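(* Let $M = D_X u$ be a left $D_X$-module generated by $u \in M$, let $f \in K[x]$ be a non-constant polynomial, and let $k\geq 0$ be an integer. Assume that the (generalized) $b$-function $b_{u,f}(s)$ for $u$ and $f$ exists. Then the following conditions are equivalent: (1) $b_{u,f}(j) \neq 0$ for every integer $j < -k$. (2) The localization $M[f^{-1}]$ is generated by $u\otimes f^{-k}$ over $D_X$. (3) The local cohomology group $H^1_{(f)}(M)$ is generated by the cohomology class $[u\otimes f^{-k}]$ over $D_X$.
   Context: $K$ is a field of characteristic zero, $K[x]=K[x_1,\dots,x_n]$, $X=K^n$, and $D_X = K[x]\langle\partial_{x_1},\dots,\partial_{x_n}\rangle$ is the $n$-th Weyl algebra. Put $f_i=\partial f/\partial x_i$. Let $s$ be an indeterminate commuting with $D_X$, and let $\mathcal{L}=K[x,f^{-1},s]f^s$ be the free $K[x,f^{-1},s]$-module with free generator $f^s$, made into a left $D_X[s]$-module by $\partial_{x_i}(a(x,s)f^{-k}f^s)=\left(\frac{\partial a(x,s)}{\partial x_i}f^{-k}+(s-k)f_i a(x,s)f^{-k-1}\right)f^s$. The tensor product $M\otimes_{K[x]}\mathcal{L}$ is a left $D_X[s]$-module via the Leibniz rule. For $k\in\mathbb{Z}$, $f^{s+k}$ denotes $f^kf^s$. The $b$-function $b_{u,f}(s)$ is the monic polynomial $b(s)\in K[s]$ of least degree such that $b(s)(u\otimes f^s)\in D_X[s](u\otimes f^{s+1})$ in $M\otimes_{K[x]}\mathcal{L}$; it is said to exist if there is a nonzero $b(s)\in K[s]$ with this property. The localization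 is $M[f^{-1}]=M\otimes_{K[x]}K[x,f^{-1}]$, a left $D_X$-module via the Leibniz rule, with canonical homomorphism $\iota:M\to M[f^{-1}]$, $\iota(v)=v\otimes 1$. The first local cohomology group with support in $f=0$ is identified with $H^1_{(f)}(M)\cong M[f^{-1}]/\iota(M)$, and $[w]$ denotes the class of $w\in M[f^{-1}]$. *)

theory Defs
  imports
    "HOL-Computational_Algebra.Polynomial"
    "HOL-Computational_Algebra.Fraction_Field"
    "HOL-Library.Poly_Mapping"
    "HOL-Algebra.UnivPoly"
    "HOL-Algebra.Free_Abelian_Groups"
begin

text \<open>
  Polynomials over \<open>'k\<close> in the variables \<open>x\<^sub>i\<close>, \<open>i :: 'n\<close>, where \<open>n\<close> is the cardinality of the finite
  type \<open>'n\<close>. The linear order on \<open>'n\<close> that is required below only lists the variables in a fixed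
  order; it also makes the library's integral domain instance for polynomials available.
\<close>

type_synonym ('n, 'k) mpoly = "('n \<Rightarrow>\<^sub>0 nat) \<Rightarrow>\<^sub>0 'k"

definition mpoly_const :: "'k::zero \<Rightarrow> ('n, 'k) mpoly" where
  "mpoly_const c = Poly_Mapping.single 0 c"

definition mpoly_deriv :: "'n \<Rightarrow> ('n, 'k::comm_ring_1) mpoly \<Rightarrow> ('n, 'k) mpoly" where
  "mpoly_deriv i p = (\<Sum>\<alpha>\<in>Poly_Mapping.keys p. Poly_Mapping.single (\<alpha> - Poly_Mapping.single i 1)
     (of_nat (Poly_Mapping.lookup \<alpha> i) * Poly_Mapping.lookup p \<alpha>))"

text \<open>
  \<open>d 1 ^^ \<alpha> 1 \<circ> \<dots> \<circ> d n ^^ \<alpha> n\<close>, with the indices in increasing order. Only commuting families \<open>d\<close> occur below.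
\<close>

definition multi_deriv ::
    "('n::{finite,linorder} \<Rightarrow> 't \<Rightarrow> 't) \<Rightarrow> ('n \<Rightarrow>\<^sub>0 nat) \<Rightarrow> 't \<Rightarrow> 't" where
  "multi_deriv d \<alpha> = foldr (\<lambda>i. d i ^^ Poly_Mapping.lookup \<alpha> i) (sorted_list_of_set UNIV)"

text \<open>
  The Weyl algebra \<open>K[x]\<langle>\<partial>\<^sub>1, \<dots>, \<partial>\<^sub>n\<rangle>\<close> as the free left \<open>K[x]\<close>-module on the monomials \<open>\<partial>\<^sup>\<alpha>\<close>: the finitely
  supported map \<open>P\<close> stands for the operator \<open>\<Sum>\<alpha>. P \<alpha> \<partial>\<^sup>\<alpha>\<close>. Beware that the multiplication \<open>(*)\<close>
  that the library provides on this type is commutative; it is not the one of the Weyl algebra.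
\<close>

type_synonym ('n, 'k) weyl = "('n \<Rightarrow>\<^sub>0 nat) \<Rightarrow>\<^sub>0 ('n, 'k) mpoly"

definition weyl_const :: "'k::zero \<Rightarrow> ('n, 'k) weyl" where
  "weyl_const c = Poly_Mapping.single 0 (mpoly_const c)"

definition weyl_mpoly :: "('n, 'k::zero) mpoly \<Rightarrow> ('n, 'k) weyl" where
  "weyl_mpoly a = Poly_Mapping.single 0 a"

definition weyl_d :: "'n \<Rightarrow> ('n, 'k::comm_ring_1) weyl" where
  "weyl_d i = Poly_Mapping.single (Poly_Mapping.single i 1) 1"

definition weyl_lmult_mpoly ::
    "('n, 'k::comm_ring_1) mpoly \<Rightarrow> ('n, 'k) weyl \<Rightarrow> ('n, 'k) weyl" where
  "weyl_lmult_mpoly a P = Poly_Mapping.map (\<lambda>b. a * b) P"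

text \<open>
  Left multiplication by \<open>\<partial>\<^sub>i\<close>, from \<open>\<partial>\<^sub>i b \<partial>\<^sup>\<beta> = b \<partial>\<^sup>\<beta> \<partial>\<^sub>i + (\<partial>b/\<partial>x\<^sub>i) \<partial>\<^sup>\<beta>\<close>. The product of the Weyl algebra is
  determined by this and by left multiplication by polynomials.
\<close>

definition weyl_lmult_d :: "'n \<Rightarrow> ('n, 'k::comm_ring_1) weyl \<Rightarrow> ('n, 'k) weyl" where
  "weyl_lmult_d i P = (\<Sum>\<beta>\<in>Poly_Mapping.keys P.
     Poly_Mapping.single (\<beta> + Poly_Mapping.single i 1) (Poly_Mapping.lookup P \<beta>)
     + Poly_Mapping.single \<beta> (mpoly_deriv i (Poly_Mapping.lookup P \<beta>)))"

definition weyl_mult ::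
    "('n::{finite,linorder}, 'k::comm_ring_1) weyl \<Rightarrow> ('n, 'k) weyl \<Rightarrow> ('n, 'k) weyl" where
  "weyl_mult P Q = (\<Sum>\<alpha>\<in>Poly_Mapping.keys P.
     weyl_lmult_mpoly (Poly_Mapping.lookup P \<alpha>) (multi_deriv weyl_lmult_d \<alpha> Q))"

definition weyl_ring :: "('n::{finite,linorder}, 'k::comm_ring_1) weyl ring" where
  "weyl_ring = \<lparr>carrier = UNIV, mult = weyl_mult, one = 1, ring.zero = 0, add = (+)\<rparr>"


lemma pm_induct [case_names zero single add]:
  fixes p :: "'a \<Rightarrow>\<^sub>0 'b::comm_monoid_add"
  assumes "P 0" "\<And>k c. P (Poly_Mapping.single k c)" "\<And>p q. P p \<Longrightarrow> P q \<Longrightarrow> P (p + q)"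
  shows "P p"
proof (induction p rule: Poly_Mapping.update_induct)
  case const
  show ?case using assms(1) by simp
next
  case (update f a b)
  have "Poly_Mapping.update a b f = f + Poly_Mapping.single a b"
    using update by (intro poly_mapping_eqI)
      (auto simp: lookup_update lookup_add lookup_single when_def in_keys_iff)
  then show ?case using update assms by simp
qed

lemma keys_sum_superset:
  assumes "finite A" "Poly_Mapping.keys p \<subseteq> A" "\<And>k. h k 0 = (0::'c::comm_monoid_add)"
  shows "(\<Sum>k\<in>Poly_Mapping.keys p. h k (Poly_Mapping.lookup p k)) = (\<Sum>k\<in>A. h k (Poly_Mapping.lookup p k))"
  using assms by (intro sum.mono_neutral_left) (auto simp: in_keys_iff)

lemma keys_sum_add:
  fixes h :: "'a \<Rightarrow> 'b::comm_monoid_add \<Rightarrow> 'c::comm_monoid_add"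
  assumes z: "\<And>k. h k 0 = 0" and a: "\<And>k b c. h k (b + c) = h k b + h k c"
  shows "(\<Sum>k\<in>Poly_Mapping.keys (p + q). h k (Poly_Mapping.lookup (p + q) k)) =
    (\<Sum>k\<in>Poly_Mapping.keys p. h k (Poly_Mapping.lookup p k)) +
    (\<Sum>k\<in>Poly_Mapping.keys q. h k (Poly_Mapping.lookup q k))"
proof -
  let ?A = "Poly_Mapping.keys p \<union> Poly_Mapping.keys q"
  have "(\<Sum>k\<in>Poly_Mapping.keys (p + q). h k (Poly_Mapping.lookup (p + q) k)) =
      (\<Sum>k\<in>?A. h k (Poly_Mapping.lookup (p + q) k))"
    by (rule keys_sum_superset) (use keys_add[of p q] z in auto)
  also have "\<dots> = (\<Sum>k\<in>?A. h k (Poly_Mapping.lookup p k)) + (\<Sum>k\<in>?A. h k (Poly_Mapping.lookup q k))"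
    by (simp add: lookup_add a sum.distrib)
  also have "(\<Sum>k\<in>?A. h k (Poly_Mapping.lookup p k)) = (\<Sum>k\<in>Poly_Mapping.keys p. h k (Poly_Mapping.lookup p k))"
    by (rule keys_sum_superset[symmetric]) (use z in auto)
  also have "(\<Sum>k\<in>?A. h k (Poly_Mapping.lookup q k)) = (\<Sum>k\<in>Poly_Mapping.keys q. h k (Poly_Mapping.lookup q k))"
    by (rule keys_sum_superset[symmetric]) (use z in auto)
  finally show ?thesis .
qed

lemma mpoly_deriv_zero [simp]: "mpoly_deriv i 0 = 0"
  by (simp add: mpoly_deriv_def)

lemma mpoly_deriv_single:
  "mpoly_deriv i (Poly_Mapping.single \<alpha> c) =
   Poly_Mapping.single (\<alpha> - Poly_Mapping.single i 1) (of_nat (Poly_Mapping.lookup \<alpha> i) * c)"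
  by (cases "c = 0") (auto simp: mpoly_deriv_def)

lemma mpoly_deriv_add: "mpoly_deriv i (p + q) = mpoly_deriv i p + mpoly_deriv i q"
  unfolding mpoly_deriv_def
  by (rule keys_sum_add[where h = "\<lambda>\<alpha> c. Poly_Mapping.single (\<alpha> - Poly_Mapping.single i 1)
     (of_nat (Poly_Mapping.lookup \<alpha> i) * c)"]) (simp_all add: single_add algebra_simps)

lemma mpoly_deriv_one [simp]: "mpoly_deriv i 1 = 0"
  using mpoly_deriv_single[of i 0 1] by simp

lemma mpoly_deriv_mult: "mpoly_deriv i (p * q) = mpoly_deriv i p * q + p * mpoly_deriv i q"
proof (induction p rule: pm_induct)
  case (single \<alpha> c)
  show ?case
  proof (induction q rule: pm_induct)
    case (single \<beta> d)
    have 1: "Poly_Mapping.lookup \<alpha> i \<noteq> 0 \<Longrightarrow>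
        \<alpha> + \<beta> - Poly_Mapping.single i 1 = \<alpha> - Poly_Mapping.single i 1 + \<beta>"
      by (intro poly_mapping_eqI) (auto simp: lookup_add lookup_minus lookup_single when_def)
    have 2: "Poly_Mapping.lookup \<beta> i \<noteq> 0 \<Longrightarrow>
        \<alpha> + \<beta> - Poly_Mapping.single i 1 = \<alpha> + (\<beta> - Poly_Mapping.single i 1)"
      by (intro poly_mapping_eqI) (auto simp: lookup_add lookup_minus lookup_single when_def)
    show ?case
      using 1 2 by (cases "Poly_Mapping.lookup \<alpha> i = 0"; cases "Poly_Mapping.lookup \<beta> i = 0")
       (auto simp: mpoly_deriv_single mult_single lookup_add algebra_simps simp flip: single_add)
  qed (simp_all add: mpoly_deriv_add algebra_simps)
qed (simp_all add: mpoly_deriv_add algebra_simps)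

lemma mpoly_deriv_commute: "mpoly_deriv i (mpoly_deriv j p) = mpoly_deriv j (mpoly_deriv i p)"
proof (induction p rule: pm_induct)
  case (single \<alpha> c)
  have "\<alpha> - Poly_Mapping.single j 1 - Poly_Mapping.single i 1 =
      \<alpha> - Poly_Mapping.single i 1 - Poly_Mapping.single j 1"
    by (intro poly_mapping_eqI) (auto simp: lookup_add lookup_minus lookup_single when_def)
  then show ?case
    by (cases "i = j") (auto simp: mpoly_deriv_single lookup_minus lookup_single when_def algebra_simps)
qed (simp_all add: mpoly_deriv_add)

lemma weyl_lmult_mpoly_lookup:
  "Poly_Mapping.lookup (weyl_lmult_mpoly a P) \<beta> = a * Poly_Mapping.lookup P \<beta>"
  by (simp add: weyl_lmult_mpoly_def Poly_Mapping.map.rep_eq when_def)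

lemma weyl_lmult_mpoly_add: "weyl_lmult_mpoly a (P + Q) = weyl_lmult_mpoly a P + weyl_lmult_mpoly a Q"
  "weyl_lmult_mpoly (a + b) P = weyl_lmult_mpoly a P + weyl_lmult_mpoly b P"
  "weyl_lmult_mpoly (a * b) P = weyl_lmult_mpoly a (weyl_lmult_mpoly b P)"
  "weyl_lmult_mpoly 1 P = P" "weyl_lmult_mpoly a 0 = 0" "weyl_lmult_mpoly 0 P = 0"
  by (intro poly_mapping_eqI; simp add: weyl_lmult_mpoly_lookup lookup_add algebra_simps)+

lemma weyl_lmult_mpoly_single: "weyl_lmult_mpoly a (Poly_Mapping.single \<beta> b) = Poly_Mapping.single \<beta> (a * b)"
  by (intro poly_mapping_eqI) (simp add: weyl_lmult_mpoly_lookup lookup_single when_def)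

lemma weyl_lmult_d_zero [simp]: "weyl_lmult_d i 0 = 0"
  by (simp add: weyl_lmult_d_def)

lemma weyl_lmult_d_single:
  "weyl_lmult_d i (Poly_Mapping.single \<beta> b) =
     Poly_Mapping.single (\<beta> + Poly_Mapping.single i 1) b + Poly_Mapping.single \<beta> (mpoly_deriv i b)"
  by (cases "b = 0") (auto simp: weyl_lmult_d_def)

lemma weyl_lmult_d_add: "weyl_lmult_d i (P + Q) = weyl_lmult_d i P + weyl_lmult_d i Q"
  unfolding weyl_lmult_d_def
  by (rule keys_sum_add[where h = "\<lambda>\<beta> b. Poly_Mapping.single (\<beta> + Poly_Mapping.single i 1) b
     + Poly_Mapping.single \<beta> (mpoly_deriv i b)"]) (simp_all add: single_add mpoly_deriv_add algebra_simps)

lemma weyl_lmult_d_commute: "weyl_lmult_d i (weyl_lmult_d j P) = weyl_lmult_d j (weyl_lmult_d i P)"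
proof (induction P rule: pm_induct)
  case (single \<beta> b)
  show ?case
    by (simp add: weyl_lmult_d_single weyl_lmult_d_add mpoly_deriv_commute[of i j] algebra_simps)
qed (simp_all add: weyl_lmult_d_add)

lemma weyl_lmult_d_leibniz:
  "weyl_lmult_d i (weyl_lmult_mpoly a P) =
     weyl_lmult_mpoly (mpoly_deriv i a) P + weyl_lmult_mpoly a (weyl_lmult_d i P)"
proof (induction P rule: pm_induct)
  case (single \<beta> b)
  show ?case
    by (simp add: weyl_lmult_d_single weyl_lmult_d_add weyl_lmult_mpoly_single weyl_lmult_mpoly_add
      mpoly_deriv_mult single_add algebra_simps)
qed (simp_all add: weyl_lmult_d_add weyl_lmult_mpoly_add algebra_simps)

text \<open>
  An abelian group with a \<open>K[x]\<close>-module structure and commuting additive operators \<open>d i\<close> satisfying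
  the Leibniz rule, that is, the data that make it a left module over the Weyl algebra.
\<close>

locale connection = abelian_group G
  for G (structure)
    and c :: "('n::{finite,linorder}, 'k::comm_ring_1) mpoly \<Rightarrow> 't \<Rightarrow> 't"
    and d :: "'n \<Rightarrow> 't \<Rightarrow> 't" +
  assumes c_closed: "x \<in> carrier G \<Longrightarrow> c a x \<in> carrier G"
    and c_l_distr: "x \<in> carrier G \<Longrightarrow> c (a + b) x = c a x \<oplus> c b x"
    and c_r_distr: "x \<in> carrier G \<Longrightarrow> y \<in> carrier G \<Longrightarrow> c a (x \<oplus> y) = c a x \<oplus> c a y"
    and c_mult: "x \<in> carrier G \<Longrightarrow> c (a * b) x = c a (c b x)"
    and c_one: "x \<in> carrier G \<Longrightarrow> c 1 x = x"
    and d_closed: "x \<in> carrier G \<Longrightarrow> d i x \<in> carrier G"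
    and d_add: "x \<in> carrier G \<Longrightarrow> y \<in> carrier G \<Longrightarrow> d i (x \<oplus> y) = d i x \<oplus> d i y"
    and d_commute: "x \<in> carrier G \<Longrightarrow> d i (d j x) = d j (d i x)"
    and d_leibniz: "x \<in> carrier G \<Longrightarrow> d i (c a x) = c (mpoly_deriv i a) x \<oplus> c a (d i x)"
begin

lemma c_zero: "x \<in> carrier G \<Longrightarrow> c 0 x = \<zero>"
  using c_l_distr[of x 0 0] c_closed[of x 0] by simp

lemma c_zero_r: "c a \<zero> = \<zero>"
  using c_r_distr[of \<zero> \<zero> a] c_closed[of \<zero> a] by simp

lemma d_zero: "d i \<zero> = \<zero>"
  using d_add[of \<zero> \<zero> i] d_closed[of \<zero> i] by simp

lemma d_pow_closed: "x \<in> carrier G \<Longrightarrow> (d i ^^ m) x \<in> carrier G"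
  by (induction m) (auto intro: d_closed)

lemma foldr_closed: "x \<in> carrier G \<Longrightarrow> foldr (\<lambda>i. d i ^^ e i) xs x \<in> carrier G"
  by (induction xs) (auto intro: d_pow_closed)

lemma md_closed: "x \<in> carrier G \<Longrightarrow> multi_deriv d \<alpha> x \<in> carrier G"
  unfolding multi_deriv_def by (rule foldr_closed)

lemma d_pow_add: "x \<in> carrier G \<Longrightarrow> y \<in> carrier G \<Longrightarrow> (d i ^^ m) (x \<oplus> y) = (d i ^^ m) x \<oplus> (d i ^^ m) y"
  by (induction m) (auto simp: d_add d_pow_closed)

lemma foldr_add: "x \<in> carrier G \<Longrightarrow> y \<in> carrier G \<Longrightarrow>
    foldr (\<lambda>i. d i ^^ e i) xs (x \<oplus> y) = foldr (\<lambda>i. d i ^^ e i) xs x \<oplus> foldr (\<lambda>i. d i ^^ e i) xs y"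
  by (induction xs) (auto simp: d_pow_add foldr_closed)

lemma md_add: "x \<in> carrier G \<Longrightarrow> y \<in> carrier G \<Longrightarrow>
    multi_deriv d \<alpha> (x \<oplus> y) = multi_deriv d \<alpha> x \<oplus> multi_deriv d \<alpha> y"
  unfolding multi_deriv_def by (rule foldr_add)

lemma d_pow_commute: "x \<in> carrier G \<Longrightarrow> d j ((d i ^^ m) x) = (d i ^^ m) (d j x)"
proof (induction m)
  case (Suc m)
  then show ?case using d_commute[of "(d i ^^ m) x" j i] by (simp add: d_pow_closed)
qed simp

lemma foldr_commute: "x \<in> carrier G \<Longrightarrow>
    d j (foldr (\<lambda>i. d i ^^ e i) xs x) = foldr (\<lambda>i. d i ^^ e i) xs (d j x)"
  by (induction xs) (auto simp: d_pow_commute foldr_closed)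

lemma foldr_Suc: "x \<in> carrier G \<Longrightarrow> distinct xs \<Longrightarrow> j \<in> set xs \<Longrightarrow>
    foldr (\<lambda>i. d i ^^ (e i + (if i = j then 1 else 0))) xs x = d j (foldr (\<lambda>i. d i ^^ e i) xs x)"
proof (induction xs)
  case (Cons y xs)
  show ?case
  proof (cases "y = j")
    case True
    have "foldr (\<lambda>i. d i ^^ (e i + (if i = j then 1 else 0))) xs x = foldr (\<lambda>i. d i ^^ e i) xs x"
      using True Cons.prems by (intro foldr_cong) auto
    then show ?thesis using True by simp
  next
    case False
    then show ?thesis using Cons by (simp add: d_pow_commute foldr_closed)
  qed
qed simp

lemma md_plus_single:
  assumes x: "x \<in> carrier G"
  shows "multi_deriv d (\<alpha> + Poly_Mapping.single j 1) x = d j (multi_deriv d \<alpha> x)"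
proof -
  have "(\<lambda>i. d i ^^ Poly_Mapping.lookup (\<alpha> + Poly_Mapping.single j 1) i) =
      (\<lambda>i. d i ^^ (Poly_Mapping.lookup \<alpha> i + (if i = j then 1 else 0)))"
    by (rule ext) (simp add: lookup_add lookup_single when_def)
  then show ?thesis
    unfolding multi_deriv_def using foldr_Suc[OF x, of "sorted_list_of_set UNIV" j] by simp
qed

lemma md_zero: "multi_deriv d 0 x = x"
proof -
  have "foldr (\<lambda>i. d i ^^ Poly_Mapping.lookup 0 i) xs x = x" for xs
    by (induction xs) auto
  then show ?thesis unfolding multi_deriv_def by simp
qed

abbreviation act where
  "act P x \<equiv> (\<Oplus>\<alpha>\<in>Poly_Mapping.keys P. c (Poly_Mapping.lookup P \<alpha>) (multi_deriv d \<alpha> x))"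

lemma act_closed: "x \<in> carrier G \<Longrightarrow> act P x \<in> carrier G"
  by (intro finsum_closed) (auto intro: c_closed md_closed)

lemma act_superset:
  assumes "x \<in> carrier G" "finite A" "Poly_Mapping.keys P \<subseteq> A"
  shows "act P x = (\<Oplus>\<alpha>\<in>A. c (Poly_Mapping.lookup P \<alpha>) (multi_deriv d \<alpha> x))"
  using assms by (intro add.finprod_mono_neutral_cong_left)
    (auto simp: in_keys_iff c_zero md_closed intro: c_closed)

lemma act_zero: "act 0 x = \<zero>"
  by simp

lemma act_single:
  assumes "x \<in> carrier G"
  shows "act (Poly_Mapping.single \<alpha> a) x = c a (multi_deriv d \<alpha> x)"
proof (cases "a = 0")
  case True
  then show ?thesis using assms by (simp add: c_zero md_closed)
next
  case False
  then show ?thesis using assms by (simp add: c_closed md_closed Pi_def)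
qed

lemma act_add:
  assumes x: "x \<in> carrier G"
  shows "act (P + Q) x = act P x \<oplus> act Q x"
proof -
  let ?A = "Poly_Mapping.keys P \<union> Poly_Mapping.keys Q"
  have "act (P + Q) x = (\<Oplus>\<alpha>\<in>?A. c (Poly_Mapping.lookup (P + Q) \<alpha>) (multi_deriv d \<alpha> x))"
    using keys_add[of P Q] x by (intro act_superset) auto
  also have "\<dots> = (\<Oplus>\<alpha>\<in>?A. c (Poly_Mapping.lookup P \<alpha>) (multi_deriv d \<alpha> x) \<oplus>
      c (Poly_Mapping.lookup Q \<alpha>) (multi_deriv d \<alpha> x))"
    by (simp add: lookup_add c_l_distr md_closed x)
  also have "\<dots> = (\<Oplus>\<alpha>\<in>?A. c (Poly_Mapping.lookup P \<alpha>) (multi_deriv d \<alpha> x)) \<oplus>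
      (\<Oplus>\<alpha>\<in>?A. c (Poly_Mapping.lookup Q \<alpha>) (multi_deriv d \<alpha> x))"
    by (intro finsum_addf) (auto intro: c_closed md_closed x)
  finally show ?thesis using x by (simp add: act_superset[of x ?A P] act_superset[of x ?A Q])
qed

lemma act_r_distr:
  assumes "x \<in> carrier G" "y \<in> carrier G"
  shows "act P (x \<oplus> y) = act P x \<oplus> act P y"
  using assms by (simp add: md_add c_r_distr md_closed c_closed finsum_addf)

lemma act_lmult_mpoly:
  assumes x: "x \<in> carrier G"
  shows "act (weyl_lmult_mpoly a P) x = c a (act P x)"
proof (induction P rule: pm_induct)
  case (single \<beta> b)
  show ?case
    using x by (simp only: weyl_lmult_mpoly_single act_single) (simp add: c_mult md_closed)
next
  case (add P Q)
  then show ?case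
    using x by (simp only: weyl_lmult_mpoly_add act_add) (simp add: act_closed c_r_distr)
qed (simp add: weyl_lmult_mpoly_add c_zero_r)

lemma act_lmult_d:
  assumes x: "x \<in> carrier G"
  shows "act (weyl_lmult_d i P) x = d i (act P x)"
proof (induction P rule: pm_induct)
  case (single \<beta> b)
  show ?case
    using x by (simp only: weyl_lmult_d_single act_single act_add md_plus_single)
      (simp add: d_leibniz md_closed c_closed d_closed a_comm)
next
  case (add P Q)
  then show ?case
    using x by (simp only: weyl_lmult_d_add act_add) (simp add: act_closed d_add)
qed (simp add: d_zero)

lemma act_lmult_md:
  assumes x: "x \<in> carrier G"
  shows "act (multi_deriv weyl_lmult_d \<alpha> Q) x = multi_deriv d \<alpha> (act Q x)"
proof -
  have p: "act ((weyl_lmult_d i ^^ m) Q) x = (d i ^^ m) (act Q x)" for i m Q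
    by (induction m) (simp_all add: act_lmult_d x)
  have "act (foldr (\<lambda>i. weyl_lmult_d i ^^ e i) xs Q) x = foldr (\<lambda>i. d i ^^ e i) xs (act Q x)" for e xs
    by (induction xs) (simp_all add: p)
  then show ?thesis unfolding multi_deriv_def .
qed

lemma act_sum:
  assumes x: "x \<in> carrier G"
  shows "finite A \<Longrightarrow> act (\<Sum>k\<in>A. F k) x = (\<Oplus>k\<in>A. act (F k) x)"
proof (induction A rule: finite_induct)
  case (insert k A)
  have "act (F k + sum F A) x = act (F k) x \<oplus> (\<Oplus>k\<in>A. act (F k) x)"
    using insert.IH act_add[OF x] by metis
  also have "\<dots> = (\<Oplus>k\<in>insert k A. act (F k) x)"
    using insert.hyps by (intro finsum_insert[symmetric]) (auto intro!: act_closed x)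
  finally show ?case unfolding sum.insert[OF insert.hyps] .
qed simp

lemma act_mult:
  assumes x: "x \<in> carrier G"
  shows "act (weyl_mult P Q) x = act P (act Q x)"
  unfolding weyl_mult_def by (simp only: act_sum[OF x] finite_keys act_lmult_mpoly[OF x] act_lmult_md[OF x])

lemma act_one: "x \<in> carrier G \<Longrightarrow> act 1 x = x"
  using act_single[of x 0 1] by (simp add: md_zero c_one)

end

lemma abelian_group_weyl: "abelian_group weyl_ring"
  by (rule abelian_groupI) (auto simp: weyl_ring_def algebra_simps intro: exI[of _ "- _"])

lemma connection_weyl:
  "connection weyl_ring weyl_lmult_mpoly (weyl_lmult_d :: _ \<Rightarrow> ('n::{finite,linorder}, 'k::comm_ring_1) weyl \<Rightarrow> _)"
  by (rule connection.intro[OF abelian_group_weyl], unfold_locales)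
    (auto simp: weyl_ring_def weyl_lmult_mpoly_add weyl_lmult_d_add weyl_lmult_d_leibniz
      intro: weyl_lmult_d_commute)

lemma finsum_weyl: "finite A \<Longrightarrow> finsum weyl_ring F A = sum F A"
proof (induction A rule: finite_induct)
  interpret abelian_group weyl_ring by (rule abelian_group_weyl)
  case empty
  show ?case using finsum_empty[of F] by (simp add: weyl_ring_def)
next
  interpret W: abelian_group weyl_ring by (rule abelian_group_weyl)
  case (insert k A)
  then show ?case using W.finsum_insert[of A k F] by (simp add: weyl_ring_def)
qed

lemma ring_weyl: "ring (weyl_ring :: ('n::{finite,linorder}, 'k::comm_ring_1) weyl ring)"
proof -
  interpret connection "weyl_ring :: ('n, 'k) weyl ring" weyl_lmult_mpoly weyl_lmult_d
    by (rule connection_weyl)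
  have act: "act P Q = weyl_mult P Q" for P Q
    by (simp add: finsum_weyl weyl_mult_def)
  have [simp]: "carrier weyl_ring = UNIV" "add weyl_ring = (+)" "monoid.mult weyl_ring = weyl_mult"
      "one weyl_ring = 1" "\<zero>\<^bsub>weyl_ring\<^esub> = 0"
    by (simp_all add: weyl_ring_def)
  have 1: "weyl_mult P 1 = P" for P :: "('n, 'k) weyl"
  proof -
    have p: "(weyl_lmult_d i ^^ m) (Poly_Mapping.single \<alpha> 1) = Poly_Mapping.single (\<alpha> + Poly_Mapping.single i m) (1 :: ('n,'k) mpoly)"
      for i m \<alpha>
      by (induction m arbitrary: \<alpha>) (simp_all add: weyl_lmult_d_single add.assoc flip: single_add)
    have "foldr (\<lambda>i. weyl_lmult_d i ^^ e i) xs 1 = Poly_Mapping.single (\<Sum>i\<leftarrow>xs. Poly_Mapping.single i (e i)) (1 :: ('n,'k) mpoly)"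
      for e xs
      by (induction xs) (simp_all add: p add.commute)
    then have "multi_deriv weyl_lmult_d \<alpha> 1 =
       Poly_Mapping.single (\<Sum>i\<leftarrow>sorted_list_of_set UNIV. Poly_Mapping.single i (Poly_Mapping.lookup \<alpha> i)) (1 :: ('n,'k) mpoly)" for \<alpha>
      unfolding multi_deriv_def by simp
    also have "(\<Sum>i\<leftarrow>sorted_list_of_set UNIV. Poly_Mapping.single i (Poly_Mapping.lookup \<alpha> i)) = \<alpha>" for \<alpha> :: "'n \<Rightarrow>\<^sub>0 nat"
      by (subst sum_list_distinct_conv_sum_set)
        (auto intro!: poly_mapping_eqI simp: lookup_sum lookup_single when_def)
    finally have m: "multi_deriv weyl_lmult_d \<alpha> 1 = Poly_Mapping.single \<alpha> (1 :: ('n,'k) mpoly)" for \<alpha> .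
    show ?thesis
      unfolding weyl_mult_def m weyl_lmult_mpoly_single
      by (intro poly_mapping_eqI) (auto simp: lookup_sum lookup_single when_def in_keys_iff)
  qed
  have 2: "weyl_mult (P + Q) R = weyl_mult P R + weyl_mult Q R"
      "weyl_mult R (P + Q) = weyl_mult R P + weyl_mult R Q"
      "weyl_mult (weyl_mult P Q) R = weyl_mult P (weyl_mult Q R)" "weyl_mult 1 P = P"
    for P Q R :: "('n, 'k) weyl"
    using act_add[of R P Q] act_r_distr[of P Q R] act_mult[of R P Q] act_one[of P]
    unfolding act by simp_all
  show ?thesis
    by (rule ringI) (auto simp: 1 2 abelian_group_weyl intro!: monoidI)
qed

lemma weyl_ring_simps [simp]:
  "carrier weyl_ring = UNIV" "\<one>\<^bsub>weyl_ring\<^esub> = 1" "\<zero>\<^bsub>weyl_ring\<^esub> = 0"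
  "P \<oplus>\<^bsub>weyl_ring\<^esub> Q = P + Q" "P \<otimes>\<^bsub>weyl_ring\<^esub> Q = weyl_mult P Q"
  by (simp_all add: weyl_ring_def)

lemma weyl_mult_single:
  "weyl_mult (Poly_Mapping.single \<alpha> a) Q = weyl_lmult_mpoly a (multi_deriv weyl_lmult_d \<alpha> Q)"
  by (cases "a = 0") (simp_all add: weyl_mult_def weyl_lmult_mpoly_add)

lemma weyl_mult_mpoly: "weyl_mult (weyl_mpoly a) Q = weyl_lmult_mpoly a Q"
proof -
  interpret connection "weyl_ring :: ('a, 'b) weyl ring" weyl_lmult_mpoly weyl_lmult_d
    by (rule connection_weyl)
  show ?thesis by (simp add: weyl_mpoly_def weyl_mult_single md_zero)
qed

lemma weyl_mult_d: "weyl_mult (weyl_d i) Q = weyl_lmult_d i Q"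
proof -
  interpret connection "weyl_ring :: ('a, 'b) weyl ring" weyl_lmult_mpoly weyl_lmult_d
    by (rule connection_weyl)
  show ?thesis
    using md_plus_single[of Q 0 i] by (simp add: weyl_d_def weyl_mult_single md_zero weyl_lmult_mpoly_add)
qed

lemma weyl_d_mpoly:
  "weyl_mult (weyl_d i) (weyl_mpoly a) = weyl_mult (weyl_mpoly a) (weyl_d i) + weyl_mpoly (mpoly_deriv i a)"
  unfolding weyl_mult_mpoly weyl_mult_d
  by (simp add: weyl_mpoly_def weyl_d_def weyl_lmult_d_single weyl_lmult_mpoly_single)

lemma weyl_d_commute: "weyl_mult (weyl_d i) (weyl_d j) = weyl_mult (weyl_d j) (weyl_d i)"
  unfolding weyl_mult_d by (simp add: weyl_d_def weyl_lmult_d_single add.commute)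

text \<open>
  The locale \<^locale>\<open>module\<close> of the library has these axioms, but over a commutative ring. As there, the
  ring multiplication and unit of the record \<open>M\<close> play no role.
\<close>

locale left_module = R?: ring R + M?: abelian_group M for R (structure) and M (structure) +
  assumes smult_closed [simp, intro]:
      "\<lbrakk>a \<in> carrier R; x \<in> carrier M\<rbrakk> \<Longrightarrow> a \<odot>\<^bsub>M\<^esub> x \<in> carrier M"
    and smult_l_distr:
      "\<lbrakk>a \<in> carrier R; b \<in> carrier R; x \<in> carrier M\<rbrakk> \<Longrightarrow>
       (a \<oplus> b) \<odot>\<^bsub>M\<^esub> x = a \<odot>\<^bsub>M\<^esub> x \<oplus>\<^bsub>M\<^esub> b \<odot>\<^bsub>M\<^esub> x"
    and smult_r_distr:
      "\<lbrakk>a \<in> carrier R; x \<in> carrier M; y \<in> carrier M\<rbrakk> \<Longrightarrow>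
       a \<odot>\<^bsub>M\<^esub> (x \<oplus>\<^bsub>M\<^esub> y) = a \<odot>\<^bsub>M\<^esub> x \<oplus>\<^bsub>M\<^esub> a \<odot>\<^bsub>M\<^esub> y"
    and smult_assoc:
      "\<lbrakk>a \<in> carrier R; b \<in> carrier R; x \<in> carrier M\<rbrakk> \<Longrightarrow>
       (a \<otimes> b) \<odot>\<^bsub>M\<^esub> x = a \<odot>\<^bsub>M\<^esub> (b \<odot>\<^bsub>M\<^esub> x)"
    and smult_one [simp]: "x \<in> carrier M \<Longrightarrow> \<one> \<odot>\<^bsub>M\<^esub> x = x"

text \<open>
  The operator \<open>\<Sum>\<alpha>. P \<alpha> \<partial>\<^sup>\<alpha>\<close> acts on \<open>G\<close>, where polynomials act through \<open>c\<close> and \<open>\<partial>\<^sub>i\<close> acts as \<open>d i\<close>.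
\<close>

definition weyl_module ::
    "('t, 'a) ring_scheme \<Rightarrow> (('n::{finite,linorder}, 'k::comm_ring_1) mpoly \<Rightarrow> 't \<Rightarrow> 't) \<Rightarrow>
     ('n \<Rightarrow> 't \<Rightarrow> 't) \<Rightarrow> (('n, 'k) weyl, 't) module" where
  "weyl_module G c d =
     \<lparr>carrier = carrier G, mult = mult G, one = one G, ring.zero = ring.zero G, add = add G,
      smult = (\<lambda>P x. \<Oplus>\<^bsub>G\<^esub>\<alpha>\<in>Poly_Mapping.keys P. c (Poly_Mapping.lookup P \<alpha>) (multi_deriv d \<alpha> x))\<rparr>"

lemma abelian_group_cong:
  assumes "abelian_group G" "carrier H = carrier G" "add H = add G" "\<zero>\<^bsub>H\<^esub> = \<zero>\<^bsub>G\<^esub>"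
  shows "abelian_group H"
proof -
  interpret abelian_group G by (rule assms(1))
  show ?thesis
    by (rule abelian_groupI) (use assms a_assoc a_comm l_neg in \<open>auto intro!: bexI[of _ "a_inv G _"]\<close>)
qed

lemma (in connection) left_module_weyl_module: "left_module weyl_ring (weyl_module G c d)"
proof (rule left_module.intro[OF ring_weyl])
  show "abelian_group (weyl_module G c d)"
    by (rule abelian_group_cong[OF abelian_group_axioms]) (simp_all add: weyl_module_def)
  have [simp]: "carrier (weyl_module G c d) = carrier G" "add (weyl_module G c d) = add G"
    by (simp_all add: weyl_module_def)
  have eq: "smult (weyl_module G c d) = (\<lambda>P x. act P x)"
    by (simp add: weyl_module_def)
  show "left_module_axioms weyl_ring (weyl_module G c d)"
    by (rule left_module_axioms.intro; simp only: eq weyl_ring_simps \<open>carrier (weyl_module G c d) = _\<close>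
      \<open>add (weyl_module G c d) = _\<close> act_closed act_add act_r_distr act_mult act_one)
qed

lemma left_module_connection:
  assumes "left_module weyl_ring M"
  shows "connection M (\<lambda>a x. weyl_mpoly a \<odot>\<^bsub>M\<^esub> x) (\<lambda>i x. weyl_d i \<odot>\<^bsub>M\<^esub> x)"
proof -
  interpret left_module weyl_ring M by (rule assms)
  have 1: "weyl_mpoly (a + b) = weyl_mpoly a + weyl_mpoly b" "weyl_mpoly 1 = 1"
    "weyl_mpoly (a * b) = weyl_mult (weyl_mpoly a) (weyl_mpoly b)" for a b
    by (simp_all add: weyl_mult_mpoly) (simp_all add: weyl_mpoly_def single_add weyl_lmult_mpoly_single)
  have l: "(P + Q) \<odot>\<^bsub>M\<^esub> x = P \<odot>\<^bsub>M\<^esub> x \<oplus>\<^bsub>M\<^esub> Q \<odot>\<^bsub>M\<^esub> x"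
    "weyl_mult P Q \<odot>\<^bsub>M\<^esub> x = P \<odot>\<^bsub>M\<^esub> (Q \<odot>\<^bsub>M\<^esub> x)" "1 \<odot>\<^bsub>M\<^esub> x = x" if "x \<in> carrier M" for P Q x
    using smult_l_distr[of P Q x] smult_assoc[of P Q x] smult_one[of x] that by simp_all
  show ?thesis
  proof (rule connection.intro[OF M.abelian_group_axioms], rule connection_axioms.intro)
    fix x i j assume x: "x \<in> carrier M"
    show "weyl_d i \<odot>\<^bsub>M\<^esub> (weyl_d j \<odot>\<^bsub>M\<^esub> x) = weyl_d j \<odot>\<^bsub>M\<^esub> (weyl_d i \<odot>\<^bsub>M\<^esub> x)"
      using x weyl_d_commute[of i j] by (metis l(2))
  next
    fix x i a assume x: "x \<in> carrier M"
    have "weyl_d i \<odot>\<^bsub>M\<^esub> (weyl_mpoly a \<odot>\<^bsub>M\<^esub> x) = weyl_mult (weyl_d i) (weyl_mpoly a) \<odot>\<^bsub>M\<^esub> x"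
      using x by (simp add: l)
    then show "weyl_d i \<odot>\<^bsub>M\<^esub> (weyl_mpoly a \<odot>\<^bsub>M\<^esub> x) =
      weyl_mpoly (mpoly_deriv i a) \<odot>\<^bsub>M\<^esub> x \<oplus>\<^bsub>M\<^esub> weyl_mpoly a \<odot>\<^bsub>M\<^esub> (weyl_d i \<odot>\<^bsub>M\<^esub> x)"
      unfolding weyl_d_mpoly using x by (simp add: l a_comm)
  qed (simp_all add: 1 l smult_r_distr)
qed

type_synonym ('n, 'k) ratfun = "('n, 'k) mpoly fract"

definition ratfun_mpoly ::
    "('n::{finite,linorder}, 'k::field_char_0) mpoly \<Rightarrow> ('n, 'k) ratfun" where
  "ratfun_mpoly a = Fract a 1"

lemma quotient_rule_identity:
  fixes a b a' b' A B A' B' :: "'a::comm_ring_1"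
  shows "(A * b - a * B) * (b' * b') - (A' * b' - a' * B') * (b * b) =
      b * b' * ((A * b' + a * B') - (A' * b + a' * B)) - (a * b' - a' * b) * (b * B' + b' * B)"
  by (simp add: algebra_simps)

lift_definition ratfun_deriv ::
    "'n \<Rightarrow> ('n::{finite,linorder}, 'k::field_char_0) ratfun \<Rightarrow> ('n, 'k) ratfun"
  is "\<lambda>i q. (mpoly_deriv i (fst q) * snd q - fst q * mpoly_deriv i (snd q), snd q * snd q)"
proof -
  fix i :: 'n and p q :: "('n, 'k) mpoly \<times> ('n, 'k) mpoly"
  assume pq: "fractrel p q"
  obtain a b a' b' where [simp]: "p = (a, b)" "q = (a', b')" by (cases p, cases q)
  have e: "a * b' = a' * b" and nz: "b \<noteq> 0" "b' \<noteq> 0" using pq by auto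
  let ?d = "mpoly_deriv i"
  have d: "?d a * b' + a * ?d b' = ?d a' * b + a' * ?d b"
    using arg_cong[OF e, of ?d] by (simp add: mpoly_deriv_mult)
  have "(?d a * b - a * ?d b) * (b' * b') - (?d a' * b' - a' * ?d b') * (b * b) =
      b * b' * ((?d a * b' + a * ?d b') - (?d a' * b + a' * ?d b))
      - (a * b' - a' * b) * (b * ?d b' + b' * ?d b)"
    by (rule quotient_rule_identity)
  also have "\<dots> = 0" using d e by simp
  finally show "fractrel (?d (fst p) * snd p - fst p * ?d (snd p), snd p * snd p)
      (?d (fst q) * snd q - fst q * ?d (snd q), snd q * snd q)"
    using nz by simp
qed

lemma ratfun_deriv_Fract:
  "b \<noteq> 0 \<Longrightarrow> ratfun_deriv i (Fract a b) = Fract (mpoly_deriv i a * b - a * mpoly_deriv i b) (b * b)"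
  by (simp add: Fract_def ratfun_deriv.abs_eq)

lemma ratfun_deriv_mpoly: "ratfun_deriv i (ratfun_mpoly a) = ratfun_mpoly (mpoly_deriv i a)"
  by (simp add: ratfun_mpoly_def ratfun_deriv_Fract)

lemma ratfun_deriv_zero [simp]: "ratfun_deriv i 0 = 0"
  by (simp add: Zero_fract_def ratfun_deriv_Fract eq_fract)

lemma ratfun_mpoly_hom:
  "ratfun_mpoly (a + b) = ratfun_mpoly a + ratfun_mpoly b"
  "ratfun_mpoly (a * b) = ratfun_mpoly a * ratfun_mpoly b"
  "ratfun_mpoly 1 = 1" "ratfun_mpoly 0 = 0" "ratfun_mpoly a = 0 \<longleftrightarrow> a = 0"
  by (simp_all add: ratfun_mpoly_def One_fract_def Zero_fract_def eq_fract)

lemma ratfun_deriv_add: "ratfun_deriv i (g + h) = ratfun_deriv i g + ratfun_deriv i h"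
  by (cases g, cases h) (simp add: ratfun_deriv_Fract mpoly_deriv_add mpoly_deriv_mult eq_fract, simp add: algebra_simps)

lemma ratfun_deriv_mult: "ratfun_deriv i (g * h) = ratfun_deriv i g * h + g * ratfun_deriv i h"
  by (cases g, cases h) (simp add: ratfun_deriv_Fract mpoly_deriv_add mpoly_deriv_mult eq_fract, simp add: algebra_simps)

lemma mpoly_deriv_uminus: "mpoly_deriv i (- p) = - mpoly_deriv i p"
  using mpoly_deriv_add[of i p "-p"] by (simp add: eq_neg_iff_add_eq_0 add.commute)

lemma mpoly_deriv_diff: "mpoly_deriv i (p - q) = mpoly_deriv i p - mpoly_deriv i q"
  using mpoly_deriv_add[of i p "-q"] by (simp add: mpoly_deriv_uminus)

lemma ratfun_deriv_commute: "ratfun_deriv i (ratfun_deriv j g) = ratfun_deriv j (ratfun_deriv i g)"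
  by (cases g) (simp add: ratfun_deriv_Fract mpoly_deriv_diff mpoly_deriv_mult eq_fract
     mpoly_deriv_commute[of i j], simp add: algebra_simps)

lemma ratfun_Fract: "b \<noteq> 0 \<Longrightarrow> Fract a b = ratfun_mpoly a / ratfun_mpoly b"
  by (simp add: ratfun_mpoly_def)

text \<open>
  \<open>K[x, f\<^sup>-\<^sup>1]\<close>, as a subring of the field of rational functions (for \<open>f \<noteq> 0\<close>).
\<close>

definition loc_carrier ::
    "('n::{finite,linorder}, 'k::field_char_0) mpoly \<Rightarrow> ('n, 'k) ratfun set" where
  "loc_carrier f = {Fract a (f ^ k) |a k. True}"

definition loc_ring ::
    "('n::{finite,linorder}, 'k::field_char_0) mpoly \<Rightarrow> ('n, 'k) ratfun ring" where
  "loc_ring f = \<lparr>carrier = loc_carrier f, mult = (*), one = 1, ring.zero = 0, add = (+)\<rparr>"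

definition loc_module ::
    "('n::{finite,linorder}, 'k::field_char_0) mpoly \<Rightarrow> (('n, 'k) weyl, ('n, 'k) ratfun) module" where
  "loc_module f = weyl_module (loc_ring f) (\<lambda>a g. ratfun_mpoly a * g) ratfun_deriv"

definition loc_s_ring ::
    "('n::{finite,linorder}, 'k::field_char_0) mpoly \<Rightarrow> ('n, 'k) ratfun poly ring" where
  "loc_s_ring f = \<lparr>carrier = {p. \<forall>j. Polynomial.coeff p j \<in> loc_carrier f},
     mult = (*), one = 1, ring.zero = 0, add = (+)\<rparr>"

text \<open>
  In \<open>L = K[x, f\<^sup>-\<^sup>1, s] f\<^sup>s\<close> the element \<open>p f\<^sup>s\<close> is represented by \<open>p\<close>, a polynomial in the
  indeterminate \<open>s\<close>. Then \<open>\<partial>\<^sub>i (p f\<^sup>s) = (\<partial>p/\<partial>x\<^sub>i + s (f\<^sub>i / f) p) f\<^sup>s\<close>; lemma \<open>fs_deriv_formula\<close> below gives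
  the value at \<open>a(x, s) f\<^sup>-\<^sup>k f\<^sup>s\<close>.
\<close>

definition fs_deriv ::
    "('n::{finite,linorder}, 'k::field_char_0) mpoly \<Rightarrow> 'n \<Rightarrow> ('n, 'k) ratfun poly \<Rightarrow> ('n, 'k) ratfun poly" where
  "fs_deriv f i p = map_poly (ratfun_deriv i) p + [:0, Fract (mpoly_deriv i f) f:] * p"

definition fs_module ::
    "('n::{finite,linorder}, 'k::field_char_0) mpoly \<Rightarrow> (('n, 'k) weyl, ('n, 'k) ratfun poly) module" where
  "fs_module f = weyl_module (loc_s_ring f) (\<lambda>a p. Polynomial.smult (ratfun_mpoly a) p) (fs_deriv f)"

lemma loc_carrierI: "Fract a (f ^ k) \<in> loc_carrier f"
  unfolding loc_carrier_def by blast

lemma loc_carrierE: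
  assumes "g \<in> loc_carrier f"
  obtains a k where "g = Fract a (f ^ k)"
  using assms unfolding loc_carrier_def by blast

lemma loc_carrier_mpoly: "ratfun_mpoly a \<in> loc_carrier f"
  using loc_carrierI[of a f 0] by (simp add: ratfun_mpoly_def)

lemma loc_carrier_0_1: "0 \<in> loc_carrier f" "1 \<in> loc_carrier f"
  using loc_carrier_mpoly[of 0 f] loc_carrier_mpoly[of 1 f] by (simp_all add: ratfun_mpoly_hom)

lemma loc_carrier_add:
  assumes "f \<noteq> 0" "g \<in> loc_carrier f" "h \<in> loc_carrier f"
  shows "g + h \<in> loc_carrier f"
  using assms(2,3)
  by (elim loc_carrierE) (use assms(1) in \<open>simp add: loc_carrierI flip: power_add\<close>)

lemma loc_carrier_mult:
  assumes "g \<in> loc_carrier f" "h \<in> loc_carrier f"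
  shows "g * h \<in> loc_carrier f"
  using assms by (elim loc_carrierE) (simp add: loc_carrierI flip: power_add)

lemma loc_carrier_uminus: "g \<in> loc_carrier f \<Longrightarrow> - g \<in> loc_carrier f"
  by (elim loc_carrierE) (simp add: loc_carrierI)

lemma loc_carrier_deriv: "f \<noteq> 0 \<Longrightarrow> g \<in> loc_carrier f \<Longrightarrow> ratfun_deriv i g \<in> loc_carrier f"
  by (elim loc_carrierE) (simp add: ratfun_deriv_Fract loc_carrierI flip: power_add)

lemma abelian_group_loc_ring: "f \<noteq> 0 \<Longrightarrow> abelian_group (loc_ring f)"
  by (rule abelian_groupI)
    (auto simp: loc_ring_def loc_carrier_add loc_carrier_0_1 algebra_simps intro!: bexI[of _ "- _"] loc_carrier_uminus)

lemma abelian_group_loc_s_ring: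
  assumes f: "f \<noteq> 0"
  shows "abelian_group (loc_s_ring f)"
proof (rule abelian_groupI)
  fix p assume "p \<in> carrier (loc_s_ring f)"
  then show "\<exists>q\<in>carrier (loc_s_ring f). q \<oplus>\<^bsub>loc_s_ring f\<^esub> p = \<zero>\<^bsub>loc_s_ring f\<^esub>"
    by (intro bexI[of _ "- p"]) (auto simp: loc_s_ring_def loc_carrier_uminus)
qed (auto simp: loc_s_ring_def loc_carrier_add[OF f] loc_carrier_0_1 algebra_simps)

lemma left_module_loc_module:
  assumes f: "f \<noteq> 0"
  shows "left_module weyl_ring (loc_module f)"
  unfolding loc_module_def
  by (rule connection.left_module_weyl_module, rule connection.intro[OF abelian_group_loc_ring[OF f]], rule connection_axioms.intro)
    (auto simp: loc_ring_def ratfun_mpoly_hom ratfun_deriv_add ratfun_deriv_mult ratfun_deriv_mpoly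
       loc_carrier_mult loc_carrier_mpoly loc_carrier_deriv[OF f] algebra_simps intro: ratfun_deriv_commute)

lemma coeff_fs_deriv:
  "Polynomial.coeff (fs_deriv f i p) j = ratfun_deriv i (Polynomial.coeff p j) +
    (case j of 0 \<Rightarrow> 0 | Suc l \<Rightarrow> Fract (mpoly_deriv i f) f * Polynomial.coeff p l)"
  by (simp add: fs_deriv_def coeff_map_poly coeff_pCons split: nat.split)

lemma fs_deriv_formula:
  assumes f: "f \<noteq> 0"
  shows "fs_deriv f i (Polynomial.smult (inverse (ratfun_mpoly f) ^ k) (map_poly ratfun_mpoly a)) =
    Polynomial.smult (inverse (ratfun_mpoly f) ^ k) (map_poly ratfun_mpoly (map_poly (mpoly_deriv i) a)) +
    [:- of_nat k, 1:] * Polynomial.smult (ratfun_mpoly (mpoly_deriv i f) * inverse (ratfun_mpoly f) ^ (k + 1))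
      (map_poly ratfun_mpoly a)"
proof (rule poly_eqI)
  fix j
  let ?F = "ratfun_mpoly f" and ?G = "ratfun_mpoly (mpoly_deriv i f)"
  have F: "?F \<noteq> 0" using f by (simp add: ratfun_mpoly_hom)
  have "ratfun_deriv i (inverse ?F) * ?F + inverse ?F * ?G = 0"
  proof -
    have "ratfun_deriv i (inverse ?F * ?F) = ratfun_deriv i (ratfun_mpoly 1)"
      using F by (simp add: ratfun_mpoly_hom)
    then show ?thesis
      by (simp only: ratfun_deriv_mult ratfun_deriv_mpoly) (simp add: ratfun_mpoly_hom)
  qed
  then have "ratfun_deriv i (inverse ?F) = - ?G * inverse ?F * inverse ?F"
    using F by (simp add: field_simps eq_neg_iff_add_eq_0)
  then have D: "ratfun_deriv i (inverse ?F ^ k) = - of_nat k * ?G * inverse ?F ^ (k + 1)"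
  proof (induction k)
    case 0
    show ?case using ratfun_deriv_mpoly[of i 1] by (simp add: ratfun_mpoly_hom)
  next
    case (Suc k)
    then show ?case by (simp add: ratfun_deriv_mult algebra_simps)
  qed
  show "Polynomial.coeff (fs_deriv f i (Polynomial.smult (inverse ?F ^ k) (map_poly ratfun_mpoly a))) j =
    Polynomial.coeff (Polynomial.smult (inverse ?F ^ k) (map_poly ratfun_mpoly (map_poly (mpoly_deriv i) a)) +
    [:- of_nat k, 1:] * Polynomial.smult (?G * inverse ?F ^ (k + 1)) (map_poly ratfun_mpoly a)) j"
    by (cases j) (simp_all add: coeff_fs_deriv coeff_map_poly ratfun_mpoly_hom ratfun_deriv_mult D
      ratfun_deriv_mpoly ratfun_Fract[OF f] divide_inverse algebra_simps)
qed

lemma fs_connection: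
  assumes f: "f \<noteq> 0"
  shows "connection (loc_s_ring f) (\<lambda>a p. Polynomial.smult (ratfun_mpoly a) p) (fs_deriv f)"
proof -
  let ?g = "\<lambda>i. Fract (mpoly_deriv i f) f"
  have g: "?g i \<in> loc_carrier f" for i
    using loc_carrierI[of "mpoly_deriv i f" f 1] by simp
  have gg: "ratfun_deriv i (?g j) = ratfun_deriv j (?g i)" for i j
    using f by (simp add: ratfun_deriv_Fract mpoly_deriv_commute[of i j] mult.commute)
  have closed: "fs_deriv f i p \<in> carrier (loc_s_ring f)" if "p \<in> carrier (loc_s_ring f)" for i p
    using that by (auto simp: loc_s_ring_def coeff_fs_deriv loc_carrier_deriv[OF f] loc_carrier_add[OF f]
      loc_carrier_mult g split: nat.split)
  have com: "fs_deriv f i (fs_deriv f j p) = fs_deriv f j (fs_deriv f i p)" for i j p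
  proof (rule poly_eqI)
    fix l
    show "Polynomial.coeff (fs_deriv f i (fs_deriv f j p)) l = Polynomial.coeff (fs_deriv f j (fs_deriv f i p)) l"
      by (cases l; cases "l - 1") (auto simp: coeff_fs_deriv ratfun_deriv_add ratfun_deriv_mult
        ratfun_deriv_commute[of i j] gg[of i j] algebra_simps)
  qed
  have add: "fs_deriv f i (p + q) = fs_deriv f i p + fs_deriv f i q" for i p q
    by (rule poly_eqI) (simp add: coeff_fs_deriv ratfun_deriv_add algebra_simps split: nat.split)
  have lei: "fs_deriv f i (Polynomial.smult (ratfun_mpoly a) p) =
     Polynomial.smult (ratfun_mpoly (mpoly_deriv i a)) p + Polynomial.smult (ratfun_mpoly a) (fs_deriv f i p)" for i a p
    by (rule poly_eqI) (simp add: coeff_fs_deriv ratfun_deriv_mult ratfun_deriv_mpoly algebra_simps split: nat.split)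
  show ?thesis
  proof (rule connection.intro[OF abelian_group_loc_s_ring[OF f]], rule connection_axioms.intro)
  qed (use closed com add lei in \<open>auto simp: ratfun_mpoly_hom loc_s_ring_def loc_carrier_mult loc_carrier_mpoly
     smult_add_left smult_add_right\<close>)
qed

lemma left_module_fs_module: "f \<noteq> 0 \<Longrightarrow> left_module weyl_ring (fs_module f)"
  unfolding fs_module_def by (rule connection.left_module_weyl_module[OF fs_connection])

text \<open>
  The tensor product over \<open>K[x]\<close> of two left modules over the Weyl algebra: the free abelian group on
  the pairs modulo the bilinearity relations, so that its elements are cosets. \<open>tensor_elem\<close> gives the
  pure tensors, and \<open>tensor_map M N \<phi>\<close> is the map induced by the assignment \<open>(m, v) \<mapsto> \<phi> m v\<close>.
\<close>

definition tensor_free :: "('r, 't, 'a) module_scheme \<Rightarrow> ('r, 'u, 'b) module_scheme \<Rightarrow>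
    ('t \<times> 'u \<Rightarrow>\<^sub>0 int) monoid" where
  "tensor_free M N = free_Abelian_group (carrier M \<times> carrier N)"

definition tensor_rel ::
    "(('n, 'k::comm_ring_1) weyl, 't, 'a) module_scheme \<Rightarrow> (('n, 'k) weyl, 'u, 'b) module_scheme \<Rightarrow>
     ('t \<times> 'u \<Rightarrow>\<^sub>0 int) set" where
  "tensor_rel M N = generate (tensor_free M N)
     ({frag_of (m \<oplus>\<^bsub>M\<^esub> m', v) - frag_of (m, v) - frag_of (m', v) |m m' v.
         m \<in> carrier M \<and> m' \<in> carrier M \<and> v \<in> carrier N} \<union>
      {frag_of (m, v \<oplus>\<^bsub>N\<^esub> v') - frag_of (m, v) - frag_of (m, v') |m v v'.
         m \<in> carrier M \<and> v \<in> carrier N \<and> v' \<in> carrier N} \<union>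
      {frag_of (weyl_mpoly a \<odot>\<^bsub>M\<^esub> m, v) - frag_of (m, weyl_mpoly a \<odot>\<^bsub>N\<^esub> v) |a m v.
         m \<in> carrier M \<and> v \<in> carrier N})"

definition tensor_class ::
    "(('n, 'k::comm_ring_1) weyl, 't, 'a) module_scheme \<Rightarrow> (('n, 'k) weyl, 'u, 'b) module_scheme \<Rightarrow>
     ('t \<times> 'u \<Rightarrow>\<^sub>0 int) \<Rightarrow> ('t \<times> 'u \<Rightarrow>\<^sub>0 int) set" where
  "tensor_class M N z = tensor_rel M N #>\<^bsub>tensor_free M N\<^esub> z"

definition tensor_elem ::
    "(('n, 'k::comm_ring_1) weyl, 't, 'a) module_scheme \<Rightarrow> (('n, 'k) weyl, 'u, 'b) module_scheme \<Rightarrow>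
     't \<Rightarrow> 'u \<Rightarrow> ('t \<times> 'u \<Rightarrow>\<^sub>0 int) set" where
  "tensor_elem M N m v = tensor_class M N (frag_of (m, v))"

definition tensor_group ::
    "(('n, 'k::comm_ring_1) weyl, 't, 'a) module_scheme \<Rightarrow> (('n, 'k) weyl, 'u, 'b) module_scheme \<Rightarrow>
     ('t \<times> 'u \<Rightarrow>\<^sub>0 int) set ring" where
  "tensor_group M N = (let G = tensor_free M N Mod tensor_rel M N in
     \<lparr>carrier = carrier G, mult = undefined, one = undefined, ring.zero = \<one>\<^bsub>G\<^esub>, add = mult G\<rparr>)"

definition tensor_map ::
    "(('n, 'k::comm_ring_1) weyl, 't, 'a) module_scheme \<Rightarrow> (('n, 'k) weyl, 'u, 'b) module_scheme \<Rightarrow>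
     ('t \<Rightarrow> 'u \<Rightarrow> ('t \<times> 'u \<Rightarrow>\<^sub>0 int)) \<Rightarrow> ('t \<times> 'u \<Rightarrow>\<^sub>0 int) set \<Rightarrow> ('t \<times> 'u \<Rightarrow>\<^sub>0 int) set" where
  "tensor_map M N \<phi> C = (\<Union>z\<in>C. tensor_class M N (frag_extend (\<lambda>(m, v). \<phi> m v) z))"

text \<open>
  The action of the Weyl algebra by \<open>a (m \<otimes> v) = a m \<otimes> v\<close> and the Leibniz rule
  \<open>\<partial>\<^sub>i (m \<otimes> v) = \<partial>\<^sub>i m \<otimes> v + m \<otimes> \<partial>\<^sub>i v\<close>.
\<close>

definition tensor_module ::
    "(('n::{finite,linorder}, 'k::comm_ring_1) weyl, 't, 'a) module_scheme \<Rightarrow>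
     (('n, 'k) weyl, 'u, 'b) module_scheme \<Rightarrow>
     (('n, 'k) weyl, ('t \<times> 'u \<Rightarrow>\<^sub>0 int) set) module" where
  "tensor_module M N = weyl_module (tensor_group M N)
     (\<lambda>a. tensor_map M N (\<lambda>m v. frag_of (weyl_mpoly a \<odot>\<^bsub>M\<^esub> m, v)))
     (\<lambda>i. tensor_map M N (\<lambda>m v. frag_of (weyl_d i \<odot>\<^bsub>M\<^esub> m, v) + frag_of (m, weyl_d i \<odot>\<^bsub>N\<^esub> v)))"


locale tensor =
  fixes M :: "(('n::{finite,linorder}, 'k::comm_ring_1) weyl, 't, 'a) module_scheme"
    and N :: "(('n, 'k) weyl, 'u, 'b) module_scheme"
  assumes M: "left_module weyl_ring M" and N: "left_module weyl_ring N"
begin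

sublocale M: connection M "\<lambda>a x. weyl_mpoly a \<odot>\<^bsub>M\<^esub> x" "\<lambda>i x. weyl_d i \<odot>\<^bsub>M\<^esub> x"
  by (rule left_module_connection[OF M])

sublocale N: connection N "\<lambda>a x. weyl_mpoly a \<odot>\<^bsub>N\<^esub> x" "\<lambda>i x. weyl_d i \<odot>\<^bsub>N\<^esub> x"
  by (rule left_module_connection[OF N])

abbreviation F where "F \<equiv> carrier (tensor_free M N)"
abbreviation R where "R \<equiv> tensor_rel M N"
abbreviation cls where "cls \<equiv> tensor_class M N"

sublocale free: comm_group "tensor_free M N"
  unfolding tensor_free_def by (rule abelian_free_Abelian_group)

lemma F_simps [simp]:
  "x \<otimes>\<^bsub>tensor_free M N\<^esub> y = x + y" "\<one>\<^bsub>tensor_free M N\<^esub> = 0"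
  by (simp_all add: tensor_free_def)

lemma F_frag: "m \<in> carrier M \<Longrightarrow> v \<in> carrier N \<Longrightarrow> frag_of (m, v) \<in> F"
  by (simp add: tensor_free_def)

lemma F_add: "x \<in> F \<Longrightarrow> y \<in> F \<Longrightarrow> x + y \<in> F"
  using free.m_closed[of x y] by simp

lemma F_uminus: "x \<in> F \<Longrightarrow> - x \<in> F"
  by (simp add: tensor_free_def)

lemma F_diff: "x \<in> F \<Longrightarrow> y \<in> F \<Longrightarrow> x - y \<in> F"
  using F_add[of x "- y"] F_uminus[of y] by simp

lemma F_zero: "0 \<in> F"
  by (simp add: tensor_free_def)

lemma inv_F: "x \<in> F \<Longrightarrow> inv\<^bsub>tensor_free M N\<^esub> x = - x"
  by (simp add: tensor_free_def)

definition gens where "gens =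
     {frag_of (m \<oplus>\<^bsub>M\<^esub> m', v) - frag_of (m, v) - frag_of (m', v) |m m' v.
         m \<in> carrier M \<and> m' \<in> carrier M \<and> v \<in> carrier N} \<union>
      {frag_of (m, v \<oplus>\<^bsub>N\<^esub> v') - frag_of (m, v) - frag_of (m, v') |m v v'.
         m \<in> carrier M \<and> v \<in> carrier N \<and> v' \<in> carrier N} \<union>
      {frag_of (weyl_mpoly a \<odot>\<^bsub>M\<^esub> m, v) - frag_of (m, weyl_mpoly a \<odot>\<^bsub>N\<^esub> v) |a m v.
         m \<in> carrier M \<and> v \<in> carrier N}"

lemma gens_F: "gens \<subseteq> F"
  unfolding gens_def by (auto intro!: F_diff F_frag M.c_closed N.c_closed)

lemma R_gens: "R = generate (tensor_free M N) gens"
  unfolding tensor_rel_def gens_def ..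

lemma R_subgroup: "subgroup R (tensor_free M N)"
  unfolding R_gens by (rule free.generate_is_subgroup[OF gens_F])

lemma R_F: "x \<in> R \<Longrightarrow> x \<in> F"
  using subgroup.subset[OF R_subgroup] by blast

lemma R_zero: "0 \<in> R"
  using subgroup.one_closed[OF R_subgroup] by simp

lemma R_add: "x \<in> R \<Longrightarrow> y \<in> R \<Longrightarrow> x + y \<in> R"
  using subgroup.m_closed[OF R_subgroup, of x y] by simp

lemma R_uminus: "x \<in> R \<Longrightarrow> - x \<in> R"
  using subgroup.m_inv_closed[OF R_subgroup, of x] inv_F[OF R_F, of x] by simp

lemma R_diff: "x \<in> R \<Longrightarrow> y \<in> R \<Longrightarrow> x - y \<in> R"
  using R_add[of x "- y"] R_uminus[of y] by simp

lemma R_normal: "R \<lhd> tensor_free M N"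
  using R_subgroup free.normal_iff_subgroup by blast

lemma R_rel1: "m \<in> carrier M \<Longrightarrow> m' \<in> carrier M \<Longrightarrow> v \<in> carrier N \<Longrightarrow>
    frag_of (m \<oplus>\<^bsub>M\<^esub> m', v) - frag_of (m, v) - frag_of (m', v) \<in> R"
  unfolding R_gens by (rule generate.incl) (auto simp: gens_def)

lemma R_rel2: "m \<in> carrier M \<Longrightarrow> v \<in> carrier N \<Longrightarrow> v' \<in> carrier N \<Longrightarrow>
    frag_of (m, v \<oplus>\<^bsub>N\<^esub> v') - frag_of (m, v) - frag_of (m, v') \<in> R"
  unfolding R_gens by (rule generate.incl) (auto simp: gens_def)

lemma R_rel3: "m \<in> carrier M \<Longrightarrow> v \<in> carrier N \<Longrightarrow>
    frag_of (weyl_mpoly a \<odot>\<^bsub>M\<^esub> m, v) - frag_of (m, weyl_mpoly a \<odot>\<^bsub>N\<^esub> v) \<in> R"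
  unfolding R_gens by (rule generate.incl) (auto simp: gens_def)

lemma cls_eq: "cls z = {r + z |r. r \<in> R}"
  by (auto simp: tensor_class_def r_coset_def)

lemma cls_self: "z \<in> cls z"
  unfolding cls_eq using R_zero by force

lemma cls_cong: "cls z = cls w \<longleftrightarrow> z - w \<in> R"
proof
  assume "cls z = cls w"
  then have "z \<in> cls w" using cls_self[of z] by simp
  then show "z - w \<in> R" unfolding cls_eq by auto
next
  assume zw: "z - w \<in> R"
  show "cls z = cls w"
  proof (intro Set.set_eqI iffI)
    fix x assume "x \<in> cls z"
    then obtain r where "x = r + z" "r \<in> R" unfolding cls_eq by auto
    then show "x \<in> cls w" unfolding cls_eq using R_add[OF _ zw, of r] by (auto intro!: exI[of _ "r + (z - w)"])
  next
    fix x assume "x \<in> cls w"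
    then obtain r where "x = r + w" "r \<in> R" unfolding cls_eq by auto
    then show "x \<in> cls z" unfolding cls_eq using R_diff[OF _ zw, of r] by (auto intro!: exI[of _ "r - (z - w)"])
  qed
qed

lemma T_carrier: "carrier (tensor_group M N) = cls ` F"
  by (auto simp: tensor_group_def FactGroup_def RCOSETS_def tensor_class_def)

lemma T_zero: "\<zero>\<^bsub>tensor_group M N\<^esub> = cls 0"
  by (simp add: tensor_group_def FactGroup_def cls_eq)

lemma T_add: "cls z \<oplus>\<^bsub>tensor_group M N\<^esub> cls w = cls (z + w)"
proof -
  have "cls z \<oplus>\<^bsub>tensor_group M N\<^esub> cls w = (\<Union>h\<in>cls z. \<Union>k\<in>cls w. {h + k})"
    by (simp add: tensor_group_def FactGroup_def set_mult_def)
  also have "\<dots> = cls (z + w)"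
  proof (intro Set.set_eqI iffI)
    fix x assume "x \<in> (\<Union>h\<in>cls z. \<Union>k\<in>cls w. {h + k})"
    then obtain r s where "x = (r + z) + (s + w)" "r \<in> R" "s \<in> R" unfolding cls_eq by auto
    then show "x \<in> cls (z + w)" unfolding cls_eq using R_add[of r s]
      by (auto intro!: exI[of _ "r + s"])
  next
    fix x assume "x \<in> cls (z + w)"
    then obtain r where "x = (r + z) + w" "r \<in> R" unfolding cls_eq by (auto simp: add.assoc)
    then show "x \<in> (\<Union>h\<in>cls z. \<Union>k\<in>cls w. {h + k})"
      using cls_self[of w] unfolding cls_eq by blast
  qed
  finally show ?thesis .
qed

lemma T_abelian_group: "abelian_group (tensor_group M N)"
proof (rule abelian_groupI)
  fix C assume "C \<in> carrier (tensor_group M N)"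
  then obtain z where "C = cls z" "z \<in> F" unfolding T_carrier by auto
  then show "\<exists>D\<in>carrier (tensor_group M N). D \<oplus>\<^bsub>tensor_group M N\<^esub> C = \<zero>\<^bsub>tensor_group M N\<^esub>"
    by (intro bexI[of _ "cls (- z)"]) (auto simp: T_add T_zero T_carrier F_uminus)
qed (auto simp: T_carrier T_add T_zero F_add F_zero algebra_simps)

lemma F_induct [consumes 1, case_names zero one diff]:
  assumes "z \<in> F" "P 0" "\<And>m v. m \<in> carrier M \<Longrightarrow> v \<in> carrier N \<Longrightarrow> P (frag_of (m, v))"
    "\<And>x y. P x \<Longrightarrow> P y \<Longrightarrow> P (x - y)"
  shows "P z"
proof -
  have "Poly_Mapping.keys z \<subseteq> carrier M \<times> carrier N" using assms(1) by (simp add: tensor_free_def)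
  then show ?thesis
    by (induction z rule: frag_induction) (use assms in auto)
qed

abbreviation ext where "ext \<phi> \<equiv> frag_extend (\<lambda>(m, v). \<phi> m v)"

definition balanced where
  "balanced \<phi> \<longleftrightarrow> (\<forall>m\<in>carrier M. \<forall>v\<in>carrier N. \<phi> m v \<in> F) \<and> (\<forall>g\<in>gens. ext \<phi> g \<in> R)"

lemma balancedI:
  assumes "\<And>m v. m \<in> carrier M \<Longrightarrow> v \<in> carrier N \<Longrightarrow> \<phi> m v \<in> F"
    and "\<And>m m' v. m \<in> carrier M \<Longrightarrow> m' \<in> carrier M \<Longrightarrow> v \<in> carrier N \<Longrightarrow>
      \<phi> (m \<oplus>\<^bsub>M\<^esub> m') v - \<phi> m v - \<phi> m' v \<in> R"
    and "\<And>m v v'. m \<in> carrier M \<Longrightarrow> v \<in> carrier N \<Longrightarrow> v' \<in> carrier N \<Longrightarrow>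
      \<phi> m (v \<oplus>\<^bsub>N\<^esub> v') - \<phi> m v - \<phi> m v' \<in> R"
    and "\<And>a m v. m \<in> carrier M \<Longrightarrow> v \<in> carrier N \<Longrightarrow>
      \<phi> (weyl_mpoly a \<odot>\<^bsub>M\<^esub> m) v - \<phi> m (weyl_mpoly a \<odot>\<^bsub>N\<^esub> v) \<in> R"
  shows "balanced \<phi>"
  using assms unfolding balanced_def gens_def by (auto simp: frag_extend_diff)

lemma ext_F:
  assumes "balanced \<phi>" "z \<in> F"
  shows "ext \<phi> z \<in> F"
  using assms(2,1)
  by (induction z rule: F_induct) (auto simp: balanced_def F_zero F_diff frag_extend_diff)

lemma ext_R: "balanced \<phi> \<Longrightarrow> z \<in> R \<Longrightarrow> ext \<phi> z \<in> R"
proof -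
  assume b: "balanced \<phi>" and z: "z \<in> R"
  from z show ?thesis unfolding R_gens
  proof (induction z rule: generate.induct)
    case one
    then show ?case using R_zero R_gens by simp
  next
    case (incl h)
    then show ?case using b R_gens by (simp add: balanced_def)
  next
    case (inv h)
    then have "h \<in> F" "ext \<phi> h \<in> R" using b gens_F by (auto simp: balanced_def)
    then show ?case using R_uminus[of "ext \<phi> h"] R_gens by (simp add: inv_F frag_extend_minus)
  next
    case (eng h1 h2)
    then show ?case using R_add R_gens by (simp add: frag_extend_add)
  qed
qed

lemma tensor_map_cls:
  assumes b: "balanced \<phi>" and z: "z \<in> F"
  shows "tensor_map M N \<phi> (cls z) = cls (ext \<phi> z)"
proof -
  have "cls (ext \<phi> w) = cls (ext \<phi> z)" if "w \<in> cls z" for w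
  proof -
    obtain r where "w = r + z" "r \<in> R" using \<open>w \<in> cls z\<close> unfolding cls_eq by auto
    then show ?thesis unfolding cls_cong using ext_R[OF b] by (simp add: frag_extend_add)
  qed
  then show ?thesis unfolding tensor_map_def using cls_self[of z] by blast
qed

definition lscal where "lscal a m v = frag_of (weyl_mpoly a \<odot>\<^bsub>M\<^esub> m, v)"
definition leib where "leib i m v = frag_of (weyl_d i \<odot>\<^bsub>M\<^esub> m, v) + frag_of (m, weyl_d i \<odot>\<^bsub>N\<^esub> v)"

lemma R_sumI: "x - y - z \<in> R \<Longrightarrow> x' - y' - z' \<in> R \<Longrightarrow> (x + x') - (y + y') - (z + z') \<in> R"
  using R_add[of "x - y - z" "x' - y' - z'"] by (simp add: algebra_simps)

lemma balanced_lscal: "balanced (lscal a)"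
proof (rule balancedI; unfold lscal_def)
  fix b m v assume mv: "m \<in> carrier M" "v \<in> carrier N"
  have "weyl_mpoly a \<odot>\<^bsub>M\<^esub> (weyl_mpoly b \<odot>\<^bsub>M\<^esub> m) = weyl_mpoly b \<odot>\<^bsub>M\<^esub> (weyl_mpoly a \<odot>\<^bsub>M\<^esub> m)"
    using mv M.c_mult[of m a b] M.c_mult[of m b a] by (simp add: mult.commute)
  then show "frag_of (weyl_mpoly a \<odot>\<^bsub>M\<^esub> (weyl_mpoly b \<odot>\<^bsub>M\<^esub> m), v) -
      frag_of (weyl_mpoly a \<odot>\<^bsub>M\<^esub> m, weyl_mpoly b \<odot>\<^bsub>N\<^esub> v) \<in> R"
    using R_rel3[of "weyl_mpoly a \<odot>\<^bsub>M\<^esub> m" v b] mv by (simp add: M.c_closed)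
qed (auto simp: M.c_r_distr M.c_closed R_rel1 R_rel2 F_frag)

lemma balanced_leib: "balanced (leib i)"
proof (rule balancedI; unfold leib_def)
  fix m v assume mv: "m \<in> carrier M" "v \<in> carrier N"
  show "frag_of (weyl_d i \<odot>\<^bsub>M\<^esub> m, v) + frag_of (m, weyl_d i \<odot>\<^bsub>N\<^esub> v) \<in> F"
    using mv by (auto intro!: F_add F_frag M.d_closed N.d_closed)
next
  fix m m' v assume mv: "m \<in> carrier M" "m' \<in> carrier M" "v \<in> carrier N"
  show "frag_of (weyl_d i \<odot>\<^bsub>M\<^esub> (m \<oplus>\<^bsub>M\<^esub> m'), v) + frag_of (m \<oplus>\<^bsub>M\<^esub> m', weyl_d i \<odot>\<^bsub>N\<^esub> v) -
     (frag_of (weyl_d i \<odot>\<^bsub>M\<^esub> m, v) + frag_of (m, weyl_d i \<odot>\<^bsub>N\<^esub> v)) -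
     (frag_of (weyl_d i \<odot>\<^bsub>M\<^esub> m', v) + frag_of (m', weyl_d i \<odot>\<^bsub>N\<^esub> v)) \<in> R"
    using mv by (intro R_sumI) (simp_all add: M.d_add R_rel1 M.d_closed N.d_closed)
next
  fix m v v' assume mv: "m \<in> carrier M" "v \<in> carrier N" "v' \<in> carrier N"
  show "frag_of (weyl_d i \<odot>\<^bsub>M\<^esub> m, v \<oplus>\<^bsub>N\<^esub> v') + frag_of (m, weyl_d i \<odot>\<^bsub>N\<^esub> (v \<oplus>\<^bsub>N\<^esub> v')) -
     (frag_of (weyl_d i \<odot>\<^bsub>M\<^esub> m, v) + frag_of (m, weyl_d i \<odot>\<^bsub>N\<^esub> v)) -
     (frag_of (weyl_d i \<odot>\<^bsub>M\<^esub> m, v') + frag_of (m, weyl_d i \<odot>\<^bsub>N\<^esub> v')) \<in> R"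
    using mv by (intro R_sumI) (simp_all add: N.d_add R_rel2 M.d_closed N.d_closed)
next
  fix a m v assume mv: "m \<in> carrier M" "v \<in> carrier N"
  let ?c = "\<lambda>x. weyl_mpoly a \<odot>\<^bsub>M\<^esub> x" and ?d = "\<lambda>x. weyl_d i \<odot>\<^bsub>M\<^esub> x" and ?a' = "mpoly_deriv i a"
  let ?cN = "\<lambda>x. weyl_mpoly a \<odot>\<^bsub>N\<^esub> x" and ?dN = "\<lambda>x. weyl_d i \<odot>\<^bsub>N\<^esub> x"
  let ?x = "weyl_mpoly ?a' \<odot>\<^bsub>M\<^esub> m" and ?y = "weyl_mpoly ?a' \<odot>\<^bsub>N\<^esub> v"
  have 1: "?d (?c m) = ?x \<oplus>\<^bsub>M\<^esub> ?c (?d m)" "?dN (?cN v) = ?y \<oplus>\<^bsub>N\<^esub> ?cN (?dN v)"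
    using mv by (simp_all add: M.d_leibniz N.d_leibniz)
  have cl: "?x \<in> carrier M" "?y \<in> carrier N" "?c (?d m) \<in> carrier M" "?cN (?dN v) \<in> carrier N"
     "?d m \<in> carrier M" "?dN v \<in> carrier N"
    using mv by (simp_all add: M.c_closed N.c_closed M.d_closed N.d_closed)
  have "(frag_of (?x \<oplus>\<^bsub>M\<^esub> ?c (?d m), v) - frag_of (?x, v) - frag_of (?c (?d m), v))
     + (frag_of (?x, v) - frag_of (m, ?y))
     + (frag_of (?c (?d m), v) - frag_of (?d m, ?cN v))
     + (frag_of (?c m, ?dN v) - frag_of (m, ?cN (?dN v)))
     - (frag_of (m, ?y \<oplus>\<^bsub>N\<^esub> ?cN (?dN v)) - frag_of (m, ?y) - frag_of (m, ?cN (?dN v))) \<in> R"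
    by (intro R_add R_diff[of _ "_ - _ - _"] R_rel1 R_rel2 R_rel3 mv cl)
  then show "frag_of (?d (?c m), v) + frag_of (?c m, ?dN v) -
     (frag_of (?d m, ?cN v) + frag_of (m, ?dN (?cN v))) \<in> R"
    unfolding 1 by (simp add: algebra_simps)
qed

lemma ext_compose_rel:
  assumes z: "z \<in> F"
    and "\<And>m v. m \<in> carrier M \<Longrightarrow> v \<in> carrier N \<Longrightarrow> A (frag_of (m, v)) \<in> R"
    and "\<And>x y. A (x - y) = A x - A y"
  shows "A z \<in> R"
  using z
proof (induction z rule: F_induct)
  case zero
  then show ?case using assms(3)[of 0 0] R_zero by simp
qed (auto simp: assms R_diff)

lemma tensor_connection: "connection (tensor_group M N) (\<lambda>a. tensor_map M N (lscal a)) (\<lambda>i. tensor_map M N (leib i))"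
proof (rule connection.intro[OF T_abelian_group], rule connection_axioms.intro)
  note [simp] = T_carrier T_add tensor_map_cls balanced_lscal balanced_leib ext_F F_add
  fix C assume "C \<in> carrier (tensor_group M N)"
  then obtain z where C: "C = cls z" and z: "z \<in> F" by auto
  show "tensor_map M N (lscal a) C \<in> carrier (tensor_group M N)" for a
    using z by (auto simp: C)
  show "tensor_map M N (leib i) C \<in> carrier (tensor_group M N)" for i
    using z by (auto simp: C)
  show "tensor_map M N (lscal (a + b)) C = tensor_map M N (lscal a) C \<oplus>\<^bsub>tensor_group M N\<^esub> tensor_map M N (lscal b) C" for a b
  proof -
    have "ext (lscal (a + b)) z - (ext (lscal a) z + ext (lscal b) z) \<in> R"
    proof (rule ext_compose_rel[OF z])
      fix m v assume mv: "m \<in> carrier M" "v \<in> carrier N"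
      show "ext (lscal (a + b)) (frag_of (m, v)) - (ext (lscal a) (frag_of (m, v)) + ext (lscal b) (frag_of (m, v))) \<in> R"
        using mv R_rel1[of "weyl_mpoly a \<odot>\<^bsub>M\<^esub> m" "weyl_mpoly b \<odot>\<^bsub>M\<^esub> m" v]
        by (simp add: lscal_def M.c_l_distr M.c_closed diff_diff_eq)
    qed (simp add: frag_extend_diff algebra_simps)
    then show ?thesis using z by (simp add: C cls_cong)
  qed
  show "tensor_map M N (lscal (a * b)) C = tensor_map M N (lscal a) (tensor_map M N (lscal b) C)" for a b
  proof -
    have "ext (lscal (a * b)) z - ext (lscal a) (ext (lscal b) z) \<in> R"
      by (rule ext_compose_rel[OF z]) (simp_all add: frag_extend_diff lscal_def M.c_mult R_zero)
    then show ?thesis using z by (simp add: C cls_cong)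
  qed
  show "tensor_map M N (lscal 1) C = C"
  proof -
    have "ext (lscal 1) z - z \<in> R"
      by (rule ext_compose_rel[OF z]) (simp_all add: frag_extend_diff lscal_def M.c_one R_zero)
    then show ?thesis using z by (simp add: C cls_cong)
  qed
  show "tensor_map M N (leib i) (tensor_map M N (leib j) C) = tensor_map M N (leib j) (tensor_map M N (leib i) C)" for i j
  proof -
    have "ext (leib i) (ext (leib j) z) - ext (leib j) (ext (leib i) z) \<in> R"
      by (rule ext_compose_rel[OF z])
        (simp_all add: frag_extend_diff frag_extend_add leib_def M.d_commute[of _ i j] N.d_commute[of _ i j] R_zero algebra_simps)
    then show ?thesis using z by (simp add: C cls_cong)
  qed
  show "tensor_map M N (leib i) (tensor_map M N (lscal a) C) =
     tensor_map M N (lscal (mpoly_deriv i a)) C \<oplus>\<^bsub>tensor_group M N\<^esub> tensor_map M N (lscal a) (tensor_map M N (leib i) C)" for i a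
  proof -
    have "ext (leib i) (ext (lscal a) z) - (ext (lscal (mpoly_deriv i a)) z + ext (lscal a) (ext (leib i) z)) \<in> R"
    proof (rule ext_compose_rel[OF z])
      fix m v assume mv: "m \<in> carrier M" "v \<in> carrier N"
      show "ext (leib i) (ext (lscal a) (frag_of (m, v))) - (ext (lscal (mpoly_deriv i a)) (frag_of (m, v)) + ext (lscal a) (ext (leib i) (frag_of (m, v)))) \<in> R"
        using mv R_rel1[of "weyl_mpoly (mpoly_deriv i a) \<odot>\<^bsub>M\<^esub> m" "weyl_mpoly a \<odot>\<^bsub>M\<^esub> (weyl_d i \<odot>\<^bsub>M\<^esub> m)" v]
        by (simp add: lscal_def leib_def M.d_leibniz M.c_closed M.d_closed frag_extend_add diff_diff_eq)
    qed (simp add: frag_extend_diff algebra_simps)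
    then show ?thesis using z by (simp add: C cls_cong)
  qed
  fix D assume "D \<in> carrier (tensor_group M N)"
  then obtain w where D: "D = cls w" and w: "w \<in> F" by auto
  show "tensor_map M N (lscal a) (C \<oplus>\<^bsub>tensor_group M N\<^esub> D) = tensor_map M N (lscal a) C \<oplus>\<^bsub>tensor_group M N\<^esub> tensor_map M N (lscal a) D" for a
    using z w by (simp add: C D frag_extend_add)
  show "tensor_map M N (leib i) (C \<oplus>\<^bsub>tensor_group M N\<^esub> D) = tensor_map M N (leib i) C \<oplus>\<^bsub>tensor_group M N\<^esub> tensor_map M N (leib i) D" for i
    using z w by (simp add: C D frag_extend_add)
qed

lemma left_module_tensor: "left_module weyl_ring (tensor_module M N)"
  using connection.left_module_weyl_module[OF tensor_connection]
  unfolding tensor_module_def lscal_def[abs_def] leib_def[abs_def] .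

end

definition cyclic_submodule :: "('r, 'a) ring_scheme \<Rightarrow> ('r, 't, 'b) module_scheme \<Rightarrow> 't \<Rightarrow> 't set" where
  "cyclic_submodule R M v = {a \<odot>\<^bsub>M\<^esub> v |a. a \<in> carrier R}"

definition generated_by :: "('r, 'a) ring_scheme \<Rightarrow> ('r, 't, 'b) module_scheme \<Rightarrow> 't \<Rightarrow> bool" where
  "generated_by R M v \<longleftrightarrow> v \<in> carrier M \<and> carrier M = cyclic_submodule R M v"


text \<open>
  \<open>f\<^sup>k\<close> in \<open>K[x, f\<^sup>-\<^sup>1]\<close> and, below, \<open>f\<^bsup>s+k\<^esup> = f\<^sup>k f\<^sup>s\<close> in \<open>L\<close>, for \<open>k \<in> \<int>\<close>.
\<close>

definition f_power ::
    "('n::{finite,linorder}, 'k::field_char_0) mpoly \<Rightarrow> int \<Rightarrow> ('n, 'k) ratfun" where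
  "f_power f k = ratfun_mpoly f powi k"

definition fs_power ::
    "('n::{finite,linorder}, 'k::field_char_0) mpoly \<Rightarrow> int \<Rightarrow> ('n, 'k) ratfun poly" where
  "fs_power f k = [:f_power f k:]"

text \<open>
  The module over \<open>R[s]\<close> (the ring \<^term>\<open>UP R\<close>, in which \<open>s\<close> is central) that an \<open>R\<close>-module \<open>T\<close> becomes
  when \<open>s\<close> acts as the \<open>R\<close>-linear map \<open>\<sigma>\<close>.
\<close>

definition poly_module ::
    "('r, 'a) ring_scheme \<Rightarrow> ('r, 't, 'b) module_scheme \<Rightarrow> ('t \<Rightarrow> 't) \<Rightarrow> (nat \<Rightarrow> 'r, 't) module" where
  "poly_module R T \<sigma> =
     \<lparr>carrier = carrier T, mult = mult T, one = one T, ring.zero = ring.zero T, add = add T,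
      smult = (\<lambda>p x. \<Oplus>\<^bsub>T\<^esub>j\<in>{..deg R p}. UnivPoly.coeff (UP R) p j \<odot>\<^bsub>T\<^esub> (\<sigma> ^^ j) x)\<rparr>"

definition tensor_fs_module ::
    "(('n::{finite,linorder}, 'k::field_char_0) weyl, 't, 'a) module_scheme \<Rightarrow> ('n, 'k) mpoly \<Rightarrow>
     (nat \<Rightarrow> ('n, 'k) weyl, ('t \<times> ('n, 'k) ratfun poly \<Rightarrow>\<^sub>0 int) set) module" where
  "tensor_fs_module M f = poly_module weyl_ring (tensor_module M (fs_module f))
     (tensor_map M (fs_module f) (\<lambda>m p. frag_of (m, [:0, 1:] * p)))"

text \<open>
  \<open>b(s) \<in> K[s]\<close> as an element of \<open>D\<^sub>X[s]\<close>.
\<close>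

definition weyl_s_poly :: "'k::comm_ring_1 poly \<Rightarrow> nat \<Rightarrow> ('n, 'k) weyl" where
  "weyl_s_poly b = (\<lambda>j. weyl_const (Polynomial.coeff b j))"

definition b_relation ::
    "(('n::{finite,linorder}, 'k::field_char_0) weyl, 't, 'a) module_scheme \<Rightarrow> 't \<Rightarrow> ('n, 'k) mpoly \<Rightarrow>
     'k poly \<Rightarrow> bool" where
  "b_relation M u f b \<longleftrightarrow>
     weyl_s_poly b \<odot>\<^bsub>tensor_fs_module M f\<^esub> tensor_elem M (fs_module f) u (fs_power f 0)
     \<in> cyclic_submodule (UP weyl_ring) (tensor_fs_module M f)
         (tensor_elem M (fs_module f) u (fs_power f 1))"

definition b_function_exists ::
    "(('n::{finite,linorder}, 'k::field_char_0) weyl, 't, 'a) module_scheme \<Rightarrow> 't \<Rightarrow> ('n, 'k) mpoly \<Rightarrow> bool" where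
  "b_function_exists M u f \<longleftrightarrow> (\<exists>b. b \<noteq> 0 \<and> b_relation M u f b)"

text \<open>
  Well defined only if \<^const>\<open>b_function_exists\<close> holds.
\<close>

definition b_function ::
    "(('n::{finite,linorder}, 'k::field_char_0) weyl, 't, 'a) module_scheme \<Rightarrow> 't \<Rightarrow> ('n, 'k) mpoly \<Rightarrow> 'k poly" where
  "b_function M u f = (THE b. lead_coeff b = 1 \<and> b_relation M u f b \<and>
     (\<forall>c. c \<noteq> 0 \<and> b_relation M u f c \<longrightarrow> degree b \<le> degree c))"


lemma (in abelian_monoid) diagonal_finsum:
  assumes "\<And>i j. h i j \<in> carrier G"
  shows "(\<Oplus>k\<in>{..n::nat}. \<Oplus>i\<in>{..k}. h i (k - i)) = (\<Oplus>i\<in>{..n}. \<Oplus>j\<in>{..n - i}. h i j)"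
proof (induction n)
  case 0
  show ?case using assms by (simp add: Pi_def)
next
  case (Suc n)
  have "(\<Oplus>i\<in>{..Suc n}. \<Oplus>j\<in>{..Suc n - i}. h i j) = h (Suc n) 0 \<oplus> (\<Oplus>i\<in>{..n}. \<Oplus>j\<in>{..Suc n - i}. h i j)"
    using assms by (simp add: Pi_def)
  also have "(\<Oplus>i\<in>{..n}. \<Oplus>j\<in>{..Suc n - i}. h i j) =
      (\<Oplus>i\<in>{..n}. h i (Suc n - i) \<oplus> (\<Oplus>j\<in>{..n - i}. h i j))"
    using assms by (intro finsum_cong') (auto simp: Suc_diff_le Pi_def)
  also have "\<dots> = (\<Oplus>i\<in>{..n}. h i (Suc n - i)) \<oplus> (\<Oplus>i\<in>{..n}. \<Oplus>j\<in>{..n - i}. h i j)"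
    using assms by (intro finsum_addf) (auto simp: Pi_def)
  finally show ?case using Suc assms by (simp add: Pi_def a_assoc)
qed

locale poly_action = left_module R T for R (structure) and T (structure) +
  fixes \<sigma> :: "'c \<Rightarrow> 'c"
  assumes \<sigma>_closed: "x \<in> carrier T \<Longrightarrow> \<sigma> x \<in> carrier T"
    and \<sigma>_add: "x \<in> carrier T \<Longrightarrow> y \<in> carrier T \<Longrightarrow> \<sigma> (x \<oplus>\<^bsub>T\<^esub> y) = \<sigma> x \<oplus>\<^bsub>T\<^esub> \<sigma> y"
    and \<sigma>_smult: "a \<in> carrier R \<Longrightarrow> x \<in> carrier T \<Longrightarrow> \<sigma> (a \<odot>\<^bsub>T\<^esub> x) = a \<odot>\<^bsub>T\<^esub> \<sigma> x"
begin

sublocale U: UP_ring R "UP R"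
  by (simp_all add: UP_ring_def R.ring_axioms)

lemma \<sigma>_pow: "x \<in> carrier T \<Longrightarrow> (\<sigma> ^^ j) x \<in> carrier T"
  by (induction j) (auto intro: \<sigma>_closed)

lemma \<sigma>_pow_add: "x \<in> carrier T \<Longrightarrow> y \<in> carrier T \<Longrightarrow> (\<sigma> ^^ j) (x \<oplus>\<^bsub>T\<^esub> y) = (\<sigma> ^^ j) x \<oplus>\<^bsub>T\<^esub> (\<sigma> ^^ j) y"
  by (induction j) (auto simp: \<sigma>_pow \<sigma>_add)

lemma \<sigma>_pow_smult: "a \<in> carrier R \<Longrightarrow> x \<in> carrier T \<Longrightarrow> (\<sigma> ^^ j) (a \<odot>\<^bsub>T\<^esub> x) = a \<odot>\<^bsub>T\<^esub> (\<sigma> ^^ j) x"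
  by (induction j) (auto simp: \<sigma>_pow \<sigma>_smult)

lemma zero_smult: "x \<in> carrier T \<Longrightarrow> \<zero> \<odot>\<^bsub>T\<^esub> x = \<zero>\<^bsub>T\<^esub>"
  using smult_l_distr[of \<zero> \<zero> x] smult_closed[of \<zero> x] by (simp del: smult_closed)

lemma smult_zero: "a \<in> carrier R \<Longrightarrow> a \<odot>\<^bsub>T\<^esub> \<zero>\<^bsub>T\<^esub> = \<zero>\<^bsub>T\<^esub>"
  using smult_r_distr[of a "\<zero>\<^bsub>T\<^esub>" "\<zero>\<^bsub>T\<^esub>"] smult_closed[of a "\<zero>\<^bsub>T\<^esub>"] by (simp del: smult_closed)

lemma \<sigma>_pow_zero: "(\<sigma> ^^ j) \<zero>\<^bsub>T\<^esub> = \<zero>\<^bsub>T\<^esub>"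
  using \<sigma>_pow_add[of "\<zero>\<^bsub>T\<^esub>" "\<zero>\<^bsub>T\<^esub>" j] \<sigma>_pow[of "\<zero>\<^bsub>T\<^esub>" j] by simp

lemma finsum_smult:
  "finite A \<Longrightarrow> a \<in> carrier R \<Longrightarrow> (\<And>k. h k \<in> carrier T) \<Longrightarrow> a \<odot>\<^bsub>T\<^esub> finsum T h A = (\<Oplus>\<^bsub>T\<^esub>k\<in>A. a \<odot>\<^bsub>T\<^esub> h k)"
  by (induction A rule: finite_induct) (auto simp: smult_zero smult_r_distr Pi_def)

lemma finsum_\<sigma>:
  "finite A \<Longrightarrow> (\<And>k. h k \<in> carrier T) \<Longrightarrow> (\<sigma> ^^ j) (finsum T h A) = (\<Oplus>\<^bsub>T\<^esub>k\<in>A. (\<sigma> ^^ j) (h k))"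
  by (induction A rule: finite_induct) (auto simp: \<sigma>_pow_zero \<sigma>_pow_add \<sigma>_pow Pi_def)

lemma smult_finsum:
  "finite A \<Longrightarrow> x \<in> carrier T \<Longrightarrow> (\<And>k. h k \<in> carrier R) \<Longrightarrow> finsum R h A \<odot>\<^bsub>T\<^esub> x = (\<Oplus>\<^bsub>T\<^esub>k\<in>A. h k \<odot>\<^bsub>T\<^esub> x)"
  by (induction A rule: finite_induct) (auto simp: zero_smult smult_l_distr Pi_def)

abbreviation pact where
  "pact n p x \<equiv> (\<Oplus>\<^bsub>T\<^esub>j\<in>{..n}. UnivPoly.coeff (UP R) p j \<odot>\<^bsub>T\<^esub> (\<sigma> ^^ j) x)"

lemma pact_bound:
  assumes "p \<in> carrier (UP R)" "x \<in> carrier T" "deg R p \<le> n"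
  shows "pact (deg R p) p x = pact n p x"
  using assms by (intro M.add.finprod_mono_neutral_cong_left)
    (auto simp: U.deg_aboveD zero_smult \<sigma>_pow U.coeff_closed)

lemma pact_closed: "p \<in> carrier (UP R) \<Longrightarrow> x \<in> carrier T \<Longrightarrow> pact n p x \<in> carrier T"
  by (intro M.finsum_closed) (auto simp: \<sigma>_pow)

lemma pact_mult:
  assumes p: "p \<in> carrier (UP R)" and q: "q \<in> carrier (UP R)" and x: "x \<in> carrier T"
  shows "pact (deg R (p \<otimes>\<^bsub>UP R\<^esub> q)) (p \<otimes>\<^bsub>UP R\<^esub> q) x = pact (deg R p) p (pact (deg R q) q x)"
proof -
  let ?n = "deg R p + deg R q"
  let ?p = "UnivPoly.coeff (UP R) p" and ?q = "UnivPoly.coeff (UP R) q"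
  let ?h = "\<lambda>i j. ?p i \<odot>\<^bsub>T\<^esub> (?q j \<odot>\<^bsub>T\<^esub> (\<sigma> ^^ (i + j)) x)"
  have h: "?h i j \<in> carrier T" for i j using p q x by (simp add: \<sigma>_pow)
  have "pact (deg R (p \<otimes>\<^bsub>UP R\<^esub> q)) (p \<otimes>\<^bsub>UP R\<^esub> q) x = pact ?n (p \<otimes>\<^bsub>UP R\<^esub> q) x"
    using p q x by (intro pact_bound) (auto intro: U.deg_mult_ring)
  also have "\<dots> = (\<Oplus>\<^bsub>T\<^esub>k\<in>{..?n}. \<Oplus>\<^bsub>T\<^esub>i\<in>{..k}. ?h i (k - i))"
  proof (intro M.finsum_cong')
    fix k assume "k \<in> {..?n}"
    have "UnivPoly.coeff (UP R) (p \<otimes>\<^bsub>UP R\<^esub> q) k \<odot>\<^bsub>T\<^esub> (\<sigma> ^^ k) x =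
        (\<Oplus>\<^bsub>T\<^esub>i\<in>{..k}. (?p i \<otimes> ?q (k - i)) \<odot>\<^bsub>T\<^esub> (\<sigma> ^^ k) x)"
      using p q x by (simp add: U.coeff_mult smult_finsum \<sigma>_pow)
    also have "\<dots> = (\<Oplus>\<^bsub>T\<^esub>i\<in>{..k}. ?h i (k - i))"
      using p q x by (intro M.finsum_cong') (auto simp: smult_assoc \<sigma>_pow)
    finally show "UnivPoly.coeff (UP R) (p \<otimes>\<^bsub>UP R\<^esub> q) k \<odot>\<^bsub>T\<^esub> (\<sigma> ^^ k) x = (\<Oplus>\<^bsub>T\<^esub>i\<in>{..k}. ?h i (k - i))" .
  qed (use h in \<open>auto intro!: M.finsum_closed\<close>)
  also have "\<dots> = (\<Oplus>\<^bsub>T\<^esub>i\<in>{..?n}. \<Oplus>\<^bsub>T\<^esub>j\<in>{..?n - i}. ?h i j)"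
    by (rule M.diagonal_finsum) (rule h)
  also have "\<dots> = (\<Oplus>\<^bsub>T\<^esub>i\<in>{..?n}. ?p i \<odot>\<^bsub>T\<^esub> (\<sigma> ^^ i) (pact (deg R q) q x))"
  proof (intro M.finsum_cong')
    fix i assume "i \<in> {..?n}"
    have "(\<Oplus>\<^bsub>T\<^esub>j\<in>{..?n - i}. ?h i j) = ?p i \<odot>\<^bsub>T\<^esub> (\<Oplus>\<^bsub>T\<^esub>j\<in>{..?n - i}. (\<sigma> ^^ i) (?q j \<odot>\<^bsub>T\<^esub> (\<sigma> ^^ j) x))"
      using p q x by (subst finsum_smult) (auto simp: \<sigma>_pow \<sigma>_pow_smult funpow_add)
    also have "\<dots> = ?p i \<odot>\<^bsub>T\<^esub> (\<sigma> ^^ i) (pact (?n - i) q x)"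
      using p q x by (subst finsum_\<sigma>) (auto simp: \<sigma>_pow)
    also have "\<dots> = ?p i \<odot>\<^bsub>T\<^esub> (\<sigma> ^^ i) (pact (deg R q) q x)"
    proof (cases "i \<le> deg R p")
      case True
      then show ?thesis using pact_bound[OF q x, of "?n - i"] by simp
    next
      case False
      then show ?thesis using p q x by (simp add: U.deg_aboveD zero_smult \<sigma>_pow pact_closed)
    qed
    finally show "(\<Oplus>\<^bsub>T\<^esub>j\<in>{..?n - i}. ?h i j) = ?p i \<odot>\<^bsub>T\<^esub> (\<sigma> ^^ i) (pact (deg R q) q x)" .
  qed (use p q x in \<open>auto simp: \<sigma>_pow pact_closed\<close>)
  also have "\<dots> = pact (deg R p) p (pact (deg R q) q x)"
    using p q x by (intro pact_bound[symmetric]) (auto simp: pact_closed)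
  finally show ?thesis .
qed

lemma pact_add:
  assumes p: "p \<in> carrier (UP R)" and q: "q \<in> carrier (UP R)" and x: "x \<in> carrier T"
  shows "pact (deg R (p \<oplus>\<^bsub>UP R\<^esub> q)) (p \<oplus>\<^bsub>UP R\<^esub> q) x = pact (deg R p) p x \<oplus>\<^bsub>T\<^esub> pact (deg R q) q x"
proof -
  let ?n = "max (deg R p) (deg R q)"
  have "pact (deg R (p \<oplus>\<^bsub>UP R\<^esub> q)) (p \<oplus>\<^bsub>UP R\<^esub> q) x = pact ?n (p \<oplus>\<^bsub>UP R\<^esub> q) x"
    using p q x by (intro pact_bound) (auto intro: U.deg_add)
  also have "\<dots> = pact ?n p x \<oplus>\<^bsub>T\<^esub> pact ?n q x"
    using p q x by (simp add: smult_l_distr \<sigma>_pow M.finsum_addf)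
  also have "\<dots> = pact (deg R p) p x \<oplus>\<^bsub>T\<^esub> pact (deg R q) q x"
    using pact_bound[OF p x, of ?n] pact_bound[OF q x, of ?n] by simp
  finally show ?thesis .
qed

lemma left_module_poly_module: "left_module (UP R) (poly_module R T \<sigma>)"
proof (rule left_module.intro[OF U.UP_ring])
  have [simp]: "carrier (poly_module R T \<sigma>) = carrier T" "add (poly_module R T \<sigma>) = add T"
    by (simp_all add: poly_module_def)
  have eq: "smult (poly_module R T \<sigma>) = (\<lambda>p x. pact (deg R p) p x)"
    by (simp add: poly_module_def)
  show "abelian_group (poly_module R T \<sigma>)"
    by (rule abelian_group_cong[OF M.abelian_group_axioms]) (simp_all add: poly_module_def)
  show "left_module_axioms (UP R) (poly_module R T \<sigma>)"
  proof (rule left_module_axioms.intro)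
    fix p x y assume "p \<in> carrier (UP R)" "x \<in> carrier (poly_module R T \<sigma>)" "y \<in> carrier (poly_module R T \<sigma>)"
    then show "p \<odot>\<^bsub>poly_module R T \<sigma>\<^esub> (x \<oplus>\<^bsub>poly_module R T \<sigma>\<^esub> y) =
       p \<odot>\<^bsub>poly_module R T \<sigma>\<^esub> x \<oplus>\<^bsub>poly_module R T \<sigma>\<^esub> p \<odot>\<^bsub>poly_module R T \<sigma>\<^esub> y"
      by (simp add: eq \<sigma>_pow_add \<sigma>_pow smult_r_distr M.finsum_addf)
  next
    fix x assume "x \<in> carrier (poly_module R T \<sigma>)"
    then show "\<one>\<^bsub>UP R\<^esub> \<odot>\<^bsub>poly_module R T \<sigma>\<^esub> x = x"
      by (simp add: eq)
  qed (simp_all only: eq pact_closed pact_add pact_mult \<open>carrier (poly_module R T \<sigma>) = _\<close>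
      \<open>add (poly_module R T \<sigma>) = _\<close>)
qed

end

lemma (in connection) weyl_module_smult_single:
  assumes "x \<in> carrier G"
  shows "weyl_mpoly a \<odot>\<^bsub>weyl_module G c d\<^esub> x = c a x" "weyl_d i \<odot>\<^bsub>weyl_module G c d\<^esub> x = d i x"
  using act_single[OF assms, of 0 a] act_single[OF assms, of "Poly_Mapping.single i 1" 1]
    md_plus_single[OF assms, of 0 i] assms
  by (simp_all add: weyl_module_def weyl_mpoly_def weyl_d_def md_zero c_one d_closed del: keys_single)


lemma fs_module_simps:
  assumes f: "f \<noteq> 0"
  shows "carrier (fs_module f) = {p. \<forall>j. Polynomial.coeff p j \<in> loc_carrier f}"
    "add (fs_module f) = (+)"
    "p \<in> carrier (fs_module f) \<Longrightarrow> weyl_mpoly a \<odot>\<^bsub>fs_module f\<^esub> p = Polynomial.smult (ratfun_mpoly a) p"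
    "p \<in> carrier (fs_module f) \<Longrightarrow> weyl_d i \<odot>\<^bsub>fs_module f\<^esub> p = fs_deriv f i p"
  using connection.weyl_module_smult_single[OF fs_connection[OF f], of p]
  by (simp_all add: fs_module_def weyl_module_def loc_s_ring_def)

lemma fs_deriv_s: "fs_deriv f i ([:0, 1:] * p) = [:0, 1:] * fs_deriv f i p"
  by (rule poly_eqI) (simp add: coeff_fs_deriv coeff_pCons split: nat.split)

lemma left_module_tensor_fs_module:
  fixes M :: "(('n::{finite,linorder}, 'k::field_char_0) weyl, 't, 'a) module_scheme" and f :: "('n, 'k) mpoly"
  assumes M: "left_module weyl_ring M" and f: "f \<noteq> 0"
  shows "left_module (UP weyl_ring) (tensor_fs_module M f)"
proof -
  interpret tensor M "fs_module f"
    by (rule tensor.intro[OF M left_module_fs_module[OF f]])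
  let ?N = "fs_module f"
  note fs = fs_module_simps[OF f]
  define \<phi> where "\<phi> = (\<lambda>(m::'t) (p::('n, 'k) ratfun poly). frag_of (m, [:0, 1:] * p))"
  let ?\<sigma> = "tensor_map M ?N \<phi>" and ?G = "tensor_group M ?N"
  have cl: "[:0, 1:] * p \<in> carrier ?N" if "p \<in> carrier ?N" for p
    using that by (auto simp: fs(1) coeff_pCons loc_carrier_0_1 split: nat.split)
  have s: "weyl_mpoly a \<odot>\<^bsub>?N\<^esub> ([:0, 1:] * p) = [:0, 1:] * (weyl_mpoly a \<odot>\<^bsub>?N\<^esub> p)"
     "weyl_d i \<odot>\<^bsub>?N\<^esub> ([:0, 1:] * p) = [:0, 1:] * (weyl_d i \<odot>\<^bsub>?N\<^esub> p)" if "p \<in> carrier ?N" for a i p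
    using that cl[OF that] by (simp_all only: fs fs_deriv_s mult_smult_right)
  have bal: "balanced \<phi>"
  proof (rule balancedI; unfold \<phi>_def)
    fix m v v' assume "m \<in> carrier M" "v \<in> carrier ?N" "v' \<in> carrier ?N"
    then show "frag_of (m, [:0, 1:] * (v \<oplus>\<^bsub>?N\<^esub> v')) - frag_of (m, [:0, 1:] * v) - frag_of (m, [:0, 1:] * v') \<in> R"
      using R_rel2[of m "[:0, 1:] * v" "[:0, 1:] * v'"] cl by (simp add: fs(2) distrib_left)
  next
    fix a m v assume mv: "m \<in> carrier M" "v \<in> carrier ?N"
    then show "frag_of (weyl_mpoly a \<odot>\<^bsub>M\<^esub> m, [:0, 1:] * v) - frag_of (m, [:0, 1:] * (weyl_mpoly a \<odot>\<^bsub>?N\<^esub> v)) \<in> R"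
      using R_rel3[of m "[:0, 1:] * v" a] cl s by metis
  qed (use cl R_rel1 F_frag in auto)
  note [simp] = T_carrier T_add tensor_map_cls bal balanced_lscal balanced_leib ext_F F_add
  have T: "carrier (tensor_module M ?N) = cls ` F" "add (tensor_module M ?N) = add ?G"
    by (simp_all add: tensor_module_def weyl_module_def)
  have \<sigma>_cl: "?\<sigma> C \<in> cls ` F" if "C \<in> cls ` F" for C
    using that by auto
  have \<sigma>_ad: "?\<sigma> (C \<oplus>\<^bsub>?G\<^esub> D) = ?\<sigma> C \<oplus>\<^bsub>?G\<^esub> ?\<sigma> D" if "C \<in> cls ` F" "D \<in> cls ` F" for C D
    using that by (auto simp: frag_extend_add)
  interpret G: connection ?G "\<lambda>a. tensor_map M ?N (lscal a)" "\<lambda>i. tensor_map M ?N (leib i)"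
    by (rule tensor_connection)
  have \<sigma>_l: "?\<sigma> (tensor_map M ?N (lscal a) C) = tensor_map M ?N (lscal a) (?\<sigma> C)" if Cin: "C \<in> cls ` F" for C a
  proof -
    obtain z where C: "C = cls z" and z: "z \<in> F" using Cin by auto
    have "ext \<phi> (ext (lscal a) z) - ext (lscal a) (ext \<phi> z) \<in> R"
      by (rule ext_compose_rel[OF z]) (simp_all add: frag_extend_diff lscal_def \<phi>_def R_zero)
    then show ?thesis using z by (simp add: C cls_cong)
  qed
  have \<sigma>_d: "?\<sigma> (tensor_map M ?N (leib i) C) = tensor_map M ?N (leib i) (?\<sigma> C)" if Cin: "C \<in> cls ` F" for C i
  proof -
    obtain z where C: "C = cls z" and z: "z \<in> F" using Cin by auto
    have "ext \<phi> (ext (leib i) z) - ext (leib i) (ext \<phi> z) \<in> R"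
    proof (rule ext_compose_rel[OF z])
      fix m v assume mv: "m \<in> carrier M" "v \<in> carrier ?N"
      have "ext \<phi> (ext (leib i) (frag_of (m, v))) = ext (leib i) (ext \<phi> (frag_of (m, v)))"
        unfolding leib_def \<phi>_def using s(2)[OF mv(2), of i] by (simp only: frag_extend_of frag_extend_add case_prod_conv)
      then show "ext \<phi> (ext (leib i) (frag_of (m, v))) - ext (leib i) (ext \<phi> (frag_of (m, v))) \<in> R"
        by (simp add: R_zero)
    qed (simp add: frag_extend_diff)
    then show ?thesis using z by (simp add: C cls_cong)
  qed
  have \<sigma>_md: "?\<sigma> (multi_deriv (\<lambda>i. tensor_map M ?N (leib i)) \<alpha> C) = multi_deriv (\<lambda>i. tensor_map M ?N (leib i)) \<alpha> (?\<sigma> C)"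
    if "C \<in> cls ` F" for \<alpha> C
  proof -
    have pc: "?\<sigma> ((tensor_map M ?N (leib i) ^^ k) D) = (tensor_map M ?N (leib i) ^^ k) (?\<sigma> D)" if "D \<in> cls ` F" for i k D
      using G.d_pow_closed[of D _ i] that by (induction k) (simp_all add: \<sigma>_d)
    have "?\<sigma> (foldr (\<lambda>i. tensor_map M ?N (leib i) ^^ e i) xs C) = foldr (\<lambda>i. tensor_map M ?N (leib i) ^^ e i) xs (?\<sigma> C)" for e xs
      using G.foldr_closed[of C e] that by (induction xs) (simp_all add: pc)
    then show ?thesis unfolding multi_deriv_def .
  qed
  have \<sigma>_0: "?\<sigma> \<zero>\<^bsub>?G\<^esub> = \<zero>\<^bsub>?G\<^esub>"
    using F_zero by (simp add: T_zero)
  have \<sigma>_sum: "?\<sigma> (finsum ?G h A) = (\<Oplus>\<^bsub>?G\<^esub>k\<in>A. ?\<sigma> (h k))" if "finite A" "\<And>k. h k \<in> cls ` F" for h and A :: "('n \<Rightarrow>\<^sub>0 nat) set"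
    using that(1)
  proof (induction A rule: finite_induct)
    case (insert k A)
    have "finsum ?G h A \<in> cls ` F"
      using G.finsum_closed[of h A] that(2) by auto
    then show ?case using insert that(2) \<sigma>_cl \<sigma>_ad by (simp add: Pi_def)
  qed (simp add: \<sigma>_0)
  have "poly_action weyl_ring (tensor_module M ?N) ?\<sigma>"
  proof (rule poly_action.intro[OF left_module_tensor], rule poly_action_axioms.intro)
    fix P C assume "C \<in> carrier (tensor_module M ?N)"
    then have C: "C \<in> cls ` F" by (simp add: T)
    have eq: "smult (tensor_module M ?N) = (\<lambda>P x. G.act P x)"
      unfolding tensor_module_def weyl_module_def lscal_def[abs_def] leib_def[abs_def] by simp
    show "?\<sigma> (P \<odot>\<^bsub>tensor_module M ?N\<^esub> C) = P \<odot>\<^bsub>tensor_module M ?N\<^esub> ?\<sigma> C"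
      unfolding eq
      using G.md_closed[of C] G.c_closed C
      by (subst \<sigma>_sum) (simp_all add: \<sigma>_l \<sigma>_md)
  qed (use \<sigma>_cl \<sigma>_ad in \<open>simp_all only: T\<close>)
  then show ?thesis
    unfolding tensor_fs_module_def \<phi>_def by (rule poly_action.left_module_poly_module)
qed

definition localization ::
    "(('n::{finite,linorder}, 'k::field_char_0) weyl, 't, 'a) module_scheme \<Rightarrow> ('n, 'k) mpoly \<Rightarrow>
     (('n, 'k) weyl, ('t \<times> ('n, 'k) ratfun \<Rightarrow>\<^sub>0 int) set) module" where
  "localization M f = tensor_module M (loc_module f)"

definition loc_elem ::
    "(('n::{finite,linorder}, 'k::field_char_0) weyl, 't, 'a) module_scheme \<Rightarrow> ('n, 'k) mpoly \<Rightarrow>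
     't \<Rightarrow> ('n, 'k) ratfun \<Rightarrow> ('t \<times> ('n, 'k) ratfun \<Rightarrow>\<^sub>0 int) set" where
  "loc_elem M f v g = tensor_elem M (loc_module f) v g"

text \<open>
  The image of the canonical map \<open>M \<rightarrow> M[f\<^sup>-\<^sup>1]\<close>, \<open>v \<mapsto> v \<otimes> 1\<close>.
\<close>

definition loc_image ::
    "(('n::{finite,linorder}, 'k::field_char_0) weyl, 't, 'a) module_scheme \<Rightarrow> ('n, 'k) mpoly \<Rightarrow>
     ('t \<times> ('n, 'k) ratfun \<Rightarrow>\<^sub>0 int) set set" where
  "loc_image M f = {loc_elem M f v 1 |v. v \<in> carrier M}"

definition quotient_module ::
    "('r, 't, 'a) module_scheme \<Rightarrow> 't set \<Rightarrow> ('r, 't set) module" where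
  "quotient_module M N =
     \<lparr>carrier = a_rcosets\<^bsub>M\<^esub> N, mult = undefined, one = undefined, ring.zero = N, add = set_add M,
      smult = (\<lambda>a C. \<Union>x\<in>C. N +>\<^bsub>M\<^esub> (a \<odot>\<^bsub>M\<^esub> x))\<rparr>"

text \<open>
  \<open>H\<^sup>1\<close> with support in \<open>f = 0\<close>, by its description as the cokernel of \<open>M \<rightarrow> M[f\<^sup>-\<^sup>1]\<close>.
\<close>

definition local_cohomology ::
    "(('n::{finite,linorder}, 'k::field_char_0) weyl, 't, 'a) module_scheme \<Rightarrow> ('n, 'k) mpoly \<Rightarrow>
     (('n, 'k) weyl, ('t \<times> ('n, 'k) ratfun \<Rightarrow>\<^sub>0 int) set set) module" where
  "local_cohomology M f = quotient_module (localization M f) (loc_image M f)"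

definition cohomology_class ::
    "(('n::{finite,linorder}, 'k::field_char_0) weyl, 't, 'a) module_scheme \<Rightarrow> ('n, 'k) mpoly \<Rightarrow>
     ('t \<times> ('n, 'k) ratfun \<Rightarrow>\<^sub>0 int) set \<Rightarrow> ('t \<times> ('n, 'k) ratfun \<Rightarrow>\<^sub>0 int) set set" where
  "cohomology_class M f w = loc_image M f +>\<^bsub>localization M f\<^esub> w"

end

theory Submission
  imports Defs
begin

text \<open>
  Write \<open>L = K[x, f\<^sup>-\<^sup>1, s] f\<^sup>s\<close> and let \<open>b(s)\<close> be the \<open>b\<close>-function. The link between \<open>b\<close> and the
  localization is the specialization \<open>M \<otimes> L \<rightarrow> M[f\<^sup>-\<^sup>1]\<close>, \<open>s \<mapsto> j\<close>, \<open>f\<^sup>s \<mapsto> f\<^sup>j\<close>, which is linear over \<open>D\<^sub>X\<close> for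
  every integer \<open>j\<close>. All the maps that are needed on \<open>M \<otimes> L\<close> and \<open>M[f\<^sup>-\<^sup>1]\<close> have the form \<open>id \<otimes> \<psi>\<close>, so that
  their properties reduce to computations with polynomials in \<open>s\<close> over the field of rational functions.

  No roots below \<open>-k\<close> implies generation: specializing the functional equation gives
  \<open>b(j) (u \<otimes> f\<^sup>j) \<in> D\<^sub>X (u \<otimes> f\<^bsup>j+1\<^esup>)\<close>. If \<open>b(j) \<noteq> 0\<close> for all \<open>j < -k\<close>, then by descending induction
  \<open>D\<^sub>X (u \<otimes> f\<^bsup>-k\<^esup>)\<close> contains all \<open>u \<otimes> f\<^sup>j\<close>, and these generate \<open>M[f\<^sup>-\<^sup>1]\<close>
  (\<open>localization_generated_if_no_roots\<close>).

  Generation implies no roots below \<open>-k\<close>: otherwise let \<open>j\<close> be the least integer root of \<open>b\<close>; then \<open>j < -k\<close>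
  and \<open>u \<otimes> f\<^sup>j \<in> D\<^sub>X (u \<otimes> f\<^bsup>-k\<^esup>) \<subseteq> D\<^sub>X (u \<otimes> f\<^bsup>j+1\<^esup>)\<close>, say \<open>u \<otimes> f\<^sup>j = Q (u \<otimes> f\<^bsup>j+1\<^esup>)\<close>. Then \<open>u \<otimes> f\<^sup>s\<close> and
  \<open>Q (u \<otimes> f\<^bsup>s+1\<^esup>)\<close> have the same specialization at \<open>j\<close>, hence differ by \<open>(s - j) z\<close> for some \<open>z\<close> in \<open>M \<otimes> L\<close>
  (\<open>specialize_eqD\<close>). The crucial point is that \<open>z\<close> again lies in \<open>D\<^sub>X[s] (u \<otimes> f\<^sup>s)\<close> (\<open>divide_in_Ds_span\<close>):
  the functional equation, shifted by negative integers, shows that every element of \<open>M \<otimes> L\<close> gets there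
  after multiplication by some \<open>B(s)\<close>, a product of factors \<open>b(s - m)\<close> with \<open>m \<ge> 1\<close>, and \<open>B(j) \<noteq> 0\<close> because \<open>j\<close> is the
  least integer root (\<open>multiple_in_Ds_span\<close>). Now write \<open>b = (s - j) c\<close> and multiply
  \<open>u \<otimes> f\<^sup>s = Q (u \<otimes> f\<^bsup>s+1\<^esup>) + (s - j) z\<close> by \<open>c(s)\<close>: the last term becomes \<open>b(s) z \<in> D\<^sub>X[s] (u \<otimes> f\<^bsup>s+1\<^esup>)\<close>, so \<open>c\<close>
  satisfies a functional equation too, contrary to the minimality of \<open>b\<close> (\<open>b_relation_div_root\<close>).

  For local cohomology, \<open>[u \<otimes> f\<^bsup>-k\<^esup>]\<close> generates the quotient of \<open>M[f\<^sup>-\<^sup>1]\<close> by \<open>\<iota>(M)\<close> if and only if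
  \<open>M[f\<^sup>-\<^sup>1] = D\<^sub>X (u \<otimes> f\<^bsup>-k\<^esup>) + \<iota>(M)\<close>; but \<open>\<iota>(M) = D\<^sub>X (u \<otimes> 1)\<close> and \<open>u \<otimes> 1 = f\<^sup>k (u \<otimes> f\<^bsup>-k\<^esup>)\<close>, so the
  second summand is contained in the first (\<open>local_cohomology_generated_iff\<close>).
\<close>

section \<open>Submodules, cyclic submodules and quotients\<close>

context left_module
begin

lemma submoduleI:
  assumes sub: "N \<subseteq> carrier M" and zero: "\<zero>\<^bsub>M\<^esub> \<in> N"
    and add: "\<And>x y. x \<in> N \<Longrightarrow> y \<in> N \<Longrightarrow> x \<oplus>\<^bsub>M\<^esub> y \<in> N"
    and smult: "\<And>a x. a \<in> carrier R \<Longrightarrow> x \<in> N \<Longrightarrow> a \<odot>\<^bsub>M\<^esub> x \<in> N"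
  shows "submodule N R M"
proof -
  have "\<ominus>\<^bsub>M\<^esub> x \<in> N" if x: "x \<in> N" for x
  proof -
    have xM: "x \<in> carrier M" using x sub by blast
    have z: "\<zero> \<odot>\<^bsub>M\<^esub> x = \<zero>\<^bsub>M\<^esub>"
      using smult_l_distr[of \<zero> \<zero> x] smult_closed[of \<zero> x] xM by (simp del: smult_closed)
    have "(\<ominus> \<one>) \<odot>\<^bsub>M\<^esub> x \<oplus>\<^bsub>M\<^esub> x = \<zero>\<^bsub>M\<^esub>"
      using smult_l_distr[of "\<ominus> \<one>" \<one> x] xM z by (simp add: R.l_neg)
    then have "\<ominus>\<^bsub>M\<^esub> x = (\<ominus> \<one>) \<odot>\<^bsub>M\<^esub> x"
      using xM by (intro M.minus_equality) auto
    then show ?thesis using smult[of "\<ominus> \<one>" x] x by simp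
  qed
  then show ?thesis
    using assms by (intro submodule.intro subgroup.intro submodule_axioms.intro) (simp_all add: a_inv_def)
qed

lemma
  assumes "submodule N R M"
  shows submodule_subset: "x \<in> N \<Longrightarrow> x \<in> carrier M"
    and submodule_zero: "\<zero>\<^bsub>M\<^esub> \<in> N"
    and submodule_add: "x \<in> N \<Longrightarrow> y \<in> N \<Longrightarrow> x \<oplus>\<^bsub>M\<^esub> y \<in> N"
    and submodule_a_inv: "x \<in> N \<Longrightarrow> \<ominus>\<^bsub>M\<^esub> x \<in> N"
    and submodule_smult: "a \<in> carrier R \<Longrightarrow> x \<in> N \<Longrightarrow> a \<odot>\<^bsub>M\<^esub> x \<in> N"
  using subgroup.subset[OF submodule.axioms(1)[OF assms]]
    subgroup.one_closed[OF submodule.axioms(1)[OF assms]]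
    subgroup.m_closed[OF submodule.axioms(1)[OF assms]]
    subgroup.m_inv_closed[OF submodule.axioms(1)[OF assms]]
    submodule.smult_closed[OF assms]
  by (auto simp: a_inv_def)

lemma cyclic_submodule:
  assumes x: "x \<in> carrier M"
  shows "submodule (cyclic_submodule R M x) R M"
proof (rule submoduleI)
  have "\<zero> \<odot>\<^bsub>M\<^esub> x = \<zero>\<^bsub>M\<^esub>"
    using smult_l_distr[of \<zero> \<zero> x] smult_closed[of \<zero> x] x by (simp del: smult_closed)
  then show "\<zero>\<^bsub>M\<^esub> \<in> cyclic_submodule R M x"
    unfolding cyclic_submodule_def by (metis (mono_tags, lifting) R.zero_closed mem_Collect_eq)
  show "a \<odot>\<^bsub>M\<^esub> y \<in> cyclic_submodule R M x" if ay: "a \<in> carrier R" "y \<in> cyclic_submodule R M x" for a y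
  proof -
    obtain b where b: "b \<in> carrier R" "y = b \<odot>\<^bsub>M\<^esub> x"
      using ay(2) unfolding cyclic_submodule_def by auto
    then have "a \<odot>\<^bsub>M\<^esub> y = (a \<otimes> b) \<odot>\<^bsub>M\<^esub> x" using ay(1) x by (simp add: smult_assoc)
    then show ?thesis using ay(1) b(1) unfolding cyclic_submodule_def by blast
  qed
  show "y \<oplus>\<^bsub>M\<^esub> z \<in> cyclic_submodule R M x"
    if yz: "y \<in> cyclic_submodule R M x" "z \<in> cyclic_submodule R M x" for y z
  proof -
    obtain a b where ab: "a \<in> carrier R" "y = a \<odot>\<^bsub>M\<^esub> x" "b \<in> carrier R" "z = b \<odot>\<^bsub>M\<^esub> x"
      using yz unfolding cyclic_submodule_def by auto
    then have "y \<oplus>\<^bsub>M\<^esub> z = (a \<oplus> b) \<odot>\<^bsub>M\<^esub> x" using x by (simp add: smult_l_distr)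
    then show ?thesis using ab unfolding cyclic_submodule_def by blast
  qed
qed (use x in \<open>auto simp: cyclic_submodule_def\<close>)

lemma cyclic_submodule_self: "x \<in> carrier M \<Longrightarrow> x \<in> cyclic_submodule R M x"
  unfolding cyclic_submodule_def using smult_one[of x] by (metis (mono_tags, lifting) R.one_closed mem_Collect_eq)

lemma cyclic_submodule_least:
  "submodule N R M \<Longrightarrow> x \<in> N \<Longrightarrow> y \<in> cyclic_submodule R M x \<Longrightarrow> y \<in> N"
  unfolding cyclic_submodule_def by (auto intro: submodule_smult)

lemma generated_by_iff:
  assumes "x \<in> carrier M"
  shows "generated_by R M x \<longleftrightarrow> carrier M \<subseteq> cyclic_submodule R M x"
  using assms submodule_subset[OF cyclic_submodule[OF assms]]
  by (auto simp: generated_by_def)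

lemma mem_rcoset: "y \<in> N +>\<^bsub>M\<^esub> x \<longleftrightarrow> (\<exists>n\<in>N. y = n \<oplus>\<^bsub>M\<^esub> x)"
  by (auto simp: a_r_coset_def r_coset_def)

lemma rcoset_self: "submodule N R M \<Longrightarrow> x \<in> carrier M \<Longrightarrow> x \<in> N +>\<^bsub>M\<^esub> x"
  unfolding mem_rcoset using submodule_zero[of N] by (intro bexI[of _ "\<zero>\<^bsub>M\<^esub>"]) auto

lemma smult_rcoset:
  assumes N: "submodule N R M" and a: "a \<in> carrier R" and x: "x \<in> carrier M"
  shows "a \<odot>\<^bsub>quotient_module M N\<^esub> (N +>\<^bsub>M\<^esub> x) = N +>\<^bsub>M\<^esub> (a \<odot>\<^bsub>M\<^esub> x)"
proof -
  have NM: "N \<subseteq> carrier M" using submodule_subset[OF N] by blast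
  have "N +>\<^bsub>M\<^esub> (a \<odot>\<^bsub>M\<^esub> y) = N +>\<^bsub>M\<^esub> (a \<odot>\<^bsub>M\<^esub> x)" if y: "y \<in> N +>\<^bsub>M\<^esub> x" for y
  proof -
    obtain n where n: "n \<in> N" "y = n \<oplus>\<^bsub>M\<^esub> x"
      using y by (auto simp: mem_rcoset)
    have nM: "n \<in> carrier M" using n NM by blast
    have "a \<odot>\<^bsub>M\<^esub> y = a \<odot>\<^bsub>M\<^esub> n \<oplus>\<^bsub>M\<^esub> a \<odot>\<^bsub>M\<^esub> x"
      unfolding n(2) by (rule smult_r_distr[OF a nM x])
    moreover have "a \<odot>\<^bsub>M\<^esub> n \<in> N" by (rule submodule_smult[OF N a n(1)])
    ultimately have "a \<odot>\<^bsub>M\<^esub> y \<in> N +>\<^bsub>M\<^esub> (a \<odot>\<^bsub>M\<^esub> x)"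
      unfolding mem_rcoset by blast
    then show ?thesis
      by (rule M.a_repr_independence[OF _ smult_closed[OF a x] submodule.axioms(1)[OF N], symmetric])
  qed
  moreover have "x \<in> N +>\<^bsub>M\<^esub> x"
    by (rule rcoset_self[OF N x])
  ultimately have "(\<Union>y\<in>N +>\<^bsub>M\<^esub> x. N +>\<^bsub>M\<^esub> (a \<odot>\<^bsub>M\<^esub> y)) = N +>\<^bsub>M\<^esub> (a \<odot>\<^bsub>M\<^esub> x)"
    by blast
  then show ?thesis
    by (simp add: quotient_module_def)
qed

lemma submodule_cancel:
  assumes N: "submodule N R M" and x: "x \<in> carrier M" and y: "y \<in> N" and xy: "x \<oplus>\<^bsub>M\<^esub> y \<in> N"
  shows "x \<in> N"
proof -
  have yM: "y \<in> carrier M" by (rule submodule_subset[OF N y])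
  have "x \<oplus>\<^bsub>M\<^esub> y \<oplus>\<^bsub>M\<^esub> (\<ominus>\<^bsub>M\<^esub> y) \<in> N" by (intro submodule_add[OF N] submodule_a_inv[OF N] y xy)
  then show ?thesis using x yM by (simp add: M.a_assoc M.r_neg)
qed

text \<open>
  Replaces generation of the quotient, whose elements are sets, by a statement about elements of \<open>M\<close>.
\<close>

lemma generated_by_quotient_iff:
  assumes N: "submodule N R M" and w: "w \<in> carrier M"
  shows "generated_by R (quotient_module M N) (N +>\<^bsub>M\<^esub> w) \<longleftrightarrow>
    (\<forall>x\<in>carrier M. \<exists>n\<in>N. \<exists>a\<in>carrier R. x = n \<oplus>\<^bsub>M\<^esub> a \<odot>\<^bsub>M\<^esub> w)"
proof -
  have NM: "N \<subseteq> carrier M" using submodule_subset[OF N] by blast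
  have car: "carrier (quotient_module M N) = {N +>\<^bsub>M\<^esub> x |x. x \<in> carrier M}"
    by (auto simp: quotient_module_def A_RCOSETS_def')
  have cyc: "cyclic_submodule R (quotient_module M N) (N +>\<^bsub>M\<^esub> w) = {N +>\<^bsub>M\<^esub> (a \<odot>\<^bsub>M\<^esub> w) |a. a \<in> carrier R}"
    using smult_rcoset[OF N _ w] unfolding cyclic_submodule_def by auto
  have eq: "N +>\<^bsub>M\<^esub> x = N +>\<^bsub>M\<^esub> y \<longleftrightarrow> (\<exists>n\<in>N. x = n \<oplus>\<^bsub>M\<^esub> y)" if "x \<in> carrier M" "y \<in> carrier M" for x y
  proof
    assume "N +>\<^bsub>M\<^esub> x = N +>\<^bsub>M\<^esub> y"
    moreover have "x \<in> N +>\<^bsub>M\<^esub> x"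
      using N that(1) by (rule rcoset_self)
    ultimately show "\<exists>n\<in>N. x = n \<oplus>\<^bsub>M\<^esub> y" by (auto simp: mem_rcoset)
  next
    assume "\<exists>n\<in>N. x = n \<oplus>\<^bsub>M\<^esub> y"
    then have "x \<in> N +>\<^bsub>M\<^esub> y" by (auto simp: mem_rcoset)
    then show "N +>\<^bsub>M\<^esub> x = N +>\<^bsub>M\<^esub> y"
      using M.a_repr_independence[of x N y] submodule.axioms(1)[OF N] that by simp
  qed
  have "generated_by R (quotient_module M N) (N +>\<^bsub>M\<^esub> w) \<longleftrightarrow>
      (\<forall>x\<in>carrier M. \<exists>a\<in>carrier R. N +>\<^bsub>M\<^esub> x = N +>\<^bsub>M\<^esub> (a \<odot>\<^bsub>M\<^esub> w))"
    unfolding generated_by_def car cyc using w by blast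
  also have "\<dots> \<longleftrightarrow> (\<forall>x\<in>carrier M. \<exists>n\<in>N. \<exists>a\<in>carrier R. x = n \<oplus>\<^bsub>M\<^esub> a \<odot>\<^bsub>M\<^esub> w)"
    using eq w by (metis smult_closed)
  finally show ?thesis .
qed

end

section \<open>The action of \<open>R[s]\<close>\<close>

context poly_action
begin

abbreviation Ts where "Ts \<equiv> poly_module R T \<sigma>"

lemma poly_module_simps [simp]:
  "carrier Ts = carrier T" "add Ts = add T" "\<zero>\<^bsub>Ts\<^esub> = \<zero>\<^bsub>T\<^esub>"
  by (simp_all add: poly_module_def)

lemma poly_module_smult: "p \<odot>\<^bsub>Ts\<^esub> x = pact (deg R p) p x"
  by (simp add: poly_module_def)

lemma monom_smult:
  assumes a: "a \<in> carrier R" and x: "x \<in> carrier T"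
  shows "UnivPoly.monom (UP R) a n \<odot>\<^bsub>Ts\<^esub> x = a \<odot>\<^bsub>T\<^esub> (\<sigma> ^^ n) x"
proof -
  have "pact (deg R (UnivPoly.monom (UP R) a n)) (UnivPoly.monom (UP R) a n) x = pact n (UnivPoly.monom (UP R) a n) x"
    using a x by (intro pact_bound) (auto intro: U.deg_monom_le)
  also have "\<dots> = (\<Oplus>\<^bsub>T\<^esub>j\<in>{..n}. if j = n then a \<odot>\<^bsub>T\<^esub> (\<sigma> ^^ j) x else \<zero>\<^bsub>T\<^esub>)"
    using a x by (intro M.finsum_cong') (auto simp: \<sigma>_pow zero_smult U.coeff_monom)
  also have "\<dots> = a \<odot>\<^bsub>T\<^esub> (\<sigma> ^^ n) x"
    using M.add.finprod_singleton[of n "{..n}" "\<lambda>j. a \<odot>\<^bsub>T\<^esub> (\<sigma> ^^ j) x"] a x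
    by (simp add: \<sigma>_pow Pi_def eq_commute)
  finally show ?thesis by (simp add: poly_module_smult)
qed

text \<open>
  With this criterion, and the minimality of cyclic submodules, membership in \<open>R[s] v\<close> is handled without
  ever writing down an element of \<open>R[s]\<close>.
\<close>

lemma submodule_poly_module_iff:
  "submodule N (UP R) Ts \<longleftrightarrow> submodule N R T \<and> (\<forall>x\<in>N. \<sigma> x \<in> N)"
proof (intro iffI conjI ballI)
  interpret P: left_module "UP R" Ts by (rule left_module_poly_module)
  assume N: "submodule N (UP R) Ts"
  note N' = P.submodule_subset[OF N] P.submodule_zero[OF N] P.submodule_add[OF N] P.submodule_smult[OF N]
  show "submodule N R T"
  proof (rule submoduleI)
    fix a x assume "a \<in> carrier R" "x \<in> N"
    then show "a \<odot>\<^bsub>T\<^esub> x \<in> N"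
      using N'(4)[of "UnivPoly.monom (UP R) a 0" x] N'(1) monom_smult[of a x 0]
      by simp
  qed (use N' in auto)
  fix x assume "x \<in> N"
  then show "\<sigma> x \<in> N"
    using N'(4)[of "UnivPoly.monom (UP R) \<one> 1" x] N'(1) monom_smult[of \<one> x 1]
    by (simp add: \<sigma>_closed)
next
  interpret P: left_module "UP R" Ts by (rule left_module_poly_module)
  assume N: "submodule N R T \<and> (\<forall>x\<in>N. \<sigma> x \<in> N)"
  then have N1: "submodule N R T" and N2: "\<And>x. x \<in> N \<Longrightarrow> \<sigma> x \<in> N" by auto
  show "submodule N (UP R) Ts"
  proof (rule P.submoduleI)
    fix p x assume p: "p \<in> carrier (UP R)" and x: "x \<in> N"
    have s: "(\<sigma> ^^ j) x \<in> N" for j by (induction j) (auto simp: x N2)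
    have c: "UnivPoly.coeff (UP R) p j \<odot>\<^bsub>T\<^esub> (\<sigma> ^^ j) x \<in> N" for j
      using p s by (intro submodule_smult[OF N1]) auto
    have "pact n p x \<in> N" for n
    proof (induction n)
      case 0
      show ?case
        using c[of 0] submodule_subset[OF N1 c[of 0]] by (subst M.finsum_0) auto
    next
      case (Suc n)
      then show ?case
        by (subst M.finsum_Suc) (auto simp del: funpow.simps intro: submodule_add[OF N1] c submodule_subset[OF N1 c])
    qed
    then show "p \<odot>\<^bsub>Ts\<^esub> x \<in> N" by (simp add: poly_module_smult)
  qed (use submodule_subset[OF N1] submodule_zero[OF N1] submodule_add[OF N1] in auto)
qed

end

section \<open>Modules over the Weyl algebra\<close>

lemma weyl_mult_mpoly_single: "weyl_mult (weyl_mpoly a) (Poly_Mapping.single \<alpha> 1) = Poly_Mapping.single \<alpha> a"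
  by (simp add: weyl_mult_mpoly weyl_lmult_mpoly_single)

text \<open>
  Generation of the Weyl algebra by \<open>K[x]\<close> and the \<open>\<partial>\<^sub>i\<close>, phrased with multiplication on the left so that it
  proves statements about \<open>P \<odot> x\<close>, where the leftmost factor acts last.
\<close>

lemma weyl_induct [case_names one add mpoly d]:
  fixes P :: "('n::{finite,linorder}, 'k::comm_ring_1) weyl"
  assumes one: "Q 1" and add: "\<And>P R. Q P \<Longrightarrow> Q R \<Longrightarrow> Q (P + R)"
    and mpoly: "\<And>a P. Q P \<Longrightarrow> Q (weyl_mult (weyl_mpoly a) P)"
    and d: "\<And>i P. Q P \<Longrightarrow> Q (weyl_mult (weyl_d i) P)"
  shows "Q P"
proof -
  let ?m = "\<lambda>\<alpha>. Poly_Mapping.single \<alpha> (1 :: ('n, 'k) mpoly)"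
  \<comment> \<open>Generalized over \<open>\<beta>\<close> so that the induction can split \<open>\<alpha>\<close> as a sum.\<close>
  have "\<forall>\<beta>. Q (?m \<beta>) \<longrightarrow> Q (?m (\<alpha> + \<beta>))" for \<alpha>
  proof (induction \<alpha> rule: pm_induct)
    case (single i n)
    show ?case
    proof (induction n)
      case (Suc n)
      have "?m (Poly_Mapping.single i (Suc n) + \<beta>) = weyl_mult (weyl_d i) (?m (Poly_Mapping.single i n + \<beta>))" for \<beta>
        using single_add[of i n 1] by (simp add: weyl_mult_d weyl_lmult_d_single ac_simps)
      then show ?case using Suc d by metis
    qed simp
  qed (simp_all add: add.assoc)
  from this one have m: "Q (?m \<alpha>)" for \<alpha>
    by (metis add_0_right single_one)
  show ?thesis
  proof (induction P rule: pm_induct)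
    case zero
    show ?case using mpoly[OF one, of 0] by (simp add: weyl_mult_mpoly weyl_lmult_mpoly_add)
  next
    case (single \<alpha> a)
    show ?case using mpoly[OF m, of a \<alpha>] by (simp add: weyl_mult_mpoly_single)
  qed (rule add)
qed

locale weyl_left_module = left_module weyl_ring T
  for T :: "(('n::{finite,linorder}, 'k::comm_ring_1) weyl, 't, 'a) module_scheme" (structure)
begin

sublocale D: connection T "\<lambda>a x. weyl_mpoly a \<odot> x" "\<lambda>i x. weyl_d i \<odot> x"
  by (rule left_module_connection[OF left_module_axioms])

lemma weyl_smult:
  assumes "x \<in> carrier T"
  shows "P \<odot> x \<in> carrier T" "(P + Q) \<odot> x = P \<odot> x \<oplus> Q \<odot> x" "weyl_mult P Q \<odot> x = P \<odot> (Q \<odot> x)"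
    "1 \<odot> x = x" "0 \<odot> x = \<zero>" "y \<in> carrier T \<Longrightarrow> P \<odot> (x \<oplus> y) = P \<odot> x \<oplus> P \<odot> y"
proof -
  show 1: "P \<odot> x \<in> carrier T" for P using assms smult_closed[of P x] by simp
  show 2: "(P + Q) \<odot> x = P \<odot> x \<oplus> Q \<odot> x" for P Q
    using assms smult_l_distr[of P Q x] by simp
  show "0 \<odot> x = \<zero>" using 2[of 0 0] 1[of 0] by simp
qed (use assms smult_assoc[of P Q x] smult_one[of x] smult_r_distr[of P x y] in simp_all)

lemma weyl_submoduleI:
  assumes sub: "N \<subseteq> carrier T" and zero: "\<zero> \<in> N"
    and add: "\<And>x y. x \<in> N \<Longrightarrow> y \<in> N \<Longrightarrow> x \<oplus> y \<in> N"
    and mpoly: "\<And>a x. x \<in> N \<Longrightarrow> weyl_mpoly a \<odot> x \<in> N"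
    and d: "\<And>i x. x \<in> N \<Longrightarrow> weyl_d i \<odot> x \<in> N"
  shows "submodule N weyl_ring T"
proof (rule submoduleI)
  fix P x assume x: "x \<in> N"
  have xT: "x \<in> carrier T" using x sub by blast
  show "P \<odot> x \<in> N"
    by (induction P rule: weyl_induct) (simp_all add: weyl_smult xT x add mpoly d)
qed (use sub zero add in auto)

end

definition mpoly_hom ::
    "(('n, 'k::comm_ring_1) weyl, 't, 'a) module_scheme \<Rightarrow> (('n, 'k) weyl, 'u, 'b) module_scheme \<Rightarrow> ('t \<Rightarrow> 'u) set" where
  "mpoly_hom N N' = {\<psi> \<in> carrier N \<rightarrow> carrier N'.
     (\<forall>v\<in>carrier N. \<forall>w\<in>carrier N. \<psi> (v \<oplus>\<^bsub>N\<^esub> w) = \<psi> v \<oplus>\<^bsub>N'\<^esub> \<psi> w) \<and>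
     (\<forall>a. \<forall>v\<in>carrier N. \<psi> (weyl_mpoly a \<odot>\<^bsub>N\<^esub> v) = weyl_mpoly a \<odot>\<^bsub>N'\<^esub> \<psi> v)}"

definition weyl_hom ::
    "(('n, 'k::comm_ring_1) weyl, 't, 'a) module_scheme \<Rightarrow> (('n, 'k) weyl, 'u, 'b) module_scheme \<Rightarrow> ('t \<Rightarrow> 'u) set" where
  "weyl_hom N N' = {\<psi> \<in> mpoly_hom N N'. \<forall>i. \<forall>v\<in>carrier N. \<psi> (weyl_d i \<odot>\<^bsub>N\<^esub> v) = weyl_d i \<odot>\<^bsub>N'\<^esub> \<psi> v}"

lemma
  assumes "\<psi> \<in> mpoly_hom N N'"
  shows mpoly_hom_closed: "v \<in> carrier N \<Longrightarrow> \<psi> v \<in> carrier N'"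
    and mpoly_hom_add: "v \<in> carrier N \<Longrightarrow> w \<in> carrier N \<Longrightarrow> \<psi> (v \<oplus>\<^bsub>N\<^esub> w) = \<psi> v \<oplus>\<^bsub>N'\<^esub> \<psi> w"
    and mpoly_hom_mpoly: "v \<in> carrier N \<Longrightarrow> \<psi> (weyl_mpoly a \<odot>\<^bsub>N\<^esub> v) = weyl_mpoly a \<odot>\<^bsub>N'\<^esub> \<psi> v"
  using assms by (auto simp: mpoly_hom_def)

lemma weyl_hom_mpoly_hom: "\<psi> \<in> weyl_hom N N' \<Longrightarrow> \<psi> \<in> mpoly_hom N N'"
  by (simp add: weyl_hom_def)

lemma weyl_hom_d:
  "\<psi> \<in> weyl_hom N N' \<Longrightarrow> v \<in> carrier N \<Longrightarrow> \<psi> (weyl_d i \<odot>\<^bsub>N\<^esub> v) = weyl_d i \<odot>\<^bsub>N'\<^esub> \<psi> v"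
  by (simp add: weyl_hom_def)

lemma mpoly_hom_zero:
  assumes "left_module weyl_ring N" "left_module weyl_ring N'" "\<psi> \<in> mpoly_hom N N'"
  shows "\<psi> \<zero>\<^bsub>N\<^esub> = \<zero>\<^bsub>N'\<^esub>"
proof -
  interpret N: weyl_left_module N using assms(1) by (rule weyl_left_module.intro)
  interpret N': weyl_left_module N' using assms(2) by (rule weyl_left_module.intro)
  show ?thesis
    using mpoly_hom_add[OF assms(3), of "\<zero>\<^bsub>N\<^esub>" "\<zero>\<^bsub>N\<^esub>"] mpoly_hom_closed[OF assms(3), of "\<zero>\<^bsub>N\<^esub>"] by simp
qed

lemma mpoly_hom_a_inv:
  assumes N: "left_module weyl_ring N" and N': "left_module weyl_ring N'" and \<psi>: "\<psi> \<in> mpoly_hom N N'"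
    and v: "v \<in> carrier N"
  shows "\<psi> (\<ominus>\<^bsub>N\<^esub> v) = \<ominus>\<^bsub>N'\<^esub> \<psi> v"
proof -
  interpret N: weyl_left_module N using N by (rule weyl_left_module.intro)
  interpret N': weyl_left_module N' using N' by (rule weyl_left_module.intro)
  have "\<psi> (\<ominus>\<^bsub>N\<^esub> v) \<oplus>\<^bsub>N'\<^esub> \<psi> v = \<zero>\<^bsub>N'\<^esub>"
    using mpoly_hom_add[OF \<psi>, of "\<ominus>\<^bsub>N\<^esub> v" v] v mpoly_hom_zero[OF N N' \<psi>] by (simp add: N.l_neg)
  then show ?thesis
    using mpoly_hom_closed[OF \<psi>] v by (metis N'.minus_equality N.a_inv_closed)
qed

lemma weyl_hom_smult:
  assumes "left_module weyl_ring N" "left_module weyl_ring N'" and \<psi>: "\<psi> \<in> weyl_hom N N'" and v: "v \<in> carrier N"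
  shows "\<psi> (P \<odot>\<^bsub>N\<^esub> v) = P \<odot>\<^bsub>N'\<^esub> \<psi> v"
proof -
  interpret N: weyl_left_module N using assms(1) by (rule weyl_left_module.intro)
  interpret N': weyl_left_module N' using assms(2) by (rule weyl_left_module.intro)
  note \<psi>' = weyl_hom_mpoly_hom[OF \<psi>]
  have \<psi>v: "\<psi> v \<in> carrier N'" using \<psi>' v by (rule mpoly_hom_closed)
  show ?thesis
    by (induction P rule: weyl_induct)
      (simp_all add: N.weyl_smult N'.weyl_smult v \<psi>v mpoly_hom_add[OF \<psi>'] mpoly_hom_mpoly[OF \<psi>'] weyl_hom_d[OF \<psi>])
qed

lemma weyl_const_smult_cancel:
  fixes X :: "(('n::{finite,linorder}, 'k::field_char_0) weyl, 't, 'a) module_scheme" and c :: 'k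
  assumes S: "submodule S weyl_ring X" and X: "left_module weyl_ring X" and x: "x \<in> carrier X"
    and c: "c \<noteq> 0" and cx: "weyl_const c \<odot>\<^bsub>X\<^esub> x \<in> S"
  shows "x \<in> S"
proof -
  interpret X: weyl_left_module X using X by (rule weyl_left_module.intro)
  have "weyl_mult (weyl_const (inverse c)) (weyl_const c :: ('n, 'k) weyl) = 1"
    using c by (simp add: weyl_const_def weyl_mult_mpoly[unfolded weyl_mpoly_def] weyl_lmult_mpoly_single
      mpoly_const_def mult_single)
  then have "weyl_const (inverse c) \<odot>\<^bsub>X\<^esub> (weyl_const c \<odot>\<^bsub>X\<^esub> x) = x"
    using x by (simp flip: X.weyl_smult(3) add: X.weyl_smult(4))
  then show ?thesis
    using X.submodule_smult[OF S, of "weyl_const (inverse c)"] cx by fastforce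
qed

text \<open>
  The way in which membership in a submodule is transported along specializations and shifts below.
\<close>

lemma submodule_vimage:
  assumes N: "left_module weyl_ring N" and N': "left_module weyl_ring N'" and \<psi>: "\<psi> \<in> weyl_hom N N'"
    and S: "submodule S weyl_ring N'"
  shows "submodule {v \<in> carrier N. \<psi> v \<in> S} weyl_ring N"
proof -
  interpret N: weyl_left_module N using N by (rule weyl_left_module.intro)
  interpret N': weyl_left_module N' using N' by (rule weyl_left_module.intro)
  note \<psi>' = weyl_hom_mpoly_hom[OF \<psi>]
  show ?thesis
    by (rule N.submoduleI)
      (auto simp: mpoly_hom_zero[OF N N' \<psi>'] mpoly_hom_add[OF \<psi>'] weyl_hom_smult[OF N N' \<psi>] N.weyl_smult
        intro: N'.submodule_zero[OF S] N'.submodule_add[OF S] N'.submodule_smult[OF S])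
qed

section \<open>Tensor products\<close>

context tensor
begin

abbreviation T where "T \<equiv> tensor_module M N"
abbreviation elem (infixl "\<Otimes>" 70) where "m \<Otimes> v \<equiv> tensor_elem M N m v"

sublocale T: weyl_left_module "tensor_module M N"
  by (rule weyl_left_module.intro[OF left_module_tensor])

lemma T_simps: "carrier T = cls ` F" "add T = add (tensor_group M N)" "\<zero>\<^bsub>T\<^esub> = cls 0"
  by (simp_all add: tensor_module_def weyl_module_def T_carrier T_zero)

lemma elem_closed: "m \<in> carrier M \<Longrightarrow> v \<in> carrier N \<Longrightarrow> m \<Otimes> v \<in> carrier T"
  by (simp add: T_simps tensor_elem_def F_frag)

lemma elem_add_left:
  assumes "m \<in> carrier M" "m' \<in> carrier M" "v \<in> carrier N"
  shows "(m \<oplus>\<^bsub>M\<^esub> m') \<Otimes> v = m \<Otimes> v \<oplus>\<^bsub>T\<^esub> m' \<Otimes> v"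
  using R_rel1[OF assms] by (simp add: tensor_elem_def T_simps T_add cls_cong algebra_simps)

lemma elem_add_right:
  assumes "m \<in> carrier M" "v \<in> carrier N" "v' \<in> carrier N"
  shows "m \<Otimes> (v \<oplus>\<^bsub>N\<^esub> v') = m \<Otimes> v \<oplus>\<^bsub>T\<^esub> m \<Otimes> v'"
  using R_rel2[OF assms] by (simp add: tensor_elem_def T_simps T_add cls_cong algebra_simps)

lemma elem_mpoly:
  assumes "m \<in> carrier M" "v \<in> carrier N"
  shows "(weyl_mpoly a \<odot>\<^bsub>M\<^esub> m) \<Otimes> v = m \<Otimes> (weyl_mpoly a \<odot>\<^bsub>N\<^esub> v)"
  using R_rel3[OF assms] by (simp add: tensor_elem_def cls_cong)

lemma smult_T:
  assumes "x \<in> carrier T"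
  shows "weyl_mpoly a \<odot>\<^bsub>T\<^esub> x = tensor_map M N (lscal a) x" "weyl_d i \<odot>\<^bsub>T\<^esub> x = tensor_map M N (leib i) x"
  using connection.weyl_module_smult_single[OF tensor_connection, of x] assms
  by (simp_all add: tensor_module_def weyl_module_def lscal_def[abs_def] leib_def[abs_def])

lemma mpoly_elem:
  assumes "m \<in> carrier M" "v \<in> carrier N"
  shows "weyl_mpoly a \<odot>\<^bsub>T\<^esub> (m \<Otimes> v) = (weyl_mpoly a \<odot>\<^bsub>M\<^esub> m) \<Otimes> v"
  unfolding smult_T[OF elem_closed[OF assms]] unfolding tensor_elem_def
  using assms by (simp add: tensor_map_cls balanced_lscal F_frag lscal_def)

lemma d_elem:
  assumes "m \<in> carrier M" "v \<in> carrier N"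
  shows "weyl_d i \<odot>\<^bsub>T\<^esub> (m \<Otimes> v) = (weyl_d i \<odot>\<^bsub>M\<^esub> m) \<Otimes> v \<oplus>\<^bsub>T\<^esub> m \<Otimes> (weyl_d i \<odot>\<^bsub>N\<^esub> v)"
  unfolding smult_T[OF elem_closed[OF assms]] unfolding tensor_elem_def
  using assms by (simp add: tensor_map_cls balanced_leib F_frag leib_def T_simps T_add)

lemma mpoly_elem_right:
  assumes "m \<in> carrier M" "v \<in> carrier N"
  shows "weyl_mpoly a \<odot>\<^bsub>T\<^esub> (m \<Otimes> v) = m \<Otimes> (weyl_mpoly a \<odot>\<^bsub>N\<^esub> v)"
  using assms by (simp add: mpoly_elem elem_mpoly)

lemma tensor_induct [consumes 1, case_names zero elem add]:
  assumes x: "x \<in> carrier T" and zero: "P \<zero>\<^bsub>T\<^esub>"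
    and elem: "\<And>m v. m \<in> carrier M \<Longrightarrow> v \<in> carrier N \<Longrightarrow> P (m \<Otimes> v)"
    and add: "\<And>x y. x \<in> carrier T \<Longrightarrow> y \<in> carrier T \<Longrightarrow> P x \<Longrightarrow> P y \<Longrightarrow> P (x \<oplus>\<^bsub>T\<^esub> y)"
  shows "P x"
proof -
  obtain z where z: "z \<in> F" "x = cls z" using x by (auto simp: T_simps)
  have c: "cls (y + w) = cls y \<oplus>\<^bsub>T\<^esub> cls w" for y w by (simp add: T_simps T_add)
  \<comment> \<open>Negatives are carried along because the free abelian group is generated under differences, and
    \<open>- (m \<otimes> v) = (- m) \<otimes> v\<close> is again a pure tensor.\<close>
  have "z \<in> F \<and> P (cls z) \<and> P (cls (- z))"
    using z(1)
  proof (induction z rule: F_induct)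
    case zero
    then show ?case using assms(2) by (simp add: T_simps F_zero)
  next
    case (one m v)
    have "(\<ominus>\<^bsub>M\<^esub> m) \<Otimes> v \<oplus>\<^bsub>T\<^esub> m \<Otimes> v = \<zero>\<^bsub>M\<^esub> \<Otimes> v"
      using one by (simp add: M.l_neg flip: elem_add_left)
    also have "\<dots> = \<zero>\<^bsub>T\<^esub>"
      using elem_add_left[of "\<zero>\<^bsub>M\<^esub>" "\<zero>\<^bsub>M\<^esub>" v] one elem_closed[of "\<zero>\<^bsub>M\<^esub>" v] by simp
    finally have "frag_of (\<ominus>\<^bsub>M\<^esub> m, v) + frag_of (m, v) \<in> R"
      by (simp add: T_simps tensor_elem_def T_add cls_cong)
    then have "cls (- frag_of (m, v)) = (\<ominus>\<^bsub>M\<^esub> m) \<Otimes> v"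
      using R_uminus[of "frag_of (\<ominus>\<^bsub>M\<^esub> m, v) + frag_of (m, v)"]
      by (simp add: cls_cong tensor_elem_def algebra_simps)
    then show ?case
      using one elem[of m v] elem[of "\<ominus>\<^bsub>M\<^esub> m" v] by (simp add: tensor_elem_def F_frag)
  next
    case (diff y w)
    then have cl: "cls y \<in> carrier T" "cls (- y) \<in> carrier T" "cls w \<in> carrier T" "cls (- w) \<in> carrier T"
      by (simp_all add: T_simps F_uminus)
    have "y - w \<in> F" using diff by (simp add: F_diff)
    moreover have "P (cls (y + - w))" "P (cls (- y + w))"
      unfolding c using diff cl by (auto intro!: add)
    ultimately show ?case by (simp add: add.commute)
  qed
  then show ?thesis using z by simp
qed

text \<open>
  By the Leibniz rule, the elements \<open>m\<close> with \<open>m \<otimes> v \<in> S\<close> for all \<open>v\<close> form a submodule of \<open>M\<close> whenever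
  \<open>S\<close> is one; so it is enough to look at a generator of \<open>M\<close>.
\<close>

lemma submodule_eq_carrier:
  assumes S: "submodule S weyl_ring T" and u: "generated_by weyl_ring M u"
    and uS: "\<And>v. v \<in> carrier N \<Longrightarrow> u \<Otimes> v \<in> S"
  shows "S = carrier T"
proof -
  interpret MM: weyl_left_module M by (rule weyl_left_module.intro[OF M])
  let ?Q = "{m \<in> carrier M. \<forall>v\<in>carrier N. m \<Otimes> v \<in> S}"
  note S' = T.submodule_subset[OF S] T.submodule_zero[OF S] T.submodule_add[OF S] T.submodule_smult[OF S]
  have Q: "submodule ?Q weyl_ring M"
  proof (rule MM.weyl_submoduleI)
    have "\<zero>\<^bsub>M\<^esub> \<Otimes> v = \<zero>\<^bsub>T\<^esub>" if "v \<in> carrier N" for v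
      using elem_add_left[of "\<zero>\<^bsub>M\<^esub>" "\<zero>\<^bsub>M\<^esub>" v] that elem_closed[of "\<zero>\<^bsub>M\<^esub>" v] by simp
    then show "\<zero>\<^bsub>M\<^esub> \<in> ?Q" using S' by auto
  next
    fix m m' assume "m \<in> ?Q" "m' \<in> ?Q"
    then show "m \<oplus>\<^bsub>M\<^esub> m' \<in> ?Q" using S' by (auto simp: elem_add_left)
  next
    fix a m assume "m \<in> ?Q"
    then show "weyl_mpoly a \<odot>\<^bsub>M\<^esub> m \<in> ?Q" by (auto simp: elem_mpoly M.c_closed N.c_closed)
  next
    fix i m assume m: "m \<in> ?Q"
    have "(weyl_d i \<odot>\<^bsub>M\<^esub> m) \<Otimes> v \<in> S" if v: "v \<in> carrier N" for v
    proof -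
      have cl: "(weyl_d i \<odot>\<^bsub>M\<^esub> m) \<Otimes> v \<in> carrier T" "m \<Otimes> (weyl_d i \<odot>\<^bsub>N\<^esub> v) \<in> carrier T"
        using m v by (auto intro!: elem_closed M.d_closed N.d_closed)
      have "weyl_d i \<odot>\<^bsub>T\<^esub> (m \<Otimes> v) \<oplus>\<^bsub>T\<^esub> (\<ominus>\<^bsub>T\<^esub> (m \<Otimes> (weyl_d i \<odot>\<^bsub>N\<^esub> v))) \<in> S"
        using m v by (intro S' T.submodule_a_inv[OF S]) (auto intro: N.d_closed)
      also have "weyl_d i \<odot>\<^bsub>T\<^esub> (m \<Otimes> v) \<oplus>\<^bsub>T\<^esub> (\<ominus>\<^bsub>T\<^esub> (m \<Otimes> (weyl_d i \<odot>\<^bsub>N\<^esub> v))) = (weyl_d i \<odot>\<^bsub>M\<^esub> m) \<Otimes> v"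
        using m v cl by (simp add: d_elem T.a_assoc T.r_neg)
      finally show ?thesis .
    qed
    then show "weyl_d i \<odot>\<^bsub>M\<^esub> m \<in> ?Q" using m by (auto intro: M.d_closed)
  qed simp
  have uM: "u \<in> carrier M" and gen: "carrier M = cyclic_submodule weyl_ring M u"
    using u by (auto simp: generated_by_def)
  have MQ: "m \<in> ?Q" if "m \<in> carrier M" for m
    by (rule MM.cyclic_submodule_least[OF Q, of u]) (use that uM uS gen in auto)
  have "x \<in> S" if "x \<in> carrier T" for x
    using that
  proof (induction x rule: tensor_induct)
    case (elem m v)
    then show ?case using MQ[of m] by simp
  qed (auto intro: S')
  then show ?thesis using S' by blast
qed

end

text \<open>
  The map \<open>id \<otimes> \<psi>\<close>. The elements of a tensor product are cosets, and the definition takes the union over all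
  representatives; for \<open>K[x]\<close>-linear \<open>\<psi>\<close> they all give the same class (\<open>id_tensor_cls\<close>).
\<close>

definition id_tensor ::
    "(('n, 'k::comm_ring_1) weyl, 't, 'a) module_scheme \<Rightarrow> (('n, 'k) weyl, 'u, 'b) module_scheme \<Rightarrow>
     ('v \<Rightarrow> 'u) \<Rightarrow> ('t \<times> 'v \<Rightarrow>\<^sub>0 int) set \<Rightarrow> ('t \<times> 'u \<Rightarrow>\<^sub>0 int) set" where
  "id_tensor M N' \<psi> C = (\<Union>z\<in>C. tensor_class M N' (frag_extend (\<lambda>(m, v). frag_of (m, \<psi> v)) z))"

locale two_tensors = tensor M N + N': tensor M N'
  for M :: "(('n::{finite,linorder}, 'k::comm_ring_1) weyl, 't, 'a) module_scheme"
    and N :: "(('n, 'k) weyl, 'u, 'b) module_scheme"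
    and N' :: "(('n, 'k) weyl, 'v, 'c) module_scheme"
begin

abbreviation lift where "lift \<psi> \<equiv> frag_extend (\<lambda>(m, v). frag_of (m, \<psi> v))"

lemma lift_F:
  assumes \<psi>: "\<psi> \<in> mpoly_hom N N'" and z: "z \<in> F"
  shows "lift \<psi> z \<in> N'.F"
  using z by (induction z rule: F_induct)
    (simp_all add: N'.F_zero N'.F_diff frag_extend_diff N'.F_frag mpoly_hom_closed[OF \<psi>])

lemma lift_R:
  assumes \<psi>: "\<psi> \<in> mpoly_hom N N'" and z: "z \<in> R"
  shows "lift \<psi> z \<in> N'.R"
proof -
  have g: "lift \<psi> h \<in> N'.R" if "h \<in> gens" for h
    using that unfolding gens_def
    by (auto simp: frag_extend_diff mpoly_hom_add[OF \<psi>] mpoly_hom_mpoly[OF \<psi>] mpoly_hom_closed[OF \<psi>]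
      intro!: N'.R_rel1 N'.R_rel2 N'.R_rel3)
  show ?thesis
    using z unfolding R_gens
  proof (induction z rule: generate.induct)
    case one
    then show ?case using N'.R_zero by simp
  next
    case (inv h)
    then show ?case using N'.R_uminus[OF g[OF inv]] gens_F inv_F[of h] by (auto simp: frag_extend_minus)
  qed (auto simp: g frag_extend_add N'.R_add)
qed

lemma id_tensor_cls:
  assumes \<psi>: "\<psi> \<in> mpoly_hom N N'"
  shows "id_tensor M N' \<psi> (cls z) = N'.cls (lift \<psi> z)"
proof -
  have "N'.cls (lift \<psi> w) = N'.cls (lift \<psi> z)" if w: "w \<in> cls z" for w
  proof -
    obtain r where "w = r + z" "r \<in> R" using w unfolding cls_eq by auto
    then show ?thesis unfolding N'.cls_cong using lift_R[OF \<psi>] by (simp add: frag_extend_add)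
  qed
  then show ?thesis unfolding id_tensor_def using cls_self[of z] by blast
qed

lemma id_tensor_elem:
  assumes "\<psi> \<in> mpoly_hom N N'"
  shows "id_tensor M N' \<psi> (tensor_elem M N m v) = tensor_elem M N' m (\<psi> v)"
  unfolding tensor_elem_def by (simp add: id_tensor_cls[OF assms])

lemma id_tensor_mpoly_hom:
  assumes \<psi>: "\<psi> \<in> mpoly_hom N N'"
  shows "id_tensor M N' \<psi> \<in> mpoly_hom T N'.T"
proof -
  let ?h = "id_tensor M N' \<psi>"
  have cl: "?h x \<in> carrier N'.T" if "x \<in> carrier T" for x
    using that by (auto simp: T_simps N'.T_simps id_tensor_cls[OF \<psi>] lift_F[OF \<psi>])
  have add: "?h (x \<oplus>\<^bsub>T\<^esub> y) = ?h x \<oplus>\<^bsub>N'.T\<^esub> ?h y" if "x \<in> carrier T" "y \<in> carrier T" for x y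
    using that by (auto simp: T_simps N'.T_simps T_add N'.T_add id_tensor_cls[OF \<psi>] frag_extend_add)
  have zero: "?h \<zero>\<^bsub>T\<^esub> = \<zero>\<^bsub>N'.T\<^esub>" by (simp add: T_simps N'.T_simps id_tensor_cls[OF \<psi>])
  have "?h (weyl_mpoly a \<odot>\<^bsub>T\<^esub> x) = weyl_mpoly a \<odot>\<^bsub>N'.T\<^esub> ?h x" if "x \<in> carrier T" for a x
    using that
  proof (induction x rule: tensor_induct)
    case zero
    then show ?case using \<open>?h \<zero>\<^bsub>T\<^esub> = _\<close> by (simp add: T.D.c_zero_r N'.T.D.c_zero_r)
  next
    case (elem m v)
    then show ?case
      by (simp add: mpoly_elem N'.mpoly_elem id_tensor_elem[OF \<psi>] mpoly_hom_closed[OF \<psi>])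
  next
    case (add x y)
    then show ?case
      using \<open>\<And>x y. _ \<Longrightarrow> _ \<Longrightarrow> ?h (x \<oplus>\<^bsub>T\<^esub> y) = _\<close> by (simp add: T.D.c_r_distr T.D.c_closed N'.T.D.c_r_distr cl)
  qed
  then show ?thesis unfolding mpoly_hom_def using cl add by auto
qed

lemma id_tensor_weyl_hom:
  assumes \<psi>': "\<psi> \<in> weyl_hom N N'"
  shows "id_tensor M N' \<psi> \<in> weyl_hom T N'.T"
proof -
  note \<psi> = weyl_hom_mpoly_hom[OF \<psi>']
  let ?h = "id_tensor M N' \<psi>"
  note h = id_tensor_mpoly_hom[OF \<psi>]
  have "?h (weyl_d i \<odot>\<^bsub>T\<^esub> x) = weyl_d i \<odot>\<^bsub>N'.T\<^esub> ?h x" if "x \<in> carrier T" for i x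
    using that
  proof (induction x rule: tensor_induct)
    case zero
    then show ?case
      using mpoly_hom_zero[OF left_module_tensor N'.left_module_tensor h] by (simp add: T.D.d_zero N'.T.D.d_zero)
  next
    case (elem m v)
    then show ?case
      by (simp add: d_elem N'.d_elem id_tensor_elem[OF \<psi>] mpoly_hom_closed[OF \<psi>] mpoly_hom_add[OF h]
        elem_closed M.d_closed N.d_closed weyl_hom_d[OF \<psi>'])
  next
    case (add x y)
    then show ?case
      by (simp add: T.D.d_add T.D.d_closed N'.T.D.d_add mpoly_hom_add[OF h] mpoly_hom_closed[OF h])
  qed
  then show ?thesis unfolding weyl_hom_def using h by auto
qed

end

section \<open>The modules \<open>K[x, f\<^sup>-\<^sup>1]\<close> and \<open>K[x, f\<^sup>-\<^sup>1, s] f\<^sup>s\<close>\<close>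

definition ratfun_const :: "'k \<Rightarrow> ('n::{finite,linorder}, 'k::field_char_0) ratfun" where
  "ratfun_const c = ratfun_mpoly (mpoly_const c)"

lemma mpoly_const_hom:
  "mpoly_const 0 = 0" "mpoly_const 1 = 1" "mpoly_const (a + b) = mpoly_const a + mpoly_const b"
  "mpoly_const (a * b) = mpoly_const a * mpoly_const b" "mpoly_const (- c) = - mpoly_const c"
  for a b c :: "'k::comm_ring_1"
  by (simp_all add: mpoly_const_def single_add mult_single single_uminus)

lemma ratfun_mpoly_uminus: "ratfun_mpoly (- a) = - ratfun_mpoly a"
  by (simp add: ratfun_mpoly_def)

lemma ratfun_const_hom [simp]:
  "ratfun_const 0 = 0" "ratfun_const 1 = 1" "ratfun_const (a + b) = ratfun_const a + ratfun_const b"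
  "ratfun_const (a * b) = ratfun_const a * ratfun_const b" "ratfun_const (- a) = - ratfun_const a"
  by (simp_all add: ratfun_const_def mpoly_const_hom ratfun_mpoly_hom ratfun_mpoly_uminus)

lemma ratfun_const_of_int [simp]: "ratfun_const (of_int j) = of_int j"
proof -
  have "ratfun_const (of_nat m) = of_nat m" for m by (induction m) simp_all
  then show ?thesis by (cases j rule: int_cases2) simp_all
qed

lemma ratfun_deriv_const [simp]: "ratfun_deriv i (ratfun_const c) = 0"
  by (simp add: ratfun_const_def ratfun_deriv_mpoly mpoly_const_def mpoly_deriv_single ratfun_mpoly_hom)

lemma ratfun_deriv_of_int [simp]: "ratfun_deriv i (of_int j) = 0"
  using ratfun_deriv_const[of i "of_int j"] by simp

lemma ratfun_mpoly_power: "ratfun_mpoly (a ^ m) = ratfun_mpoly a ^ m"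
  by (induction m) (simp_all add: ratfun_mpoly_hom)

lemma f_power_simps:
  assumes "f \<noteq> 0"
  shows "f_power f 0 = 1" "f_power f 1 = ratfun_mpoly f" "f_power f (i + j) = f_power f i * f_power f j"
    "f_power f j \<noteq> 0" "f_power f (int m) = ratfun_mpoly (f ^ m)"
proof -
  have F: "ratfun_mpoly f \<noteq> 0" using assms by (simp add: ratfun_mpoly_hom)
  then show "f_power f 0 = 1" "f_power f 1 = ratfun_mpoly f" "f_power f (i + j) = f_power f i * f_power f j"
    "f_power f j \<noteq> 0"
    by (simp_all add: f_power_def power_int_add)
  show "f_power f (int m) = ratfun_mpoly (f ^ m)"
    by (simp add: f_power_def ratfun_mpoly_power)
qed

lemma Fract_f_power: "f \<noteq> 0 \<Longrightarrow> Fract a (f ^ m) = ratfun_mpoly a * f_power f (- int m)"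
  by (simp add: ratfun_Fract f_power_def power_int_minus divide_inverse ratfun_mpoly_power)

text \<open>
  \<open>f\<^sub>i / f\<close> is the logarithmic derivative of \<open>f\<close>, also for negative exponents; this is what makes the
  maps of \<open>specialize_fs_hom\<close> and \<open>shift_fs_hom\<close> compatible with \<open>\<partial>\<^sub>i\<close>.
\<close>

lemma ratfun_deriv_f_power:
  assumes f: "f \<noteq> 0"
  shows "ratfun_deriv i (f_power f j) = of_int j * Fract (mpoly_deriv i f) f * f_power f j"
proof -
  let ?F = "ratfun_mpoly f" and ?g = "Fract (mpoly_deriv i f) f"
  have F: "?F \<noteq> 0" using f by (simp add: ratfun_mpoly_hom)
  have inv: "x = (- g) * inverse y" if "x * y + inverse y * (g * y) = 0" "y \<noteq> 0" for x y g :: "('a, 'b) ratfun"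
    using that by (simp add: eq_neg_iff_add_eq_0 field_simps)
  have 1: "ratfun_deriv i ?F = ?g * ?F"
    using f F by (simp add: ratfun_deriv_mpoly ratfun_Fract)
  have "ratfun_deriv i (inverse ?F) * ?F + inverse ?F * ratfun_deriv i ?F = 0"
    using F ratfun_deriv_of_int[of i 1] by (simp flip: ratfun_deriv_mult)
  then have 2: "ratfun_deriv i (inverse ?F) = (- ?g) * inverse ?F"
    unfolding 1 using F inv by metis
  have pow: "ratfun_deriv i (y ^ m) = of_nat m * h * y ^ m" if "ratfun_deriv i y = h * y" for y h m
  proof (induction m)
    case 0
    show ?case using ratfun_deriv_of_int[of i 1] by simp
  next
    case (Suc m)
    have "ratfun_deriv i (y ^ Suc m) = (h * y) * y ^ m + y * (of_nat m * h * y ^ m)"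
      using that Suc by (simp only: power_Suc ratfun_deriv_mult)
    then show ?case by (simp add: algebra_simps)
  qed
  show ?thesis
    using pow[OF 1] pow[OF 2]
    by (cases j rule: int_cases2) (simp_all add: f_power_def power_int_minus power_inverse del: minus_fract)
qed

lemma loc_module_simps:
  assumes f: "f \<noteq> 0"
  shows "carrier (loc_module f) = loc_carrier f" "add (loc_module f) = (+)"
    "g \<in> loc_carrier f \<Longrightarrow> weyl_mpoly a \<odot>\<^bsub>loc_module f\<^esub> g = ratfun_mpoly a * g"
    "g \<in> loc_carrier f \<Longrightarrow> weyl_d i \<odot>\<^bsub>loc_module f\<^esub> g = ratfun_deriv i g"
proof -
  have c: "connection (loc_ring f) (\<lambda>a g. ratfun_mpoly a * g) ratfun_deriv"
    by (rule connection.intro[OF abelian_group_loc_ring[OF f]], rule connection_axioms.intro)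
      (auto simp: loc_ring_def ratfun_mpoly_hom ratfun_deriv_add ratfun_deriv_mult ratfun_deriv_mpoly
         loc_carrier_mult loc_carrier_mpoly loc_carrier_deriv[OF f] algebra_simps intro: ratfun_deriv_commute)
  show "carrier (loc_module f) = loc_carrier f" "add (loc_module f) = (+)"
    by (simp_all add: loc_module_def weyl_module_def loc_ring_def)
  show "g \<in> loc_carrier f \<Longrightarrow> weyl_mpoly a \<odot>\<^bsub>loc_module f\<^esub> g = ratfun_mpoly a * g"
    "g \<in> loc_carrier f \<Longrightarrow> weyl_d i \<odot>\<^bsub>loc_module f\<^esub> g = ratfun_deriv i g"
    using connection.weyl_module_smult_single[OF c, of g]
    by (simp_all add: loc_module_def loc_ring_def)
qed

lemma loc_carrier_const: "ratfun_const c \<in> loc_carrier f" "of_int j \<in> loc_carrier f"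
  using loc_carrier_mpoly[of _ f] ratfun_const_of_int[of j] by (metis ratfun_const_def)+

lemma loc_carrier_f_power:
  assumes "f \<noteq> 0"
  shows "f_power f j \<in> loc_carrier f"
  using f_power_simps(5)[OF assms] Fract_f_power[OF assms, of 1] loc_carrier_mpoly[of _ f] loc_carrierI[of 1 f]
  by (cases j rule: int_cases2) (simp_all add: ratfun_mpoly_hom)

definition loc_polys ::
    "('n::{finite,linorder}, 'k::field_char_0) mpoly \<Rightarrow> ('n, 'k) ratfun poly set" where
  "loc_polys f = {p. \<forall>j. Polynomial.coeff p j \<in> loc_carrier f}"

lemma loc_polys_pCons: "pCons a p \<in> loc_polys f \<longleftrightarrow> a \<in> loc_carrier f \<and> p \<in> loc_polys f"
  by (auto simp: loc_polys_def coeff_pCons all_conj_distrib split: nat.splits)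

lemma loc_polys_induct [consumes 1, case_names zero pCons]:
  assumes "p \<in> loc_polys f" "P 0"
    "\<And>a p. a \<in> loc_carrier f \<Longrightarrow> p \<in> loc_polys f \<Longrightarrow> P p \<Longrightarrow> P (pCons a p)"
  shows "P p"
  using assms(1)
proof (induction p)
  case (pCons a p)
  then show ?case using assms(3) unfolding loc_polys_pCons by blast
qed (rule assms(2))

lemma loc_polys_zero: "0 \<in> loc_polys f"
  by (simp add: loc_polys_def loc_carrier_0_1)

lemma loc_polys_add: "f \<noteq> 0 \<Longrightarrow> p \<in> loc_polys f \<Longrightarrow> q \<in> loc_polys f \<Longrightarrow> p + q \<in> loc_polys f"
  by (simp add: loc_polys_def loc_carrier_add)

lemma loc_polys_smult: "g \<in> loc_carrier f \<Longrightarrow> p \<in> loc_polys f \<Longrightarrow> Polynomial.smult g p \<in> loc_polys f"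
  by (simp add: loc_polys_def loc_carrier_mult)

lemma loc_polys_mult:
  assumes f: "f \<noteq> 0" and p: "p \<in> loc_polys f" and q: "q \<in> loc_polys f"
  shows "p * q \<in> loc_polys f"
  using p
proof (induction p rule: loc_polys_induct)
  case (pCons a p)
  have "pCons 0 (p * q) \<in> loc_polys f"
    unfolding loc_polys_pCons using pCons loc_carrier_0_1 by blast
  then show ?case
    unfolding mult_pCons_left by (intro loc_polys_add[OF f] loc_polys_smult pCons q)
qed (simp add: loc_polys_zero)

lemma loc_polys_poly:
  assumes f: "f \<noteq> 0" and p: "p \<in> loc_polys f"
  shows "poly p (of_int j) \<in> loc_carrier f"
  using p by (induction p rule: loc_polys_induct)
    (simp_all add: loc_carrier_0_1 loc_carrier_add[OF f] loc_carrier_mult loc_carrier_const)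

lemma loc_polys_pcompose:
  assumes f: "f \<noteq> 0" and p: "p \<in> loc_polys f" and q: "q \<in> loc_polys f"
  shows "pcompose p q \<in> loc_polys f"
  using p
proof (induction p rule: loc_polys_induct)
  case (pCons a p)
  have "[:a:] \<in> loc_polys f" using pCons loc_polys_zero unfolding loc_polys_pCons by blast
  then show ?case unfolding pcompose_pCons by (intro loc_polys_add[OF f] loc_polys_mult[OF f] pCons q)
qed (simp add: loc_polys_zero)

lemma loc_polys_synthetic_div:
  assumes f: "f \<noteq> 0" and p: "p \<in> loc_polys f"
  shows "synthetic_div p (of_int j) \<in> loc_polys f"
  using p
proof (induction p rule: loc_polys_induct)
  case (pCons a p)
  then show ?case unfolding synthetic_div_pCons loc_polys_pCons using loc_polys_poly[OF f] by blast
qed (simp add: loc_polys_zero)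

definition ratfun_poly :: "'k poly \<Rightarrow> ('n::{finite,linorder}, 'k::field_char_0) ratfun poly" where
  "ratfun_poly b = map_poly ratfun_const b"

lemma ratfun_poly_pCons [simp]: "ratfun_poly (pCons c b) = pCons (ratfun_const c) (ratfun_poly b)"
  by (simp add: ratfun_poly_def map_poly_pCons)

lemma ratfun_poly_0 [simp]: "ratfun_poly 0 = 0"
  by (simp add: ratfun_poly_def)

lemma ratfun_poly_add: "ratfun_poly (b + c) = ratfun_poly b + ratfun_poly c"
  by (rule poly_eqI) (simp add: ratfun_poly_def coeff_map_poly)

lemma ratfun_poly_smult: "ratfun_poly (Polynomial.smult a b) = Polynomial.smult (ratfun_const a) (ratfun_poly b)"
  by (rule poly_eqI) (simp add: ratfun_poly_def coeff_map_poly)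

lemma ratfun_poly_mult: "ratfun_poly (b * c) = ratfun_poly b * ratfun_poly c"
  by (induction b) (simp_all add: ratfun_poly_add ratfun_poly_smult)

lemma ratfun_poly_1 [simp]: "ratfun_poly 1 = 1"
  by (simp add: one_pCons)

lemma ratfun_poly_pcompose:
  "ratfun_poly (pcompose b [:of_int l, 1:]) = pcompose (ratfun_poly b) [:of_int l, 1:]"
  by (induction b) (simp_all add: pcompose_pCons ratfun_poly_add ratfun_poly_mult ratfun_poly_smult)

lemma poly_ratfun_poly: "poly (ratfun_poly b) (of_int j) = ratfun_const (poly b (of_int j))"
  by (induction b) simp_all

lemma loc_polys_ratfun_poly: "ratfun_poly b \<in> loc_polys f"
  by (simp add: loc_polys_def ratfun_poly_def coeff_map_poly loc_carrier_const)

lemma carrier_fs_module: "f \<noteq> 0 \<Longrightarrow> carrier (fs_module f) = loc_polys f"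
  by (simp add: fs_module_simps loc_polys_def)

lemma fs_deriv_add: "fs_deriv f i (p + q) = fs_deriv f i p + fs_deriv f i q"
  by (rule poly_eqI) (simp add: coeff_fs_deriv ratfun_deriv_add algebra_simps split: nat.split)

lemma fs_deriv_smult:
  "fs_deriv f i (Polynomial.smult g p) = Polynomial.smult (ratfun_deriv i g) p + Polynomial.smult g (fs_deriv f i p)"
  by (rule poly_eqI) (simp add: coeff_fs_deriv ratfun_deriv_mult algebra_simps split: nat.split)

lemma fs_deriv_pCons: "fs_deriv f i (pCons a p) = [:ratfun_deriv i a, Fract (mpoly_deriv i f) f * a:] + pCons 0 (fs_deriv f i p)"
  by (rule poly_eqI) (simp add: coeff_fs_deriv coeff_pCons split: nat.split)

lemma fs_deriv_0 [simp]: "fs_deriv f i 0 = 0"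
  by (simp add: fs_deriv_def)

lemma fs_deriv_ratfun_poly_mult: "fs_deriv f i (ratfun_poly b * p) = ratfun_poly b * fs_deriv f i p"
proof (induction b)
  case (pCons c b)
  then show ?case using fs_deriv_s[of f i "ratfun_poly b * p"] by (simp add: fs_deriv_add fs_deriv_smult)
qed simp

lemma mult_fs_hom:
  assumes f: "f \<noteq> 0"
  shows "(\<lambda>p. ratfun_poly b * p) \<in> weyl_hom (fs_module f) (fs_module f)"
proof -
  have "ratfun_poly b * p \<in> carrier (fs_module f)" if "p \<in> carrier (fs_module f)" for p
    using loc_polys_mult[OF f loc_polys_ratfun_poly] that unfolding carrier_fs_module[OF f] by blast
  then show ?thesis
    using fs_module_simps(2,3,4)[OF f]
    by (auto simp: weyl_hom_def mpoly_hom_def distrib_left fs_deriv_ratfun_poly_mult)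
qed

text \<open>
  The specialization \<open>s \<mapsto> j\<close>, \<open>f\<^sup>s \<mapsto> f\<^sup>j\<close>. It commutes with \<open>\<partial>\<^sub>i\<close> because the summand \<open>s f\<^sub>i / f\<close> in the action
  of \<open>\<partial>\<^sub>i\<close> on \<open>L\<close> turns into \<open>j f\<^sub>i / f\<close>, the logarithmic derivative of \<open>f\<^sup>j\<close>.
\<close>

lemma specialize_fs_hom:
  assumes f: "f \<noteq> 0"
  shows "(\<lambda>p. poly p (of_int j) * f_power f j) \<in> weyl_hom (fs_module f) (loc_module f)"
proof -
  have cl: "poly p (of_int j) * f_power f j \<in> loc_carrier f" if "p \<in> loc_polys f" for p
    by (intro loc_carrier_mult loc_polys_poly loc_carrier_f_power f that)
  have "poly (fs_deriv f i p) (of_int j) * f_power f j = ratfun_deriv i (poly p (of_int j) * f_power f j)" for i p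
    by (induction p) (simp_all add: fs_deriv_pCons ratfun_deriv_add ratfun_deriv_mult
        ratfun_deriv_f_power[OF f] algebra_simps)
  then show ?thesis
    using cl fs_module_simps(2,3,4)[OF f] loc_module_simps[OF f]
    by (auto simp: weyl_hom_def mpoly_hom_def carrier_fs_module[OF f] algebra_simps)
qed

text \<open>
  The substitution \<open>s \<mapsto> s + l\<close>, \<open>f\<^sup>s \<mapsto> f\<^bsup>s+l\<^esup>\<close>. For \<open>l \<noteq> 0\<close> it is not linear over \<open>K[s]\<close>, but it is over \<open>D\<^sub>X\<close>: the
  derivative of the factor \<open>f\<^sup>l\<close> supplies the difference between \<open>(s + l) f\<^sub>i / f\<close> and \<open>s f\<^sub>i / f\<close>.
\<close>

lemma shift_fs_hom:
  assumes f: "f \<noteq> 0"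
  shows "(\<lambda>p. Polynomial.smult (f_power f l) (pcompose p [:of_int l, 1:])) \<in> weyl_hom (fs_module f) (fs_module f)"
proof -
  let ?h = "\<lambda>p. Polynomial.smult (f_power f l) (pcompose p [:of_int l, 1:])"
  have q: "[:of_int l, 1:] \<in> loc_polys f"
    using loc_polys_ratfun_poly[of "[:of_int l, 1:]" f] by simp
  have cl: "?h p \<in> loc_polys f" if "p \<in> loc_polys f" for p
    by (intro loc_polys_smult loc_polys_pcompose q loc_carrier_f_power f that)
  have s: "fs_deriv f i ([:of_int l, 1:] * p) = [:of_int l, 1:] * fs_deriv f i p" for i p
    using fs_deriv_ratfun_poly_mult[of f i "[:of_int l, 1:]" p] by simp
  have c: "fs_deriv f i [:a:] = [:ratfun_deriv i a, Fract (mpoly_deriv i f) f * a:]" for i a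
    by (simp add: fs_deriv_pCons)
  have "?h (fs_deriv f i p) = fs_deriv f i (?h p)" for i p
  proof (induction p)
    case (pCons a p)
    have "fs_deriv f i (?h (pCons a p)) = fs_deriv f i ([:f_power f l * a:] + [:of_int l, 1:] * ?h p)"
      by (simp add: pcompose_pCons smult_add_right)
    also have "\<dots> = fs_deriv f i [:f_power f l * a:] + [:of_int l, 1:] * ?h (fs_deriv f i p)"
      unfolding fs_deriv_add s pCons ..
    also have "\<dots> = ?h (fs_deriv f i (pCons a p))"
      unfolding c by (simp add: fs_deriv_pCons pcompose_pCons pcompose_add smult_add_right ratfun_deriv_mult
        ratfun_deriv_f_power[OF f] algebra_simps)
    finally show ?case ..
  qed simp
  then show ?thesis
    using cl fs_module_simps(2,3,4)[OF f] 
    by (auto simp: weyl_hom_def mpoly_hom_def carrier_fs_module[OF f] pcompose_add pcompose_smult smult_add_right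
      mult.commute)
qed

text \<open>
  A section of the specialization \<open>s \<mapsto> j\<close>; with the division by \<open>s - j\<close> in \<open>divide_fs_hom\<close> it splits \<open>L\<close>.
  In general neither map commutes with \<open>\<partial>\<^sub>i\<close>, but linearity over \<open>K[x]\<close> is enough to tensor with \<open>M\<close>.
\<close>

lemma section_fs_hom:
  assumes f: "f \<noteq> 0"
  shows "(\<lambda>g. [:g * f_power f (- j):]) \<in> mpoly_hom (loc_module f) (fs_module f)"
proof -
  have "[:g * f_power f (- j):] \<in> loc_polys f" if "g \<in> loc_carrier f" for g
    unfolding loc_polys_pCons using that loc_polys_zero loc_carrier_f_power[OF f] loc_carrier_mult by blast
  then show ?thesis
    using fs_module_simps(2,3)[OF f] loc_module_simps[OF f]
    by (auto simp: mpoly_hom_def carrier_fs_module[OF f] algebra_simps)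
qed

lemma synthetic_div_add: "synthetic_div (p + q) c = synthetic_div p c + synthetic_div q (c::'a::comm_ring_1)"
  by (induction p q rule: poly_induct2) simp_all

lemma synthetic_div_smult: "synthetic_div (Polynomial.smult a p) c = Polynomial.smult a (synthetic_div p (c::'a::comm_ring_1))"
  by (induction p) simp_all

lemma divide_fs_hom:
  assumes f: "f \<noteq> 0"
  shows "(\<lambda>p. synthetic_div p (of_int j)) \<in> mpoly_hom (fs_module f) (fs_module f)"
proof -
  have "synthetic_div p (of_int j) \<in> carrier (fs_module f)" if "p \<in> carrier (fs_module f)" for p
    using that loc_polys_synthetic_div[OF f] unfolding carrier_fs_module[OF f] by blast
  then show ?thesis
    using fs_module_simps(2,3)[OF f]
    by (auto simp: mpoly_hom_def synthetic_div_add synthetic_div_smult)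
qed

section \<open>The \<open>b\<close>-function\<close>

text \<open>
  The difference of two distinct monic polynomials of the same degree has smaller degree.
\<close>

lemma ex1_minimal_monic:
  fixes I :: "'k::field poly \<Rightarrow> bool"
  assumes ex: "b \<noteq> 0" "I b"
    and diff: "\<And>p q. I p \<Longrightarrow> I q \<Longrightarrow> I (p - q)" and smult: "\<And>a p. I p \<Longrightarrow> I (Polynomial.smult a p)"
  shows "\<exists>!b. lead_coeff b = 1 \<and> I b \<and> (\<forall>c. c \<noteq> 0 \<and> I c \<longrightarrow> degree b \<le> degree c)"
proof -
  obtain b where b: "b \<noteq> 0" "I b" and min: "\<And>c. c \<noteq> 0 \<Longrightarrow> I c \<Longrightarrow> degree b \<le> degree c"
    using ex_has_least_nat[of "\<lambda>b. b \<noteq> 0 \<and> I b" b degree] ex by auto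
  let ?b = "Polynomial.smult (inverse (lead_coeff b)) b"
  show ?thesis
  proof (rule ex1I[of _ ?b])
    show "lead_coeff ?b = 1 \<and> I ?b \<and> (\<forall>c. c \<noteq> 0 \<and> I c \<longrightarrow> degree ?b \<le> degree c)"
      using b min smult by auto
  next
    fix c assume c: "lead_coeff c = 1 \<and> I c \<and> (\<forall>d. d \<noteq> 0 \<and> I d \<longrightarrow> degree c \<le> degree d)"
    then have c0: "c \<noteq> 0" by auto
    have deg: "degree c = degree ?b"
      using min[OF c0] c b by (auto intro: antisym)
    show "c = ?b"
    proof (rule ccontr)
      assume "c \<noteq> ?b"
      then have "c - ?b \<noteq> 0" by simp
      moreover have "I (c - ?b)" using c b by (intro diff smult) auto
      moreover have "lead_coeff ?b = 1" using b by simp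
      then have "degree (c - ?b) < degree c"
        using c deg \<open>c - ?b \<noteq> 0\<close>
        by (metis coeff_diff degree_diff_le diff_self eq_zero_or_degree_less order_refl)
      ultimately show False using c by (metis not_less)
    qed
  qed
qed

locale cyclic_module_and_poly =
  fixes M :: "(('n::{finite,linorder}, 'k::field_char_0) weyl, 't, 'a) module_scheme"
    and u :: 't and f :: "('n, 'k) mpoly"
  assumes M: "left_module weyl_ring M" and u: "generated_by weyl_ring M u" and f: "f \<noteq> 0"
begin

sublocale L: tensor M "fs_module f"
  by (rule tensor.intro[OF M left_module_fs_module[OF f]])

sublocale Loc: tensor M "loc_module f"
  by (rule tensor.intro[OF M left_module_loc_module[OF f]])

lemmas LL = two_tensors.intro[OF L.tensor_axioms L.tensor_axioms]
lemmas L_Loc = two_tensors.intro[OF L.tensor_axioms Loc.tensor_axioms]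
lemmas Loc_L = two_tensors.intro[OF Loc.tensor_axioms L.tensor_axioms]

text \<open>
  The elements \<open>u \<otimes> f\<^bsup>s+j\<^esup>\<close> and \<open>u \<otimes> f\<^sup>j\<close>, and three maps \<open>id \<otimes> \<psi>\<close> on \<open>M \<otimes> L\<close>. The action of \<open>b(s)\<close> is
  expressed in this form, instead of through the module structure over \<open>D\<^sub>X[s]\<close>, since it can then be
  compared with specializations and shifts on pure tensors; \<open>weyl_s_poly_smult\<close> shows that it is the same.
\<close>

abbreviation u_fs where "u_fs j \<equiv> tensor_elem M (fs_module f) u (fs_power f j)"
abbreviation u_f where "u_f j \<equiv> tensor_elem M (loc_module f) u (f_power f j)"

definition s_act where "s_act b = id_tensor M (fs_module f) (\<lambda>p. ratfun_poly b * p)"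
definition spec where "spec j = id_tensor M (loc_module f) (\<lambda>p. poly p (of_int j) * f_power f j)"
definition shift where "shift r = id_tensor M (fs_module f)
  (\<lambda>p. Polynomial.smult (f_power f r) (pcompose p [:of_int r, 1:]))"

lemma u_closed: "u \<in> carrier M"
  using u unfolding generated_by_def by blast

lemma fs_power_closed: "fs_power f j \<in> carrier (fs_module f)"
  using loc_carrier_f_power[OF f, of j] loc_polys_zero[of f]
  unfolding carrier_fs_module[OF f] fs_power_def loc_polys_pCons by simp

lemma u_fs_closed: "u_fs j \<in> carrier L.T"
  by (rule L.elem_closed[OF u_closed fs_power_closed])

lemma u_f_closed: "u_f j \<in> carrier Loc.T"
  by (rule Loc.elem_closed[OF u_closed]) (simp add: loc_module_simps[OF f] loc_carrier_f_power[OF f])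

lemma s_act_weyl_hom: "s_act b \<in> weyl_hom L.T L.T"
  unfolding s_act_def by (rule two_tensors.id_tensor_weyl_hom[OF LL mult_fs_hom[OF f]])

lemma s_act_elem:
  "s_act b (tensor_elem M (fs_module f) m p) =
    tensor_elem M (fs_module f) m (ratfun_poly b * p)"
  unfolding s_act_def by (rule two_tensors.id_tensor_elem[OF LL weyl_hom_mpoly_hom[OF mult_fs_hom[OF f]]])

lemma spec_weyl_hom: "spec j \<in> weyl_hom L.T Loc.T"
  unfolding spec_def by (rule two_tensors.id_tensor_weyl_hom[OF L_Loc specialize_fs_hom[OF f]])

lemma spec_elem:
  "spec j (tensor_elem M (fs_module f) m p) =
    tensor_elem M (loc_module f) m (poly p (of_int j) * f_power f j)"
  unfolding spec_def by (rule two_tensors.id_tensor_elem[OF L_Loc weyl_hom_mpoly_hom[OF specialize_fs_hom[OF f]]])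

lemma shift_weyl_hom: "shift r \<in> weyl_hom L.T L.T"
  unfolding shift_def by (rule two_tensors.id_tensor_weyl_hom[OF LL shift_fs_hom[OF f]])

lemma shift_elem:
  "shift r (tensor_elem M (fs_module f) m p) =
    tensor_elem M (fs_module f) m (Polynomial.smult (f_power f r) (pcompose p [:of_int r, 1:]))"
  unfolding shift_def by (rule two_tensors.id_tensor_elem[OF LL weyl_hom_mpoly_hom[OF shift_fs_hom[OF f]]])

lemmas s_act_hom = weyl_hom_mpoly_hom[OF s_act_weyl_hom]
lemmas spec_hom = weyl_hom_mpoly_hom[OF spec_weyl_hom]
lemmas shift_hom = weyl_hom_mpoly_hom[OF shift_weyl_hom]
lemmas closed = mpoly_hom_closed[OF s_act_hom] mpoly_hom_closed[OF spec_hom] mpoly_hom_closed[OF shift_hom]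
lemmas additive = mpoly_hom_add[OF s_act_hom] mpoly_hom_add[OF spec_hom] mpoly_hom_add[OF shift_hom]
lemmas hom_zero = mpoly_hom_zero[OF L.left_module_tensor L.left_module_tensor s_act_hom]
  mpoly_hom_zero[OF L.left_module_tensor Loc.left_module_tensor spec_hom]
  mpoly_hom_zero[OF L.left_module_tensor L.left_module_tensor shift_hom]
lemmas linear = weyl_hom_smult[OF L.left_module_tensor L.left_module_tensor s_act_weyl_hom]
  weyl_hom_smult[OF L.left_module_tensor Loc.left_module_tensor spec_weyl_hom]
  weyl_hom_smult[OF L.left_module_tensor L.left_module_tensor shift_weyl_hom]

lemma mult_closed: "p \<in> carrier (fs_module f) \<Longrightarrow> ratfun_poly b * p \<in> carrier (fs_module f)"
  by (rule mpoly_hom_closed[OF weyl_hom_mpoly_hom[OF mult_fs_hom[OF f]]])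

lemma s_act_mult: "x \<in> carrier L.T \<Longrightarrow> s_act (b * c) x = s_act b (s_act c x)"
  by (induction x rule: L.tensor_induct)
    (simp_all add: hom_zero s_act_elem ratfun_poly_mult mult.assoc additive closed)

lemma s_act_commute: "x \<in> carrier L.T \<Longrightarrow> s_act b (s_act c x) = s_act c (s_act b x)"
  by (metis s_act_mult mult.commute)

lemma s_act_one: "x \<in> carrier L.T \<Longrightarrow> s_act 1 x = x"
  by (induction x rule: L.tensor_induct) (simp_all add: hom_zero s_act_elem additive)

lemma s_act_add: "x \<in> carrier L.T \<Longrightarrow> s_act (b + c) x = s_act b x \<oplus>\<^bsub>L.T\<^esub> s_act c x"
proof (induction x rule: L.tensor_induct)
  case (elem m p)
  have "ratfun_poly (b + c) * p = (ratfun_poly b * p) \<oplus>\<^bsub>fs_module f\<^esub> (ratfun_poly c * p)"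
    by (simp add: fs_module_simps(2)[OF f] ratfun_poly_add algebra_simps)
  then show ?case using elem by (simp add: s_act_elem L.elem_add_right mult_closed)
next
  case (add x y)
  then show ?case by (simp add: additive closed L.T.a_ac)
qed (simp add: hom_zero)

lemma s_act_const: "x \<in> carrier L.T \<Longrightarrow> s_act [:c:] x = weyl_const c \<odot>\<^bsub>L.T\<^esub> x"
proof -
  have w: "weyl_const c = weyl_mpoly (mpoly_const c)" by (simp add: weyl_const_def weyl_mpoly_def)
  assume "x \<in> carrier L.T"
  then show ?thesis unfolding w
  proof (induction x rule: L.tensor_induct)
    case (elem m p)
    then show ?case
      by (simp add: s_act_elem L.mpoly_elem_right fs_module_simps(3)[OF f] flip: ratfun_const_def)
  qed (simp_all add: hom_zero L.T.D.c_zero_r additive L.T.D.c_r_distr)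
qed

lemma spec_s_act: "x \<in> carrier L.T \<Longrightarrow> spec j (s_act b x) = weyl_const (poly b (of_int j)) \<odot>\<^bsub>Loc.T\<^esub> spec j x"
proof -
  let ?c = "poly b (of_int j)"
  have w: "weyl_const ?c = weyl_mpoly (mpoly_const ?c)" by (simp add: weyl_const_def weyl_mpoly_def)
  assume "x \<in> carrier L.T"
  then show ?thesis unfolding w
  proof (induction x rule: L.tensor_induct)
    case (elem m p)
    have "poly p (of_int j) * f_power f j \<in> carrier (loc_module f)"
      by (rule mpoly_hom_closed[OF weyl_hom_mpoly_hom[OF specialize_fs_hom[OF f]] elem(2)])
    then show ?case
      using elem by (simp add: s_act_elem spec_elem Loc.mpoly_elem_right loc_module_simps[OF f] poly_ratfun_poly
        mult.assoc flip: ratfun_const_def)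
  qed (simp_all add: hom_zero Loc.T.D.c_zero_r additive Loc.T.D.c_r_distr closed)
qed

lemma shift_s_act: "x \<in> carrier L.T \<Longrightarrow> shift r (s_act b x) = s_act (pcompose b [:of_int r, 1:]) (shift r x)"
  by (induction x rule: L.tensor_induct)
    (simp_all add: hom_zero additive closed s_act_elem shift_elem pcompose_mult ratfun_poly_pcompose)

lemma spec_u_fs: "spec j (u_fs i) = u_f (j + i)"
  by (simp add: spec_elem fs_power_def f_power_simps(3)[OF f] mult.commute)

lemma shift_u_fs: "shift r (u_fs i) = u_fs (r + i)"
  by (simp add: shift_elem fs_power_def f_power_simps(3)[OF f])

text \<open>
  For a polynomial \<open>p\<close> in \<open>s\<close>, the difference \<open>p - p(j)\<close> is divisible by \<open>s - j\<close>. Carried over to \<open>M \<otimes> L\<close> by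
  the two maps \<open>section_fs_hom\<close> and \<open>divide_fs_hom\<close>, this writes every \<open>x\<close> as the sum of a term that depends
  only on the specialization of \<open>x\<close> and of a multiple of \<open>s - j\<close>.
\<close>

lemma specialize_eqD:
  assumes x: "x \<in> carrier L.T" and y: "y \<in> carrier L.T" and eq: "spec j x = spec j y"
  obtains z where "z \<in> carrier L.T" "x = y \<oplus>\<^bsub>L.T\<^esub> s_act [:- of_int j, 1:] z"
proof -
  define c where "c = id_tensor M (fs_module f) (\<lambda>g. [:g * f_power f (- j):])"
  define q where "q = id_tensor M (fs_module f) (\<lambda>p. synthetic_div p (of_int j))"
  let ?d = "s_act [:- of_int j, 1:]"
  have c: "c \<in> mpoly_hom Loc.T L.T" unfolding c_def
    by (rule two_tensors.id_tensor_mpoly_hom[OF Loc_L section_fs_hom[OF f]])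
  have q: "q \<in> mpoly_hom L.T L.T" unfolding q_def
    by (rule two_tensors.id_tensor_mpoly_hom[OF LL divide_fs_hom[OF f]])
  note cl = closed mpoly_hom_closed[OF c] mpoly_hom_closed[OF q]
  have decomp: "x = c (spec j x) \<oplus>\<^bsub>L.T\<^esub> ?d (q x)" if "x \<in> carrier L.T" for x
    using that
  proof (induction x rule: L.tensor_induct)
    case zero
    then show ?case
      using mpoly_hom_zero[OF Loc.left_module_tensor L.left_module_tensor c]
        mpoly_hom_zero[OF L.left_module_tensor L.left_module_tensor q] by (simp add: hom_zero)
  next
    case (elem m p)
    have 1: "synthetic_div p (of_int j) \<in> carrier (fs_module f)"
      by (rule mpoly_hom_closed[OF divide_fs_hom[OF f] elem(2)])
    have 2: "poly p (of_int j) * f_power f j \<in> carrier (loc_module f)"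
      by (rule mpoly_hom_closed[OF weyl_hom_mpoly_hom[OF specialize_fs_hom[OF f]] elem(2)])
    have 3: "[:poly p (of_int j) * f_power f j * f_power f (- j):] \<in> carrier (fs_module f)"
      by (rule mpoly_hom_closed[OF section_fs_hom[OF f] 2])
    have "f_power f j * f_power f (- j) = 1"
      using f_power_simps(3)[OF f, of j "- j"] f_power_simps(1)[OF f] by simp
    then have "[:poly p (of_int j) * f_power f j * f_power f (- j):] \<oplus>\<^bsub>fs_module f\<^esub>
        (ratfun_poly [:- of_int j, 1:] * synthetic_div p (of_int j)) = p"
      using synthetic_div_correct'[of "of_int j" p]
      by (simp add: fs_module_simps(2)[OF f] mult.assoc add.commute del: mult_pCons_left)
    then show ?case
      using elem 1 2 3 L.elem_add_right[OF elem(1) 3 mult_closed[OF 1, of "[:- of_int j, 1:]"]]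
      unfolding c_def q_def spec_elem s_act_elem two_tensors.id_tensor_elem[OF Loc_L section_fs_hom[OF f]]
        two_tensors.id_tensor_elem[OF LL divide_fs_hom[OF f]] by simp
  next
    case (add x y)
    have "x \<oplus>\<^bsub>L.T\<^esub> y = (c (spec j x) \<oplus>\<^bsub>L.T\<^esub> ?d (q x)) \<oplus>\<^bsub>L.T\<^esub> (c (spec j y) \<oplus>\<^bsub>L.T\<^esub> ?d (q y))"
      using add(3,4) by simp
    also have "\<dots> = c (spec j (x \<oplus>\<^bsub>L.T\<^esub> y)) \<oplus>\<^bsub>L.T\<^esub> ?d (q (x \<oplus>\<^bsub>L.T\<^esub> y))"
      using add(1,2) by (simp add: additive mpoly_hom_add[OF c] mpoly_hom_add[OF q] cl L.T.a_ac)
    finally show ?case .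
  qed
  \<comment> \<open>The terms \<open>c (spec j x)\<close> and \<open>c (spec j y)\<close> are equal and cancel.\<close>
  let ?z = "q x \<oplus>\<^bsub>L.T\<^esub> (\<ominus>\<^bsub>L.T\<^esub> q y)"
  have "y \<oplus>\<^bsub>L.T\<^esub> ?d ?z = (c (spec j y) \<oplus>\<^bsub>L.T\<^esub> ?d (q y)) \<oplus>\<^bsub>L.T\<^esub> (?d (q x) \<oplus>\<^bsub>L.T\<^esub> (\<ominus>\<^bsub>L.T\<^esub> ?d (q y)))"
    using x y decomp[OF y] cl
    by (simp add: additive mpoly_hom_a_inv[OF L.left_module_tensor L.left_module_tensor s_act_hom])
  also have "\<dots> = c (spec j x) \<oplus>\<^bsub>L.T\<^esub> ?d (q x)"
    using x y cl unfolding eq by (simp add: L.T.a_ac L.T.r_neg L.T.r_neg1 L.T.r_neg2)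
  also have "\<dots> = x" using decomp[OF x] ..
  finally show thesis using that[of ?z] x y cl by simp
qed

sublocale Ls: poly_action weyl_ring L.T "s_act [:0, 1:]"
  by (rule poly_action.intro[OF L.left_module_tensor], rule poly_action_axioms.intro)
    (simp_all add: additive closed linear)

lemma tensor_fs_module: "tensor_fs_module M f = Ls.Ts"
  by (simp add: tensor_fs_module_def tensor_map_def[abs_def] s_act_def id_tensor_def[abs_def])

sublocale Ds: left_module "UP weyl_ring" Ls.Ts
  by (rule Ls.left_module_poly_module)

abbreviation Ds_submodule where "Ds_submodule V \<equiv> submodule V (UP weyl_ring) Ls.Ts"
abbreviation Ds_span where "Ds_span x \<equiv> cyclic_submodule (UP weyl_ring) Ls.Ts x"

lemma Ds_submoduleI:
  "submodule V weyl_ring L.T \<Longrightarrow> (\<And>x. x \<in> V \<Longrightarrow> s_act [:0, 1:] x \<in> V) \<Longrightarrow> Ds_submodule V"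
  by (simp add: Ls.submodule_poly_module_iff)

lemma
  assumes "Ds_submodule V"
  shows Ds_submodule_weyl: "submodule V weyl_ring L.T"
    and Ds_submodule_s: "x \<in> V \<Longrightarrow> s_act [:0, 1:] x \<in> V"
    and Ds_submodule_subset: "x \<in> V \<Longrightarrow> x \<in> carrier L.T"
    and Ds_submodule_add: "x \<in> V \<Longrightarrow> y \<in> V \<Longrightarrow> x \<oplus>\<^bsub>L.T\<^esub> y \<in> V"
    and Ds_submodule_smult: "x \<in> V \<Longrightarrow> Q \<odot>\<^bsub>L.T\<^esub> x \<in> V"
proof -
  show V: "submodule V weyl_ring L.T" and "x \<in> V \<Longrightarrow> s_act [:0, 1:] x \<in> V"
    using assms by (simp_all add: Ls.submodule_poly_module_iff)
  show "x \<in> V \<Longrightarrow> x \<in> carrier L.T" "x \<in> V \<Longrightarrow> y \<in> V \<Longrightarrow> x \<oplus>\<^bsub>L.T\<^esub> y \<in> V"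
    "x \<in> V \<Longrightarrow> Q \<odot>\<^bsub>L.T\<^esub> x \<in> V"
    using L.T.submodule_subset[OF V] L.T.submodule_add[OF V] L.T.submodule_smult[OF V, of Q] by auto
qed

lemma Ds_span_submodule: "x \<in> carrier L.T \<Longrightarrow> Ds_submodule (Ds_span x)"
  by (rule Ds.cyclic_submodule) simp

lemma Ds_span_self: "x \<in> carrier L.T \<Longrightarrow> x \<in> Ds_span x"
  by (rule Ds.cyclic_submodule_self) simp

lemma s_act_pCons: "x \<in> carrier L.T \<Longrightarrow> s_act (pCons c b) x = weyl_const c \<odot>\<^bsub>L.T\<^esub> x \<oplus>\<^bsub>L.T\<^esub> s_act [:0, 1:] (s_act b x)"
  using s_act_add[of x "[:c:]" "[:0, 1:] * b"] by (simp add: s_act_const s_act_mult[symmetric])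

lemma Ds_submodule_s_act:
  assumes V: "Ds_submodule V" and x: "x \<in> V"
  shows "s_act b x \<in> V"
proof (induction b)
  case 0
  show ?case
    using L.T.weyl_smult(5)[of x] s_act_const[of x 0] Ds_submodule_subset[OF V x] L.T.submodule_zero[OF Ds_submodule_weyl[OF V]]
    by (simp add: weyl_const_def mpoly_const_hom)
next
  case (pCons c b)
  then show ?case
    unfolding s_act_pCons[OF Ds_submodule_subset[OF V x]]
    by (intro Ds_submodule_add[OF V] Ds_submodule_s[OF V] Ds_submodule_smult[OF V] x)
qed

text \<open>
  Both sides are \<open>\<Sum>\<^sub>j b\<^sub>j s\<^sup>j x\<close>: the left one by the definition of the \<open>D\<^sub>X[s]\<close>-module, the right one because
  \<open>s_act\<close> is additive and multiplicative in \<open>b\<close>.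
\<close>

lemma weyl_s_poly_smult:
  assumes x: "x \<in> carrier L.T"
  shows "weyl_s_poly b \<odot>\<^bsub>Ls.Ts\<^esub> x = s_act b x"
proof -
  let ?p = "weyl_s_poly b :: nat \<Rightarrow> ('n, 'k) weyl"
  have up: "?p \<in> up weyl_ring"
  proof (rule mem_upI)
    show "\<exists>n. bound \<zero>\<^bsub>weyl_ring\<^esub> n ?p"
      by (intro exI[of _ "degree b"] bound.intro)
        (simp add: weyl_s_poly_def coeff_eq_0 weyl_const_def mpoly_const_hom)
  qed simp
  then have pc: "?p \<in> carrier (UP weyl_ring)" by (simp add: UP_def)
  have co: "UnivPoly.coeff (UP weyl_ring) ?p j = weyl_const (Polynomial.coeff b j)" for j
    using up by (simp add: UP_def weyl_s_poly_def)
  have deg: "deg weyl_ring ?p \<le> degree b"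
    by (rule Ls.U.deg_aboveI[OF _ pc]) (simp add: co coeff_eq_0 weyl_const_def mpoly_const_hom)
  have pow: "(s_act [:0, 1:] ^^ j) x = s_act (Polynomial.monom 1 j) x" for j
    using x by (induction j) (simp_all add: s_act_one monom_Suc s_act_mult[symmetric])
  have mon: "weyl_const c \<odot>\<^bsub>L.T\<^esub> (s_act [:0, 1:] ^^ j) x = s_act (Polynomial.monom c j) x" for c j
    using x s_act_mult[OF x, of "[:c:]" "Polynomial.monom 1 j"]
    by (simp add: pow s_act_const closed smult_monom)
  have sum: "(\<Oplus>\<^bsub>L.T\<^esub>j\<in>{..m}. weyl_const (Polynomial.coeff b j) \<odot>\<^bsub>L.T\<^esub> (s_act [:0, 1:] ^^ j) x) =
      s_act (\<Sum>j\<le>m. Polynomial.monom (Polynomial.coeff b j) j) x" for m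
    unfolding mon
  proof (induction m)
    case (Suc m)
    then show ?case
      using x by (simp add: closed Pi_def s_act_add L.T.a_comm)
  qed (simp add: closed x Pi_def)
  have "?p \<odot>\<^bsub>Ls.Ts\<^esub> x = Ls.pact (degree b) ?p x"
    using Ls.pact_bound[OF pc x deg] by (simp add: Ls.poly_module_smult)
  also have "\<dots> = s_act b x"
    unfolding co sum poly_as_sum_of_monoms ..
  finally show ?thesis .
qed

lemma b_relation_iff: "b_relation M u f b \<longleftrightarrow> s_act b (u_fs 0) \<in> Ds_span (u_fs 1)"
  by (simp add: b_relation_def tensor_fs_module weyl_s_poly_smult u_fs_closed)

lemma b_relation_add: "b_relation M u f b \<Longrightarrow> b_relation M u f c \<Longrightarrow> b_relation M u f (b + c)"
  by (simp add: b_relation_iff s_act_add u_fs_closed Ds_submodule_add[OF Ds_span_submodule])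

lemma b_relation_mult: "b_relation M u f b \<Longrightarrow> b_relation M u f (c * b)"
  by (simp add: b_relation_iff s_act_mult u_fs_closed Ds_submodule_s_act[OF Ds_span_submodule])

text \<open>
  The polynomials that satisfy the functional equation form an ideal of \<open>K[s]\<close>, so the definite description
  behind \<^const>\<open>b_function\<close> denotes its monic generator.
\<close>

lemma b_function:
  assumes "b_function_exists M u f"
  shows "lead_coeff (b_function M u f) = 1" "b_relation M u f (b_function M u f)"
    "c \<noteq> 0 \<Longrightarrow> b_relation M u f c \<Longrightarrow> degree (b_function M u f) \<le> degree c"
proof -
  have smult: "b_relation M u f (Polynomial.smult a p)" if "b_relation M u f p" for a p
    using b_relation_mult[OF that, of "[:a:]"] by simp
  have diff: "b_relation M u f (p - q)" if "b_relation M u f p" "b_relation M u f q" for p q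
    using b_relation_add[OF that(1) smult[OF that(2), of "- 1"]] by simp
  obtain b where "b \<noteq> 0" "b_relation M u f b"
    using assms by (auto simp: b_function_exists_def)
  from theI'[OF ex1_minimal_monic[of b "b_relation M u f", OF this diff smult]]
  show "lead_coeff (b_function M u f) = 1" "b_relation M u f (b_function M u f)"
    "c \<noteq> 0 \<Longrightarrow> b_relation M u f c \<Longrightarrow> degree (b_function M u f) \<le> degree c"
    unfolding b_function_def by auto
qed

section \<open>Powers of \<open>f\<close> in the localization\<close>

lemma mpoly_u_f: "weyl_mpoly a \<odot>\<^bsub>Loc.T\<^esub> u_f j = tensor_elem M (loc_module f) u (ratfun_mpoly a * f_power f j)"
  using loc_carrier_f_power[OF f, of j] u_closed by (simp add: Loc.mpoly_elem_right loc_module_simps[OF f])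

lemma u_f_mono:
  assumes S: "submodule S weyl_ring Loc.T" and j: "u_f j \<in> S" and "j \<le> i"
  shows "u_f i \<in> S"
proof -
  have "ratfun_mpoly (f ^ nat (i - j)) * f_power f j = f_power f i"
    using f_power_simps(5)[OF f, of "nat (i - j)"] f_power_simps(3)[OF f, of "i - j" j] assms(3) by simp
  then have "weyl_mpoly (f ^ nat (i - j)) \<odot>\<^bsub>Loc.T\<^esub> u_f j = u_f i" by (simp add: mpoly_u_f)
  then show ?thesis using Loc.T.submodule_smult[OF S _ j, of "weyl_mpoly (f ^ nat (i - j))"] by simp
qed

text \<open>
  Every element of \<open>K[x, f\<^sup>-\<^sup>1]\<close> is \<open>a f\<^bsup>-n\<^esup>\<close> with \<open>a \<in> K[x]\<close>, so the \<open>u \<otimes> f\<^bsup>-n\<^esup>\<close> generate the localization.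
\<close>

lemma submodule_eq_localization:
  assumes S: "submodule S weyl_ring Loc.T" and uS: "\<And>n. u_f (- int n) \<in> S"
  shows "S = carrier Loc.T"
proof (rule Loc.submodule_eq_carrier[OF S u])
  fix g assume "g \<in> carrier (loc_module f)"
  then obtain a n where "g = Fract a (f ^ n)" by (auto simp: loc_module_simps[OF f] elim: loc_carrierE)
  then have "tensor_elem M (loc_module f) u g = weyl_mpoly a \<odot>\<^bsub>Loc.T\<^esub> u_f (- int n)"
    by (simp add: mpoly_u_f Fract_f_power[OF f])
  then show "tensor_elem M (loc_module f) u g \<in> S"
    using Loc.T.submodule_smult[OF S _ uS[of n], of "weyl_mpoly a"] by simp
qed

text \<open>
  Specializing the functional equation at \<open>s = j\<close> gives \<open>b(j) (u \<otimes> f\<^sup>j) \<in> D\<^sub>X (u \<otimes> f\<^bsup>j+1\<^esup>)\<close>.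
\<close>

lemma u_f_in_submodule_step:
  assumes rel: "b_relation M u f b" and bj: "poly b (of_int j) \<noteq> 0"
    and S: "submodule S weyl_ring Loc.T" and uS: "u_f (j + 1) \<in> S"
  shows "u_f j \<in> S"
proof -
  let ?V = "{x \<in> carrier L.T. spec j x \<in> S}"
  have "Ds_submodule ?V"
    by (rule Ds_submoduleI[OF submodule_vimage[OF L.left_module_tensor Loc.left_module_tensor spec_weyl_hom S]])
      (auto simp: closed spec_s_act Loc.T.submodule_smult[OF S])
  moreover have "u_fs 1 \<in> ?V" using uS by (simp add: spec_u_fs u_fs_closed)
  ultimately have "s_act b (u_fs 0) \<in> ?V"
    by (rule Ds.cyclic_submodule_least) (use rel in \<open>simp add: b_relation_iff\<close>)
  then have "weyl_const (poly b (of_int j)) \<odot>\<^bsub>Loc.T\<^esub> u_f j \<in> S"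
    by (simp add: spec_s_act u_fs_closed spec_u_fs)
  then show ?thesis
    by (rule weyl_const_smult_cancel[OF S Loc.left_module_tensor u_f_closed bj])
qed

lemma localization_generated_if_no_roots:
  assumes rel: "b_relation M u f b" and roots: "\<And>j::int. j < - int k \<Longrightarrow> poly b (of_int j) \<noteq> 0"
  shows "generated_by weyl_ring Loc.T (u_f (- int k))"
proof -
  let ?S = "cyclic_submodule weyl_ring Loc.T (u_f (- int k))"
  have S: "submodule ?S weyl_ring Loc.T" by (rule Loc.T.cyclic_submodule[OF u_f_closed])
  have "u_f (- int k - int n) \<in> ?S" for n
  proof (induction n)
    case 0
    show ?case using Loc.T.cyclic_submodule_self[OF u_f_closed] by simp
  next
    case (Suc n)
    have "- int k - int (Suc n) + 1 = - int k - int n" by simp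
    then show ?case using Suc by - (rule u_f_in_submodule_step[OF rel roots S], simp_all)
  qed
  then have "u_f (- int n) \<in> ?S" for n
    by (rule u_f_mono[OF S, of "- int k - int n"]) simp
  then have "?S = carrier Loc.T" by (rule submodule_eq_localization[OF S])
  then show ?thesis by (simp add: Loc.T.generated_by_iff[OF u_f_closed])
qed

section \<open>The smallest integer root\<close>

text \<open>
  Up to the factor \<open>b(s - 1) \<cdots> b(s - n)\<close>, the element \<open>u \<otimes> f\<^bsup>s-n\<^esup>\<close> lies in \<open>D\<^sub>X[s] (u \<otimes> f\<^sup>s)\<close>, and
  these elements generate \<open>M \<otimes> L\<close>. If \<open>b\<close> has no root among the integers below \<open>j\<close>, the factor does
  not vanish at \<open>j\<close>.
\<close>

lemma multiple_in_Ds_span: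
  assumes rel: "b_relation M u f b" and nz: "\<And>i::int. i < j \<Longrightarrow> poly b (of_int i) \<noteq> 0"
    and x: "x \<in> carrier L.T"
  obtains B where "poly B (of_int j) \<noteq> 0" "s_act B x \<in> Ds_span (u_fs 0)"
proof -
  define V where "V = {x \<in> carrier L.T. \<exists>B. poly B (of_int j) \<noteq> 0 \<and> s_act B x \<in> Ds_span (u_fs 0)}"
  note N = Ds_span_submodule[OF u_fs_closed[of 0]]
  \<comment> \<open>Closed under addition because two factors can be multiplied.\<close>
  have V: "Ds_submodule V"
  proof (rule Ds_submoduleI)
    show "submodule V weyl_ring L.T"
    proof (rule L.T.submoduleI)
      have "s_act 1 \<zero>\<^bsub>L.T\<^esub> \<in> Ds_span (u_fs 0)"
        using L.T.submodule_zero[OF Ds_submodule_weyl[OF N]] by (simp add: hom_zero)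
      then show "\<zero>\<^bsub>L.T\<^esub> \<in> V" unfolding V_def by (auto intro!: exI[of _ 1])
    next
      fix x y assume "x \<in> V" "y \<in> V"
      then obtain B B' where x: "x \<in> carrier L.T" "poly B (of_int j) \<noteq> 0" "s_act B x \<in> Ds_span (u_fs 0)"
        and y: "y \<in> carrier L.T" "poly B' (of_int j) \<noteq> 0" "s_act B' y \<in> Ds_span (u_fs 0)"
        unfolding V_def by auto
      have "s_act (B' * B) (x \<oplus>\<^bsub>L.T\<^esub> y) = s_act B' (s_act B x) \<oplus>\<^bsub>L.T\<^esub> s_act B (s_act B' y)"
        using x(1) y(1) by (simp add: additive s_act_mult[symmetric] mult.commute)
      also have "\<dots> \<in> Ds_span (u_fs 0)"
        by (intro Ds_submodule_add[OF N] Ds_submodule_s_act[OF N] x y)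
      finally show "x \<oplus>\<^bsub>L.T\<^esub> y \<in> V"
        unfolding V_def using x y by (auto intro!: exI[of _ "B' * B"])
    next
      fix Q x assume "x \<in> V"
      then show "Q \<odot>\<^bsub>L.T\<^esub> x \<in> V"
        unfolding V_def by (auto simp: linear intro: Ds_submodule_smult[OF N] L.T.weyl_smult)
    qed (auto simp: V_def)
    fix x assume "x \<in> V"
    then obtain B where x: "x \<in> carrier L.T" "poly B (of_int j) \<noteq> 0" "s_act B x \<in> Ds_span (u_fs 0)"
      unfolding V_def by auto
    have "s_act B (s_act [:0, 1:] x) = s_act [:0, 1:] (s_act B x)"
      by (rule s_act_commute[OF x(1)])
    also have "\<dots> \<in> Ds_span (u_fs 0)" by (rule Ds_submodule_s[OF N x(3)])
    finally show "s_act [:0, 1:] x \<in> V" unfolding V_def using x closed by auto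
  qed
  have uV: "u_fs (- int n) \<in> V" for n
  proof (induction n)
    case 0
    have "s_act 1 (u_fs 0) \<in> Ds_span (u_fs 0)"
      using Ds_span_self[OF u_fs_closed[of 0]] by (simp add: s_act_one u_fs_closed)
    then show ?case unfolding V_def using u_fs_closed by (auto intro!: exI[of _ 1])
  next
    case (Suc n)
    \<comment> \<open>The functional equation, shifted by \<open>s \<mapsto> s - n - 1\<close>, adds the factor \<open>b(s - n - 1)\<close>.\<close>
    let ?r = "- int n - 1"
    let ?W = "{x \<in> carrier L.T. shift ?r x \<in> V}"
    have "Ds_submodule ?W"
      by (rule Ds_submoduleI[OF submodule_vimage[OF L.left_module_tensor L.left_module_tensor
            shift_weyl_hom Ds_submodule_weyl[OF V]]])
        (auto simp: closed shift_s_act Ds_submodule_s_act[OF V])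
    moreover have "u_fs 1 \<in> ?W" using Suc by (simp add: shift_u_fs u_fs_closed)
    ultimately have "s_act b (u_fs 0) \<in> ?W"
      by (rule Ds.cyclic_submodule_least) (use rel in \<open>simp add: b_relation_iff\<close>)
    then have "s_act (pcompose b [:of_int ?r, 1:]) (u_fs ?r) \<in> V"
      by (simp add: shift_s_act shift_u_fs u_fs_closed)
    then obtain B where B: "poly B (of_int j) \<noteq> 0"
      "s_act B (s_act (pcompose b [:of_int ?r, 1:]) (u_fs ?r)) \<in> Ds_span (u_fs 0)"
      unfolding V_def by blast
    have "poly b (of_int (?r + j)) \<noteq> 0" by (rule nz) simp
    then have "poly (B * pcompose b [:of_int ?r, 1:]) (of_int j) \<noteq> 0"
      using B(1) by (simp add: poly_pcompose)
    moreover have "s_act (B * pcompose b [:of_int ?r, 1:]) (u_fs ?r) \<in> Ds_span (u_fs 0)"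
      using B(2) by (simp add: s_act_mult u_fs_closed)
    ultimately have "u_fs ?r \<in> V" unfolding V_def using u_fs_closed by blast
    moreover have "?r = - int (Suc n)" by simp
    ultimately show ?case by simp
  qed
  have "V = carrier L.T"
  proof (rule L.submodule_eq_carrier[OF Ds_submodule_weyl[OF V] u])
    fix p assume "p \<in> carrier (fs_module f)"
    then have "p \<in> loc_polys f" by (simp add: carrier_fs_module[OF f])
    then show "tensor_elem M (fs_module f) u p \<in> V"
    \<comment> \<open>Horner's scheme in \<open>s\<close>, with coefficients \<open>a f\<^bsup>-n\<^esup>\<close>.\<close>
    proof (induction p rule: loc_polys_induct)
      case zero
      have "tensor_elem M (fs_module f) u 0 = s_act 0 (u_fs 0)" by (simp add: s_act_elem)
      then show ?case using Ds_submodule_s_act[OF V uV[of 0], of 0] by simp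
    next
      case (pCons g p)
      obtain a n where g: "g = Fract a (f ^ n)" using pCons(1) by (rule loc_carrierE)
      have p: "p \<in> carrier (fs_module f)" using pCons by (simp add: carrier_fs_module[OF f])
      have 1: "[:g:] = weyl_mpoly a \<odot>\<^bsub>fs_module f\<^esub> fs_power f (- int n)"
        using fs_module_simps(3)[OF f fs_power_closed] by (simp add: g fs_power_def Fract_f_power[OF f])
      have 2: "pCons g p = [:g:] \<oplus>\<^bsub>fs_module f\<^esub> (ratfun_poly [:0, 1:] * p)"
        by (simp add: fs_module_simps(2)[OF f])
      have "tensor_elem M (fs_module f) u (pCons g p) =
          weyl_mpoly a \<odot>\<^bsub>L.T\<^esub> u_fs (- int n) \<oplus>\<^bsub>L.T\<^esub> s_act [:0, 1:] (tensor_elem M (fs_module f) u p)"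
        unfolding 2 1 using p u_closed fs_power_closed[of "- int n"]
        by (simp only: L.elem_add_right L.N.c_closed mult_closed s_act_elem L.mpoly_elem_right)
      then show ?case
        using pCons by (simp add: Ds_submodule_add[OF V] Ds_submodule_smult[OF V] Ds_submodule_s[OF V] uV)
    qed
  qed
  then show thesis using that x unfolding V_def by blast
qed

text \<open>
  Write the factor of \<open>multiple_in_Ds_span\<close> as \<open>B = B(j) + (s - j) B'\<close>. Both \<open>B(s) x\<close> and \<open>B'(s) (s - j) x\<close>
  lie in \<open>D\<^sub>X[s] (u \<otimes> f\<^sup>s)\<close>, hence so does \<open>B(j) x\<close>, and \<open>B(j)\<close> is a nonzero constant.
\<close>

lemma divide_in_Ds_span:
  assumes rel: "b_relation M u f b" and nz: "\<And>i::int. i < j \<Longrightarrow> poly b (of_int i) \<noteq> 0"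
    and x: "x \<in> carrier L.T" and dx: "s_act [:- of_int j, 1:] x \<in> Ds_span (u_fs 0)"
  shows "x \<in> Ds_span (u_fs 0)"
proof -
  note N = Ds_span_submodule[OF u_fs_closed[of 0]]
  obtain B where B: "poly B (of_int j) \<noteq> 0" "s_act B x \<in> Ds_span (u_fs 0)"
    using multiple_in_Ds_span[OF rel nz x] by blast
  define B' where "B' = synthetic_div B (of_int j)"
  have "B = [:poly B (of_int j):] + B' * [:- of_int j, 1:]"
    using synthetic_div_correct'[of "of_int j" B] by (metis B'_def add.commute mult.commute)
  then have "s_act B x = weyl_const (poly B (of_int j)) \<odot>\<^bsub>L.T\<^esub> x \<oplus>\<^bsub>L.T\<^esub> s_act B' (s_act [:- of_int j, 1:] x)"
    using x by (metis s_act_add s_act_const s_act_mult)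
  moreover have "s_act B' (s_act [:- of_int j, 1:] x) \<in> Ds_span (u_fs 0)"
    by (rule Ds_submodule_s_act[OF N dx])
  ultimately have "weyl_const (poly B (of_int j)) \<odot>\<^bsub>L.T\<^esub> x \<in> Ds_span (u_fs 0)"
    using B(2) L.T.submodule_cancel[OF Ds_submodule_weyl[OF N]] L.T.weyl_smult(1)[OF x] by metis
  then show ?thesis
    by (rule weyl_const_smult_cancel[OF Ds_submodule_weyl[OF N] L.left_module_tensor x B(1)])
qed

text \<open>
  If \<open>u \<otimes> f\<^sup>j = Q (u \<otimes> f\<^bsup>j+1\<^esup>)\<close>, then \<open>u \<otimes> f\<^sup>s = Q (u \<otimes> f\<^bsup>s+1\<^esup>) + (s - j) z\<close> with \<open>z \<in> D\<^sub>X[s] (u \<otimes> f\<^sup>s)\<close>. Applying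
  \<open>c(s)\<close> turns the last summand into \<open>b(s) z\<close>, which lies in \<open>D\<^sub>X[s] (u \<otimes> f\<^bsup>s+1\<^esup>)\<close> as \<open>b(s) (u \<otimes> f\<^sup>s)\<close> does.
\<close>

lemma b_relation_div_root:
  assumes rel: "b_relation M u f b" and b: "b = [:- of_int j, 1:] * c"
    and nz: "\<And>i::int. i < j \<Longrightarrow> poly b (of_int i) \<noteq> 0"
    and gen: "u_f j \<in> cyclic_submodule weyl_ring Loc.T (u_f (j + 1))"
  shows "b_relation M u f c"
proof -
  note N = Ds_span_submodule[OF u_fs_closed[of 0]] and N1 = Ds_span_submodule[OF u_fs_closed[of 1]]
  obtain Q where Q: "u_f j = Q \<odot>\<^bsub>Loc.T\<^esub> u_f (j + 1)" using gen by (auto simp: cyclic_submodule_def)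
  let ?y = "Q \<odot>\<^bsub>L.T\<^esub> u_fs 1"
  have y: "?y \<in> carrier L.T" by (rule L.T.weyl_smult(1)[OF u_fs_closed])
  have "spec j (u_fs 0) = spec j ?y" using Q by (simp add: linear u_fs_closed spec_u_fs)
  then obtain z where z: "z \<in> carrier L.T" and eq: "u_fs 0 = ?y \<oplus>\<^bsub>L.T\<^esub> s_act [:- of_int j, 1:] z"
    using specialize_eqD[OF u_fs_closed y] by blast
  have dz: "s_act [:- of_int j, 1:] z \<in> carrier L.T" using z by (rule closed)
  have "u_fs 1 = weyl_mpoly f \<odot>\<^bsub>L.T\<^esub> u_fs 0"
    using u_closed fs_power_closed[of 0]
    by (simp add: L.mpoly_elem_right fs_module_simps(3)[OF f]) (simp add: fs_power_def f_power_simps[OF f])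
  then have "?y \<in> Ds_span (u_fs 0)"
    using Ds_span_self[OF u_fs_closed[of 0]] by (simp add: Ds_submodule_smult[OF N])
  moreover have "s_act [:- of_int j, 1:] z \<oplus>\<^bsub>L.T\<^esub> ?y \<in> Ds_span (u_fs 0)"
    using eq Ds_span_self[OF u_fs_closed[of 0]] L.T.a_comm[OF y dz] by metis
  ultimately have "s_act [:- of_int j, 1:] z \<in> Ds_span (u_fs 0)"
    using L.T.submodule_cancel[OF Ds_submodule_weyl[OF N] dz] by blast
  with rel nz z have zN: "z \<in> Ds_span (u_fs 0)" by (rule divide_in_Ds_span)
  have "Ds_submodule {x \<in> carrier L.T. s_act b x \<in> Ds_span (u_fs 1)}" (is "Ds_submodule ?W")
    by (rule Ds_submoduleI[OF submodule_vimage[OF L.left_module_tensor L.left_module_tensor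
          s_act_weyl_hom Ds_submodule_weyl[OF N1]]])
      (auto simp: closed s_act_commute[of _ b] intro: Ds_submodule_s[OF N1])
  moreover have "u_fs 0 \<in> ?W" using rel by (simp add: b_relation_iff u_fs_closed)
  ultimately have bz: "s_act b z \<in> Ds_span (u_fs 1)"
    using Ds.cyclic_submodule_least[OF _ _ zN] by blast
  have "s_act c (u_fs 0) = s_act c ?y \<oplus>\<^bsub>L.T\<^esub> s_act c (s_act [:- of_int j, 1:] z)"
    using eq additive(1)[OF y dz, of c] by metis
  also have "\<dots> = Q \<odot>\<^bsub>L.T\<^esub> s_act c (u_fs 1) \<oplus>\<^bsub>L.T\<^esub> s_act b z"
    using s_act_mult[OF z, of c "[:- of_int j, 1:]"] unfolding b by (simp add: linear u_fs_closed mult.commute)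
  also have "\<dots> \<in> Ds_span (u_fs 1)"
    by (intro Ds_submodule_add[OF N1] Ds_submodule_smult[OF N1] Ds_submodule_s_act[OF N1] Ds_span_self u_fs_closed bz)
  finally show ?thesis by (simp add: b_relation_iff)
qed

lemma no_roots_if_localization_generated:
  assumes ex: "b_function_exists M u f" and gen: "generated_by weyl_ring Loc.T (u_f (- int k))"
    and j: "j < - int k"
  shows "poly (b_function M u f) (of_int j) \<noteq> 0"
proof
  let ?b = "b_function M u f"
  assume root: "poly ?b (of_int j) = 0"
  have b0: "?b \<noteq> 0" using b_function(1)[OF ex] by auto
  let ?R = "{i::int. i < - int k \<and> poly ?b (of_int i) = 0}"
  have "finite (of_int -` {x. poly ?b x = 0} :: int set)"
    by (rule finite_vimageI[OF poly_roots_finite[OF b0]]) (simp add: inj_on_def)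
  then have fin: "finite ?R" by (rule finite_subset[rotated]) auto
  define j0 where "j0 = Min ?R"
  have "j0 \<in> ?R" unfolding j0_def using root j by (intro Min_in fin) auto
  then have j0: "j0 < - int k" "poly ?b (of_int j0) = 0" by auto
  have nz: "poly ?b (of_int i) \<noteq> 0" if "i < j0" for i
    using Min_le[OF fin, of i] that j0 unfolding j0_def by force
  obtain c where c: "?b = [:- of_int j0, 1:] * c" using j0(2) by (auto simp: poly_eq_0_iff_dvd elim: dvdE)
  let ?S = "cyclic_submodule weyl_ring Loc.T (u_f (j0 + 1))"
  have S: "submodule ?S weyl_ring Loc.T" by (rule Loc.T.cyclic_submodule[OF u_f_closed])
  have "u_f (- int k) \<in> ?S"
    using j0(1) by (intro u_f_mono[OF S Loc.T.cyclic_submodule_self[OF u_f_closed]]) simp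
  then have "u_f j0 \<in> ?S"
    using gen u_f_closed[of j0] Loc.T.generated_by_iff[OF u_f_closed] Loc.T.cyclic_submodule_least[OF S] by blast
  then have "b_relation M u f c"
    using b_function(2)[OF ex] nz by (intro b_relation_div_root[OF _ c]) auto
  moreover have "c \<noteq> 0" using c b0 by auto
  moreover have "degree ?b = Suc (degree c)" unfolding c using \<open>c \<noteq> 0\<close> by (subst degree_mult_eq) auto
  ultimately show False using b_function(3)[OF ex, of c] by simp
qed

section \<open>Local cohomology\<close>

text \<open>
  Since \<open>\<partial>\<^sub>i 1 = 0\<close>, the map \<open>m \<mapsto> m \<otimes> 1\<close> is linear over \<open>D\<^sub>X\<close>; its image is thus generated by \<open>u \<otimes> 1\<close>.
\<close>

lemma loc_image_submodule: "submodule (loc_image M f) weyl_ring Loc.T"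
  and loc_image_cyclic: "loc_image M f \<subseteq> cyclic_submodule weyl_ring Loc.T (u_f 0)"
proof -
  interpret MM: weyl_left_module M by (rule weyl_left_module.intro[OF M])
  let ?i = "\<lambda>m. tensor_elem M (loc_module f) m 1"
  have 1: "(1 :: ('n, 'k) ratfun) \<in> carrier (loc_module f)"
    by (simp add: loc_module_simps[OF f] loc_carrier_0_1)
  have d1: "weyl_d i \<odot>\<^bsub>loc_module f\<^esub> (1 :: ('n, 'k) ratfun) = 0" for i
    using ratfun_deriv_of_int[of i 1] by (simp add: loc_module_simps[OF f] loc_carrier_0_1)
  have zero: "tensor_elem M (loc_module f) m 0 = \<zero>\<^bsub>Loc.T\<^esub>" if m: "m \<in> carrier M" for m
    using Loc.elem_add_right[OF m, of 0 0] Loc.elem_closed[OF m, of 0]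
    by (simp add: loc_module_simps[OF f] loc_carrier_0_1)
  have hom: "?i \<in> weyl_hom M Loc.T"
    using 1 d1 zero by (auto simp: weyl_hom_def mpoly_hom_def Loc.elem_closed Loc.elem_add_left Loc.mpoly_elem Loc.d_elem
      MM.weyl_smult)
  have eq: "loc_image M f = {?i m |m. m \<in> carrier M}"
    by (simp add: loc_image_def loc_elem_def)
  have sm: "P \<odot>\<^bsub>Loc.T\<^esub> ?i m = ?i (P \<odot>\<^bsub>M\<^esub> m)" if "m \<in> carrier M" for P m
    using weyl_hom_smult[OF M Loc.left_module_tensor hom that] ..
  show "submodule (loc_image M f) weyl_ring Loc.T"
  proof (rule Loc.T.submoduleI)
    show "\<zero>\<^bsub>Loc.T\<^esub> \<in> loc_image M f"
      unfolding eq using mpoly_hom_zero[OF M Loc.left_module_tensor weyl_hom_mpoly_hom[OF hom]]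
      by (auto intro!: exI[of _ "\<zero>\<^bsub>M\<^esub>"])
  next
    fix x y assume "x \<in> loc_image M f" "y \<in> loc_image M f"
    then obtain m m' where "m \<in> carrier M" "m' \<in> carrier M" "x = ?i m" "y = ?i m'" unfolding eq by auto
    then show "x \<oplus>\<^bsub>Loc.T\<^esub> y \<in> loc_image M f"
      unfolding eq using 1 by (auto intro!: exI[of _ "m \<oplus>\<^bsub>M\<^esub> m'"] simp: Loc.elem_add_left)
  qed (use 1 in \<open>auto simp: eq sm Loc.elem_closed MM.weyl_smult\<close>)
  show "loc_image M f \<subseteq> cyclic_submodule weyl_ring Loc.T (u_f 0)"
  proof
    fix x assume "x \<in> loc_image M f"
    then obtain m where m: "m \<in> carrier M" "x = ?i m" unfolding eq by auto
    then obtain P where "m = P \<odot>\<^bsub>M\<^esub> u" using u unfolding generated_by_def cyclic_submodule_def by blast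
    then have "x = P \<odot>\<^bsub>Loc.T\<^esub> u_f 0" using m sm[OF u_closed] by (simp add: f_power_simps[OF f])
    then show "x \<in> cyclic_submodule weyl_ring Loc.T (u_f 0)" unfolding cyclic_submodule_def by auto
  qed
qed

lemma local_cohomology_generated_iff:
  "generated_by weyl_ring (local_cohomology M f) (cohomology_class M f (u_f (- int k))) \<longleftrightarrow>
   generated_by weyl_ring Loc.T (u_f (- int k))"
proof -
  let ?w = "u_f (- int k)" and ?S = "cyclic_submodule weyl_ring Loc.T (u_f (- int k))"
  have S: "submodule ?S weyl_ring Loc.T" by (rule Loc.T.cyclic_submodule[OF u_f_closed])
  have "u_f 0 \<in> ?S" by (rule u_f_mono[OF S Loc.T.cyclic_submodule_self[OF u_f_closed]]) simp
  then have im: "loc_image M f \<subseteq> ?S"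
    using loc_image_cyclic Loc.T.cyclic_submodule_least[OF S] by blast
  have "generated_by weyl_ring (local_cohomology M f) (cohomology_class M f ?w) \<longleftrightarrow>
      (\<forall>x\<in>carrier Loc.T. \<exists>n\<in>loc_image M f. \<exists>P\<in>carrier weyl_ring. x = n \<oplus>\<^bsub>Loc.T\<^esub> P \<odot>\<^bsub>Loc.T\<^esub> ?w)"
    unfolding local_cohomology_def cohomology_class_def localization_def
    by (rule Loc.T.generated_by_quotient_iff[OF loc_image_submodule u_f_closed])
  also have "\<dots> \<longleftrightarrow> carrier Loc.T \<subseteq> ?S"
  proof (intro iffI ballI subsetI)
    fix x assume "\<forall>x\<in>carrier Loc.T. \<exists>n\<in>loc_image M f. \<exists>P\<in>carrier weyl_ring. x = n \<oplus>\<^bsub>Loc.T\<^esub> P \<odot>\<^bsub>Loc.T\<^esub> ?w"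
      "x \<in> carrier Loc.T"
    then obtain n P where "n \<in> loc_image M f" "x = n \<oplus>\<^bsub>Loc.T\<^esub> P \<odot>\<^bsub>Loc.T\<^esub> ?w" by blast
    moreover have "P \<odot>\<^bsub>Loc.T\<^esub> ?w \<in> ?S" unfolding cyclic_submodule_def by auto
    ultimately show "x \<in> ?S" using im Loc.T.submodule_add[OF S] by blast
  next
    fix x assume "carrier Loc.T \<subseteq> ?S" "x \<in> carrier Loc.T"
    then obtain P where "x = P \<odot>\<^bsub>Loc.T\<^esub> ?w" unfolding cyclic_submodule_def by auto
    then have "x = \<zero>\<^bsub>Loc.T\<^esub> \<oplus>\<^bsub>Loc.T\<^esub> P \<odot>\<^bsub>Loc.T\<^esub> ?w" using \<open>x \<in> carrier Loc.T\<close> by simp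
    then show "\<exists>n\<in>loc_image M f. \<exists>P\<in>carrier weyl_ring. x = n \<oplus>\<^bsub>Loc.T\<^esub> P \<odot>\<^bsub>Loc.T\<^esub> ?w"
      using Loc.T.submodule_zero[OF loc_image_submodule] by auto
  qed
  also have "\<dots> \<longleftrightarrow> generated_by weyl_ring Loc.T ?w"
    by (rule Loc.T.generated_by_iff[OF u_f_closed, symmetric])
  finally show ?thesis .
qed

end

theorem corollary1p8:
  fixes M :: "(('n::{finite,linorder}, 'k::field_char_0) weyl, 'm) module"
    and u :: 'm and f :: "('n, 'k) mpoly" and k :: nat
  assumes "left_module weyl_ring M"
    and "generated_by weyl_ring M u"
    and "\<nexists>c. f = mpoly_const c"
    and "b_function_exists M u f"
  shows "((\<forall>j::int. j < - int k \<longrightarrow> poly (b_function M u f) (of_int j) \<noteq> 0) \<longleftrightarrow>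
          generated_by weyl_ring (localization M f) (loc_elem M f u (f_power f (- int k)))) \<and>
         (generated_by weyl_ring (localization M f) (loc_elem M f u (f_power f (- int k))) \<longleftrightarrow>
          generated_by weyl_ring (local_cohomology M f)
            (cohomology_class M f (loc_elem M f u (f_power f (- int k)))))"
proof -
  have "f \<noteq> 0" using assms(3) mpoly_const_hom(1) by metis
  then interpret cyclic_module_and_poly M u f
    using assms(1,2) by (intro cyclic_module_and_poly.intro)
  show ?thesis
    using localization_generated_if_no_roots[OF b_function(2)[OF assms(4)], of k]
      no_roots_if_localization_generated[OF assms(4), of k] local_cohomology_generated_iff[of k]
    unfolding localization_def loc_elem_def by blast
qed

end
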